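(* Let $M\ge 1$, $l_1,\dots,l_M\in\mathbb{R}$, and let $F_1,\dots,F_M:\mathbb{R}\to[0,+\infty)$ be $C^1$ functions with $F_i(0)=0$ and $\sup_{u\in\mathbb{R}}|F_i'(u)|<+\infty$ for each $i$. Let $x\in\mathbb{R}$ satisfy $\sum_{i=1}^M l_iF_i(x)>0$. For each integer $n\ge1$ let $\{X_t^n\}_{t\ge0}$ be the density-dependent Markov chain with $X_0^n=nx$ which jumps from $u$ to $u+l_i$ at rate $nF_i(u/n)$, $i=1,\dots,M$. Let $x_\infty$, $\tau_r$ and $\tau_r^n$ be as defined in the context. Let $\{a_n\}_{n\ge1}$ be a positive sequence such that \[ \lim_{n\to+\infty}\frac{a_n}{n}=\lim_{n\to+\infty}\frac{\sqrt n}{a_n}=0 . \] Then for any $r\in(x,x_\infty)$ and any $t>0$, \[ \lim_{n\to+\infty}\frac{n}{a_n^2}\log P\left(\frac{n}{a_n}(\tau_r^n-\tau_r)>t\right)=-\frac{t^2}{2\displaystyle\int_x^r\frac{\sum_{i=1}^M l_i^2F_i(u)}{\left(\sum_{i=1}^M l_iF_i(u)\right)^3}\,du} \] and \[ \lim_{n\to+\infty}\frac{n}{a_n^2}\log P\left(\frac{n}{a_n}(\tau_r^n-\tau_r)<-t\right)=-\frac{t^2}{2\displaystyle\int_x^r\frac{\sum_{i=1}^M l_i^2F_i(u)}{\left(\sum_{i=1}^M l_iF_i(u)\right)^3}\,du}. \]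
   Context: $\{X_t^n\}_{t\ge0}$ is the (c\`adl\`ag) continuous-time pure-jump Markov process with state space a subset of $\mathbb{R}$ and generator $\mathcal{L}_nf(u)=n\sum_{i=1}^M F_i(u/n)\,[f(u+l_i)-f(u)]$ for bounded $f:\mathbb{R}\to\mathbb{R}$, started from $X_0^n=nx$. $\{x_t\}_{t\ge0}$ is the unique solution of the ODE $\frac{d}{dt}x_t=\sum_{i=1}^M l_iF_i(x_t)$, $x_0=x$. $x_\infty=\inf\{u>x:\ \sum_{i=1}^M l_iF_i(u)=0\}$, with $x_\infty=+\infty$ if this set is empty. Since $\sum_i l_iF_i(x)>0$, $x_t$ is increasing in $t$ with $\lim_{t\to+\infty}x_t=x_\infty$. For $r\in(x,x_\infty)$, $\tau_r>0$ is the unique time with $x_{\tau_r}=r$; equivalently $\tau_r=\int_x^r\frac{1}{\sum_{i=1}^M l_iF_i(u)}\,du$. For $n\ge1$ and $r\in(x,x_\infty)$, $\tau_r^n=\inf\{t:\ X_t^n\ge nr\}$ (with $\inf\emptyset=+\infty$). *)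

theory Defs
  imports "HOL-Probability.Probability"
begin

section \<open>Markov jump processes given by a generator\<close>

text \<open>
  A time-homogeneous Markov transition function \<open>p t u = P\<^sub>t(u, \<cdot>)\<close> on a Borel set \<open>S\<close> of reals:
  a family of probability kernels on \<open>S\<close> satisfying the Chapman--Kolmogorov equation.
\<close>

definition transition_function :: "real set \<Rightarrow> (real \<Rightarrow> real \<Rightarrow> real measure) \<Rightarrow> bool" where
  "transition_function S p \<longleftrightarrow>
     S \<in> sets borel \<and>
     (\<forall>t\<ge>0. p t \<in> restrict_space borel S \<rightarrow>\<^sub>M prob_algebra (restrict_space borel S)) \<and>
     (\<forall>u\<in>S. p 0 u = return (restrict_space borel S) u) \<and>
     (\<forall>s\<ge>0. \<forall>t\<ge>0. \<forall>u\<in>S. p (s + t) u = p s u \<bind> p t)"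

text \<open>
  The generator is taken in the pointwise sense: the rates may be unbounded, so \<open>L f\<close> need not be
  bounded for bounded \<open>f\<close>, and convergence of the difference quotients cannot be required uniformly.
\<close>

definition has_generator ::
  "real set \<Rightarrow> (real \<Rightarrow> real \<Rightarrow> real measure) \<Rightarrow> ((real \<Rightarrow> real) \<Rightarrow> real \<Rightarrow> real) \<Rightarrow> bool" where
  "has_generator S p L \<longleftrightarrow>
     (\<forall>f \<in> borel_measurable borel. bounded (range f) \<longrightarrow>
       (\<forall>u\<in>S. ((\<lambda>h. ((\<integral>v. f v \<partial>p h u) - f u) / h) \<longlongrightarrow> L f u) (at_right 0)))"

definition natural_filtration :: "'w measure \<Rightarrow> (real \<Rightarrow> 'w \<Rightarrow> real) \<Rightarrow> real \<Rightarrow> 'w measure" where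
  "natural_filtration N X s =
     sigma (space N) (\<Union>r\<in>{0..s}. {X r -` A \<inter> space N | A. A \<in> sets borel})"

definition markov_process ::
  "'w measure \<Rightarrow> real set \<Rightarrow> (real \<Rightarrow> real \<Rightarrow> real measure) \<Rightarrow> (real \<Rightarrow> 'w \<Rightarrow> real) \<Rightarrow> bool" where
  "markov_process N S p X \<longleftrightarrow>
     (\<forall>t\<ge>0. X t \<in> borel_measurable N) \<and>
     (\<forall>t\<ge>0. \<forall>\<omega>\<in>space N. X t \<omega> \<in> S) \<and>
     (\<forall>s\<ge>0. \<forall>t\<ge>0. \<forall>A\<in>sets borel.
        AE \<omega> in N. real_cond_exp N (natural_filtration N X s) (\<lambda>\<omega>. indicator A (X (s + t) \<omega>)) \<omega>
                    = measure (p t (X s \<omega>)) (A \<inter> S))"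

text \<open>
  A path is a cadlag pure-jump path if it is right-continuous with left limits for the
  discrete topology on the reals, i.e. it is piecewise constant with finitely many jumps in
  every bounded time interval.
\<close>

definition pure_jump_path :: "(real \<Rightarrow> real) \<Rightarrow> bool" where
  "pure_jump_path w \<longleftrightarrow>
     (\<forall>t\<ge>0. \<forall>\<^sub>F s in at_right t. w s = w t) \<and>
     (\<forall>t>0. \<exists>c. \<forall>\<^sub>F s in at_left t. w s = c)"

definition pure_jump_markov_process ::
  "'w measure \<Rightarrow> ((real \<Rightarrow> real) \<Rightarrow> real \<Rightarrow> real) \<Rightarrow> real \<Rightarrow> (real \<Rightarrow> 'w \<Rightarrow> real) \<Rightarrow> bool" where
  "pure_jump_markov_process N L x0 X \<longleftrightarrow>
     prob_space N \<and>
     (\<exists>S p. transition_function S p \<and> has_generator S p L \<and> markov_process N S p X) \<and>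
     (\<forall>\<omega>\<in>space N. pure_jump_path (\<lambda>t. X t \<omega>)) \<and>
     (AE \<omega> in N. X 0 \<omega> = x0)"

section \<open>Density-dependent Markov chains and their fluid limit\<close>

definition dd_generator ::
  "nat \<Rightarrow> (nat \<Rightarrow> real) \<Rightarrow> (nat \<Rightarrow> real \<Rightarrow> real) \<Rightarrow> nat \<Rightarrow> (real \<Rightarrow> real) \<Rightarrow> real \<Rightarrow> real" where
  "dd_generator M l F n f u = real n * (\<Sum>i=1..M. F i (u / real n) * (f (u + l i) - f u))"

definition drift :: "nat \<Rightarrow> (nat \<Rightarrow> real) \<Rightarrow> (nat \<Rightarrow> real \<Rightarrow> real) \<Rightarrow> real \<Rightarrow> real" where
  "drift M l F u = (\<Sum>i=1..M. l i * F i u)"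

text \<open>
  The choice operator below picks a solution on \<open>[0, \<infinity>)\<close>; the solution is unique there, and its
  (arbitrary) values at negative times are never used.
\<close>

definition fluid_path :: "(real \<Rightarrow> real) \<Rightarrow> real \<Rightarrow> real \<Rightarrow> real" where
  "fluid_path b x = (SOME y. y 0 = x \<and>
     (\<forall>t\<ge>0. (y has_real_derivative b (y t)) (at t within {0..})))"

definition fluid_hitting_time :: "(real \<Rightarrow> real) \<Rightarrow> real \<Rightarrow> real \<Rightarrow> real" where
  "fluid_hitting_time b x r = (THE s. s > 0 \<and> fluid_path b x s = r)"

definition x_infinity :: "(real \<Rightarrow> real) \<Rightarrow> real \<Rightarrow> ereal" where
  "x_infinity b x = Inf (ereal ` {u. u > x \<and> b u = 0})"

definition chain_hitting_time :: "(real \<Rightarrow> 'w \<Rightarrow> real) \<Rightarrow> real \<Rightarrow> 'w \<Rightarrow> ereal" where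
  "chain_hitting_time X c \<omega> = Inf (ereal ` {t. t \<ge> 0 \<and> X t \<omega> \<ge> c})"

text \<open>Logarithm of a nonnegative real, with \<open>log 0 = -\<infinity>\<close> (the library has \<open>ln 0 = 0\<close>).\<close>

definition ext_ln :: "real \<Rightarrow> ereal" where
  "ext_ln q = (if q \<le> 0 then -\<infinity> else ereal (ln q))"

end

theory Submission
  imports Defs
begin

text \<open>
  Let \<open>b\<close> be the drift, \<open>\<sigma>\<^sup>2 = \<Sum> l\<^sub>i\<^sup>2 F\<^sub>i\<close>, \<open>G' = 1 / b\<close> and \<open>K' = - \<sigma>\<^sup>2 / (2 b\<^sup>3)\<close>, with \<open>G\<close> and \<open>K\<close>
  vanishing at \<open>x\<close>, and put \<open>s\<^sub>n = a\<^sub>n\<^sup>2 / n\<close>. For every real \<open>\<theta>\<close> the function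
  \<open>f u = exp (\<theta> a\<^sub>n G (u / n) + \<theta>\<^sup>2 s\<^sub>n K (u / n))\<close> is an approximate eigenfunction of the generator: near
  \<open>[x, r]\<close> one has \<open>L f = (\<theta> a\<^sub>n + o (s\<^sub>n)) f\<close>, because \<open>K\<close> cancels the second-order term in the
  expansion of the exponential. Stopping \<open>exp (- \<theta> a\<^sub>n t) f (X\<^sub>t)\<close> at the exit from a region below \<open>r\<close>
  (and at a fixed time beyond \<open>G r = \<tau>\<^sub>r\<close>) therefore gives
  \<open>E exp (\<theta> s\<^sub>n Z\<^sub>n) = exp (s\<^sub>n (\<theta>\<^sup>2 V / 2 + o (1)))\<close> for \<open>Z\<^sub>n = (n / a\<^sub>n) (\<tau>\<^sub>r - \<tau>\<^sub>r\<^sup>n)\<close> and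
  \<open>V = - 2 K r\<close>, up to an event on which \<open>G (X / n)\<close> lags behind the elapsed time by a fixed amount and
  whose probability is \<open>exp (- c a\<^sub>n)\<close>, hence negligible. Since this holds for all \<open>\<theta>\<close>, the
  upper bound is Chernoff's and the lower bound follows by tilting the law of the single random variable
  \<open>Z\<^sub>n\<close>; no change of measure on path space is needed.
\<close>

section \<open>Semigroup estimates for jump processes\<close>

text \<open>The generator is given only pointwise, at each bounded measurable function, and the
  rates are unbounded, so no Dynkin formula is at hand. It is rebuilt on a time grid: from a point
  of the region, P_h f exceeds f + h L f by at most O(h^2) uniformly, since only the rates at the
  point and at its neighbours enter; the T / h errors add up to O(h), and piecewise constant paths
  let the grid shrink. \<open>G\<close> is the time that the fluid path needs from \<open>x\<close>,
  so G (X / n) - t is nearly a martingale; up to the factor 1 / n its quadratic variation grows like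
  \<sigma>^2 / b^2 per unit of time, hence \<sigma>^2 / b^3 per unit of space, and \<open>K\<close>
  is minus half of the accumulated amount. The error of the expansion is of order s_n (a_n / n + 1 /
  a_n). Both conditions on \<open>a\<close> enter: sqrt n / a_n -> 0 makes s_n and a_n tend to
  infinity, and a_n / n -> 0 makes s_n = a_n (a_n / n) small against a_n, so that exp (- c a_n)
  drops below every exp (- R s_n).\<close>

lemma right_derivative_increment_le:
  fixes \<phi> :: "real \<Rightarrow> real"
  assumes cont: "continuous_on {0..d} \<phi>" and d: "0 \<le> d"
    and deriv: "\<And>t. 0 \<le> t \<Longrightarrow> t < d \<Longrightarrow> ((\<lambda>h. (\<phi> (t + h) - \<phi> t) / h) \<longlongrightarrow> \<psi> t) (at_right 0)"
    and bound: "\<And>t. 0 \<le> t \<Longrightarrow> t < d \<Longrightarrow> \<psi> t \<le> C"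
  shows "\<phi> d - \<phi> 0 \<le> C * d"
proof -
  have step: "\<phi> d - \<phi> 0 \<le> (C + e) * d" if e: "e > 0" for e
  proof -
    \<comment> \<open>Only right derivatives are available, so the mean value theorem is replaced by
      a supremum argument: at the last point \<open>m\<close> of \<open>S\<close> the right
      derivative is below \<open>C + e\<close>, which would put some \<open>m + h\<close> into
      \<open>S\<close> unless \<open>m = d\<close>.\<close>
    define S where "S = {s \<in> {0..d}. \<phi> s - \<phi> 0 \<le> (C + e) * s}"
    have "closed S"
      unfolding S_def using cont by (intro continuous_on_closed_Collect_le continuous_intros) auto
    have "0 \<in> S" using d by (auto simp: S_def)
    have bdd: "bdd_above S" by (rule bdd_aboveI[of _ d]) (auto simp: S_def)
    define m where "m = Sup S"
    have mS: "m \<in> S"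
      unfolding m_def using \<open>0 \<in> S\<close> bdd \<open>closed S\<close> by (intro closed_contains_Sup) auto
    have "m = d"
    proof (rule ccontr)
      assume "m \<noteq> d"
      with mS have m: "0 \<le> m" "m < d" by (auto simp: S_def)
      have "\<forall>\<^sub>F h in at_right 0. (\<phi> (m + h) - \<phi> m) / h < C + e"
        using deriv[OF m] bound[OF m] e by (intro order_tendstoD) auto
      moreover have "\<forall>\<^sub>F h in at_right 0. 0 < h \<and> h < d - m"
        using m by (auto simp: eventually_at_right_field intro!: exI[of _ "d - m"])
      ultimately have "\<forall>\<^sub>F h in at_right (0::real). 0 < h \<and> h < d - m \<and> (\<phi> (m + h) - \<phi> m) / h < C + e"
        by eventually_elim auto
      then obtain h where h: "0 < h" "h < d - m" "(\<phi> (m + h) - \<phi> m) / h < C + e"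
        using eventually_happens'[OF trivial_limit_at_right_real] by blast
      have "\<phi> (m + h) - \<phi> m \<le> (C + e) * h"
        using h by (simp add: field_simps)
      then have "m + h \<in> S" using h mS m by (auto simp: S_def algebra_simps)
      then have "m + h \<le> m" unfolding m_def using bdd by (intro cSup_upper)
      with h show False by simp
    qed
    with mS show ?thesis by (auto simp: S_def)
  qed
  show ?thesis
  proof (rule field_le_epsilon)
    fix e :: real assume e: "e > 0"
    \<comment> \<open>The slack \<open>e / (d + 1)\<close> costs at most \<open>e\<close> over the
      whole interval and is defined for \<open>d = 0\<close> too.\<close>
    have "\<phi> d - \<phi> 0 \<le> (C + e / (d + 1)) * d"
      using d e by (intro step) auto
    also have "\<dots> = C * d + e * (d / (d + 1))" by (simp add: algebra_simps)
    also have "\<dots> \<le> C * d + e"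
      using d e mult_left_le[of "d / (d + 1)" e] by auto
    finally show "\<phi> d - \<phi> 0 \<le> C * d + e" .
  qed
qed

section \<open>Transition functions with finitely many jump sizes\<close>

locale jump_semigroup =
  fixes S :: "real set" and p :: "real \<Rightarrow> real \<Rightarrow> real measure"
    and M :: nat and c :: "nat \<Rightarrow> real \<Rightarrow> real" and l :: "nat \<Rightarrow> real"
  assumes transition: "transition_function S p"
    and generator: "has_generator S p (\<lambda>f u. \<Sum>i=1..M. c i u * (f (u + l i) - f u))"
    and rate_nonneg: "\<And>i u. i \<in> {1..M} \<Longrightarrow> 0 \<le> c i u"
begin

definition L :: "(real \<Rightarrow> real) \<Rightarrow> real \<Rightarrow> real" where
  "L f u = (\<Sum>i=1..M. c i u * (f (u + l i) - f u))"

definition q :: "real \<Rightarrow> real" where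
  "q u = (\<Sum>i=1..M. c i u)"

text \<open>The value outside \<open>S\<close> is irrelevant; setting it to 0 makes \<open>Pt t f\<close> Borel on the whole line.\<close>

definition Pt :: "real \<Rightarrow> (real \<Rightarrow> real) \<Rightarrow> real \<Rightarrow> real" where
  "Pt t f u = (if u \<in> S then \<integral>v. f v \<partial>p t u else 0)"

lemma S_borel [measurable]: "S \<in> sets borel"
  using transition by (simp add: transition_function_def)

lemma kernel: "t \<ge> 0 \<Longrightarrow> p t \<in> restrict_space borel S \<rightarrow>\<^sub>M prob_algebra (restrict_space borel S)"
  using transition by (simp add: transition_function_def)

lemma kernel_subprob:
  "t \<ge> 0 \<Longrightarrow> p t \<in> restrict_space borel S \<rightarrow>\<^sub>M subprob_algebra (restrict_space borel S)"
  by (intro measurable_prob_algebraD kernel)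

lemma prob_space_kernel: "t \<ge> 0 \<Longrightarrow> u \<in> S \<Longrightarrow> prob_space (p t u)"
  using measurable_space[OF kernel, of t u] by (simp add: space_prob_algebra space_restrict_space)

lemma sets_kernel: "t \<ge> 0 \<Longrightarrow> u \<in> S \<Longrightarrow> sets (p t u) = sets (restrict_space borel S)"
  using measurable_space[OF kernel, of t u] by (simp add: space_prob_algebra space_restrict_space)

lemma space_kernel: "t \<ge> 0 \<Longrightarrow> u \<in> S \<Longrightarrow> space (p t u) = S"
  using sets_eq_imp_space_eq[OF sets_kernel] by (simp add: space_restrict_space)

lemma measurable_kernel:
  assumes "f \<in> borel_measurable borel" "t \<ge> 0" "u \<in> S"
  shows "f \<in> borel_measurable (p t u)"
  using assms measurable_restrict_space1[OF assms(1), of S] sets_kernel[OF assms(2,3)]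
  by (simp cong: measurable_cong_sets)

lemma integrable_kernel:
  fixes f :: "real \<Rightarrow> real"
  assumes "f \<in> borel_measurable borel" "\<And>v. \<bar>f v\<bar> \<le> B" "t \<ge> 0" "u \<in> S"
  shows "integrable (p t u) f"
proof -
  interpret prob_space "p t u" using assms prob_space_kernel by blast
  show ?thesis using assms measurable_kernel by (intro integrable_const_bound[of _ B]) auto
qed

lemma measurable_Pt:
  assumes "f \<in> borel_measurable borel" "t \<ge> 0"
  shows "Pt t f \<in> borel_measurable borel"
proof -
  have "f \<in> borel_measurable (restrict_space borel S)"
    using assms(1) by (rule measurable_restrict_space1)
  then have "(\<lambda>u. \<integral>v. f v \<partial>p t u) \<in> borel_measurable (restrict_space borel S)"
    using kernel_subprob[OF assms(2)]
    by (intro measurable_compose[OF _ integral_measurable_subprob_algebra]) auto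
  then have "(\<lambda>u. if u \<in> S then \<integral>v. f v \<partial>p t u else 0) \<in> borel_measurable borel"
    by (subst (asm) measurable_restrict_space_iff[where c=0]) auto
  then show ?thesis by (simp add: Pt_def[abs_def])
qed

lemma abs_Pt_le:
  assumes "f \<in> borel_measurable borel" "\<And>v. \<bar>f v\<bar> \<le> B" "t \<ge> 0"
  shows "\<bar>Pt t f u\<bar> \<le> B"
proof (cases "u \<in> S")
  case True
  interpret prob_space "p t u" using assms True prob_space_kernel by blast
  have "\<bar>\<integral>v. f v \<partial>p t u\<bar> \<le> (\<integral>v. \<bar>f v\<bar> \<partial>p t u)" by (rule integral_abs_bound)
  also have "\<dots> \<le> (\<integral>v. B \<partial>p t u)"
    using assms True by (intro integral_mono integrable_abs integrable_kernel) auto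
  finally show ?thesis using True by (simp add: Pt_def prob_space)
next
  case False
  then show ?thesis using order_trans[OF abs_ge_zero assms(2)] by (simp add: Pt_def)
qed

lemma Pt_0:
  assumes "f \<in> borel_measurable borel" "u \<in> S"
  shows "Pt 0 f u = f u"
proof -
  have "p 0 u = return (restrict_space borel S) u"
    using transition assms(2) by (auto simp: transition_function_def)
  moreover have "integral\<^sup>L (return (restrict_space borel S) u) f = f u"
    using assms by (intro integral_return measurable_restrict_space1) (auto simp: space_restrict_space)
  ultimately show ?thesis using assms(2) by (simp add: Pt_def)
qed

lemma Pt_add:
  assumes f: "f \<in> borel_measurable borel" "\<And>v. \<bar>f v\<bar> \<le> B" and st: "s \<ge> 0" "t \<ge> 0" and u: "u \<in> S"
  shows "Pt (s + t) f u = Pt s (Pt t f) u"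
proof -
  have ps: "prob_space (p s u)" using st u prob_space_kernel by blast
  have "p (s + t) u = p s u \<bind> p t"
    using transition st u by (auto simp: transition_function_def)
  then have "Pt (s + t) f u = integral\<^sup>L (p s u \<bind> p t) f" using u by (simp add: Pt_def)
  also have "\<dots> = (\<integral>v. integral\<^sup>L (p t v) f \<partial>p s u)"
  proof (rule integral_bind)
    show "f \<in> borel_measurable (restrict_space borel S)" using f by (intro measurable_restrict_space1)
    show "p t \<in> p s u \<rightarrow>\<^sub>M subprob_algebra (restrict_space borel S)"
      using kernel_subprob[OF st(2)] sets_kernel[OF st(1) u] by (simp cong: measurable_cong_sets)
    show "finite_measure (p s u)" using ps by (simp add: prob_space_def)
    show "AE x in p s u. emeasure (p t x) (space (p t x)) \<le> ennreal 1"
      using st u prob_space.emeasure_space_1[OF prob_space_kernel]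
      by (intro AE_I2) (simp add: space_kernel)
    show "\<bar>f v\<bar> \<le> B" for v using f by simp
  qed
  also have "\<dots> = (\<integral>v. Pt t f v \<partial>p s u)"
    using st u by (intro Bochner_Integration.integral_cong) (auto simp: Pt_def space_kernel)
  finally show ?thesis using u by (simp add: Pt_def[of s])
qed

lemma generator_Pt:
  assumes "f \<in> borel_measurable borel" "\<And>v. \<bar>f v\<bar> \<le> B" "u \<in> S"
  shows "((\<lambda>h. (Pt h f u - f u) / h) \<longlongrightarrow> L f u) (at_right 0)"
proof -
  have "bounded (range f)" using assms(2) by (auto simp: bounded_iff)
  then show ?thesis
    using generator assms(1,3) unfolding has_generator_def L_def Pt_def by simp
qed

lemma q_nonneg: "0 \<le> q u"
  unfolding q_def by (intro sum_nonneg rate_nonneg)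

text \<open>The indicator of the complement of \<open>S\<close> has expectation 0 under every
  kernel, so the generator sends it to 0 at \<open>u\<close>; there it is a sum of nonnegative
  terms. Hence the neighbours outside \<open>S\<close>, where \<open>Pt\<close> carries an arbitrary
  value, never contribute.\<close>

lemma rate_outside_zero:
  assumes u: "u \<in> S" and i: "i \<in> {1..M}" and out: "u + l i \<notin> S"
  shows "c i u = 0"
proof -
  define f :: "real \<Rightarrow> real" where "f = indicator (- S)"
  have fm: "f \<in> borel_measurable borel" unfolding f_def by measurable
  have fb: "\<bar>f v\<bar> \<le> 1" for v by (simp add: f_def indicator_def)
  have "Pt h f u = 0" if "h > 0" for h
  proof -
    have "(\<integral>v. f v \<partial>p h u) = (\<integral>v. 0 \<partial>p h u)"
      using that u by (intro Bochner_Integration.integral_cong) (auto simp: f_def space_kernel)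
    then show ?thesis by (simp add: Pt_def)
  qed
  then have "\<forall>\<^sub>F h in at_right 0. (Pt h f u - f u) / h = 0"
    using u by (auto simp: eventually_at_right_field f_def intro!: exI[of _ 1])
  then have "((\<lambda>h. (Pt h f u - f u) / h) \<longlongrightarrow> 0) (at_right 0)"
    by (rule tendsto_eventually)
  then have "L f u = 0"
    by (rule tendsto_unique[OF trivial_limit_at_right_real generator_Pt[OF fm fb u]])
  then have "(\<Sum>i=1..M. c i u * f (u + l i)) = 0" using u by (simp add: L_def f_def)
  then have "c i u * f (u + l i) = 0"
    using i rate_nonneg by (subst (asm) sum_nonneg_eq_0_iff) (auto simp: f_def)
  with out show ?thesis by (simp add: f_def)
qed

text \<open>\<open>t \<mapsto> P\<^sub>t(u, {u})\<close> is supermultiplicative, so the bound for small times propagates to all times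
  by Bernoulli's inequality.\<close>

lemma stay_prob_ge:
  assumes u: "u \<in> S" and t: "t \<ge> 0"
  shows "1 - q u * t \<le> Pt t (indicator {u}) u"
proof (cases "t = 0")
  case True
  with u show ?thesis by (simp add: Pt_0)
next
  case False
  with t have t: "t > 0" by simp
  define f :: "real \<Rightarrow> real" where "f = indicator {u}"
  have fm: "f \<in> borel_measurable borel" unfolding f_def by measurable
  have fb: "\<bar>f v\<bar> \<le> 1" for v by (simp add: f_def indicator_def)
  define \<phi> where "\<phi> t = Pt t f u" for t
  have nn: "\<phi> t \<ge> 0" for t
    unfolding \<phi>_def Pt_def f_def by (simp add: integral_nonneg_AE)
  have super: "\<phi> s * \<phi> t \<le> \<phi> (s + t)" if st: "s \<ge> 0" "t \<ge> 0" for s t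
  proof -
    have "\<phi> s * \<phi> t = Pt s (\<lambda>v. \<phi> t * f v) u" using u by (simp add: \<phi>_def Pt_def mult.commute)
    also have "\<dots> \<le> Pt s (Pt t f) u"
    proof -
      have "(\<integral>v. \<phi> t * f v \<partial>p s u) \<le> (\<integral>v. Pt t f v \<partial>p s u)"
      proof (rule integral_mono)
        show "integrable (p s u) (\<lambda>v. \<phi> t * f v)"
          by (intro integrable_mult_right integrable_kernel[OF fm fb st(1) u])
        show "integrable (p s u) (Pt t f)"
          by (intro integrable_kernel[OF measurable_Pt abs_Pt_le[OF fm fb]] fm st u)
        show "\<phi> t * f v \<le> Pt t f v" for v
          unfolding \<phi>_def f_def by (auto simp: indicator_def Pt_def intro!: integral_nonneg_AE)
      qed
      then show ?thesis using u by (simp add: Pt_def[of s])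
    qed
    also have "\<dots> = \<phi> (s + t)" unfolding \<phi>_def by (rule Pt_add[OF fm fb st u, symmetric])
    finally show ?thesis .
  qed
  have power: "\<phi> h ^ m \<le> \<phi> (real m * h)" if "h \<ge> 0" for h m
  proof (induction m)
    case 0
    show ?case using Pt_0[OF fm u] by (simp add: \<phi>_def f_def)
  next
    case (Suc m)
    have "\<phi> h ^ Suc m \<le> \<phi> h * \<phi> (real m * h)"
      using Suc nn by (simp add: mult_left_mono)
    also have "\<dots> \<le> \<phi> (real (Suc m) * h)"
      using super[of h "real m * h"] that by (simp add: algebra_simps)
    finally show ?case .
  qed
  have Lf: "- q u \<le> L f u"
  proof -
    have "- q u = (\<Sum>i=1..M. c i u * (- 1))" by (simp add: q_def sum_negf)
    also have "\<dots> \<le> L f u"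
      unfolding L_def by (intro sum_mono mult_left_mono rate_nonneg) (auto simp: f_def indicator_def)
    finally show ?thesis .
  qed
  have lower: "1 - (q u + e) * t \<le> \<phi> t" if e: "e > 0" for e
  proof -
    have "\<forall>\<^sub>F h in at_right 0. (\<phi> h - 1) / h > - (q u + e)"
      using generator_Pt[OF fm fb u] e Lf u unfolding \<phi>_def
      by (intro order_tendstoD(1)) (auto simp: f_def)
    then obtain d where d: "d > 0" "\<And>h. 0 < h \<Longrightarrow> h < d \<Longrightarrow> (\<phi> h - 1) / h > - (q u + e)"
      by (auto simp: eventually_at_right_field)
    \<comment> \<open>Two demands on \<open>m\<close>: the step \<open>t / m\<close> must lie in the
      range where the difference quotient is controlled, and \<open>1 - (q u + e) * h\<close> must
      be nonnegative before it is raised to the power \<open>m\<close>.\<close>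
    obtain m :: nat where m: "real m > max (t / d) ((q u + e) * t)"
      using reals_Archimedean2 by blast
    have m0: "real m > 0" using m t d by (smt (verit) divide_pos_pos)
    define h where "h = t / real m"
    have h: "0 < h" "h < d" "(q u + e) * h \<le> 1"
      using m m0 t d by (auto simp: h_def field_simps)
    have "1 - (q u + e) * h \<le> \<phi> h" using d(2)[OF h(1,2)] h by (simp add: field_simps)
    then have "(1 + (- ((q u + e) * h))) ^ m \<le> \<phi> h ^ m" using h by (intro power_mono) auto
    moreover have "1 + real m * (- ((q u + e) * h)) \<le> (1 + (- ((q u + e) * h))) ^ m"
      using h by (intro Bernoulli_inequality) auto
    moreover have "\<phi> h ^ m \<le> \<phi> t" using power[of h m] h m0 by (simp add: h_def)
    moreover have "real m * (- ((q u + e) * h)) = - ((q u + e) * t)" using m0 by (simp add: h_def)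
    ultimately show ?thesis by linarith
  qed
  have "1 - q u * t \<le> \<phi> t"
  proof (rule field_le_epsilon)
    fix e :: real assume "e > 0"
    then show "1 - q u * t \<le> \<phi> t + e" using lower[of "e / t"] t by (simp add: distrib_right)
  qed
  then show ?thesis by (simp add: \<phi>_def f_def)
qed

text \<open>\<open>f\<close> differs from \<open>f u\<close> only if the process is away from
  \<open>u\<close> at time \<open>t\<close>, which has probability at most \<open>q u * t\<close>,
  and then by at most \<open>2 * B\<close>.\<close>

lemma abs_Pt_diff_le:
  assumes f: "f \<in> borel_measurable borel" "\<And>v. \<bar>f v\<bar> \<le> B" and u: "u \<in> S" and t: "t \<ge> 0"
  shows "\<bar>Pt t f u - f u\<bar> \<le> 2 * B * q u * t"
proof -
  interpret prob_space "p t u" using u t prob_space_kernel by blast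
  have B: "0 \<le> B" using order_trans[OF abs_ge_zero f(2)] .
  have int: "integrable (p t u) f" using integrable_kernel[OF f t u] .
  have int1: "integrable (p t u) (indicator {u} :: real \<Rightarrow> real)"
    by (rule integrable_kernel[of _ 1]) (auto simp: t u indicator_def)
  have "Pt t f u - f u = (\<integral>v. f v - f u \<partial>p t u)"
    using int u by (simp add: Pt_def prob_space)
  also have "\<bar>\<dots>\<bar> \<le> (\<integral>v. \<bar>f v - f u\<bar> \<partial>p t u)" by (rule integral_abs_bound)
  also have "\<dots> \<le> (\<integral>v. 2 * B * (1 - indicator {u} v) \<partial>p t u)"
  proof (rule integral_mono)
    show "\<bar>f v - f u\<bar> \<le> 2 * B * (1 - indicator {u} v)" for v
      using f(2)[of v] f(2)[of u] by (auto simp: indicator_def)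
  qed (use int int1 in auto)
  also have "\<dots> = 2 * B * (1 - Pt t (indicator {u}) u)"
    using int1 u by (simp add: Pt_def prob_space)
  also have "\<dots> \<le> 2 * B * (q u * t)"
    using stay_prob_ge[OF u t] B by (intro mult_left_mono) auto
  finally show ?thesis by (simp add: mult.assoc)
qed

text \<open>Applying the generator to the bounded function \<open>P\<^sub>t f\<close> gives Kolmogorov's backward equation at the
  fixed point \<open>u\<close>. It involves only \<open>u\<close> and its finitely many neighbours, so neither non-explosion
  nor an interchange of limit and integral is required.\<close>

lemma Pt_expansion:
  assumes f: "f \<in> borel_measurable borel" "\<And>v. \<bar>f v\<bar> \<le> B" and u: "u \<in> S" and d: "d \<ge> 0"
    and Q: "q u \<le> Q" "\<And>i. i \<in> {1..M} \<Longrightarrow> q (u + l i) \<le> Q"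
  shows "Pt d f u \<le> f u + d * L f u + 4 * B * Q\<^sup>2 * d\<^sup>2"
proof -
  have B: "0 \<le> B" using order_trans[OF abs_ge_zero f(2)] .
  have Q0: "0 \<le> Q" using Q(1) q_nonneg[of u] by linarith
  define \<phi> where "\<phi> t = Pt t f u - t * L f u" for t
  have meas: "Pt t f \<in> borel_measurable borel" "\<And>v. \<bar>Pt t f v\<bar> \<le> B" if "t \<ge> 0" for t
    using that f measurable_Pt abs_Pt_le by blast+
  have incr: "Pt (t + h) f u - Pt t f u = Pt h (Pt t f) u - Pt t f u" if "t \<ge> 0" "h \<ge> 0" for t h
    using Pt_add[OF f that(2,1) u] by (simp add: add.commute)
  have lip: "\<bar>Pt (t + h) f u - Pt t f u\<bar> \<le> 2 * B * q u * h" if "t \<ge> 0" "h \<ge> 0" for t h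
    unfolding incr[OF that] using abs_Pt_diff_le[OF meas[OF that(1)] u that(2)] .
  have "(2 * B * q u)-lipschitz_on {0..d} (\<lambda>t. Pt t f u)"
  proof (rule lipschitz_on_leI)
    fix s t :: real assume "s \<in> {0..d}" "t \<in> {0..d}" "s \<le> t"
    then show "dist (Pt s f u) (Pt t f u) \<le> 2 * B * q u * dist s t"
      using lip[of s "t - s"] by (simp add: dist_real_def abs_minus_commute)
  qed (use B q_nonneg in auto)
  then have "continuous_on {0..d} (\<lambda>t. Pt t f u)"
    by (rule lipschitz_on_continuous_on)
  then have cont: "continuous_on {0..d} \<phi>" unfolding \<phi>_def by (intro continuous_intros)
  \<comment> \<open>The right derivative of \<phi> is the generator applied to P_t f - f. Each of
    the two values in an increment is at most \<open>2 * B * Q * d\<close> in size and the total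
    rate is at most \<open>Q\<close>, which gives the slope \<open>4 * B * Q\<^sup>2 * d\<close>;
    the interval length supplies the second \<open>d\<close>.\<close>
  have "\<phi> d - \<phi> 0 \<le> (4 * B * Q\<^sup>2 * d) * d"
  proof (rule right_derivative_increment_le[OF cont d])
    fix t assume t: "0 \<le> t" "t < d"
    have ev: "\<forall>\<^sub>F h in at_right 0. (Pt h (Pt t f) u - Pt t f u) / h - L f u = (\<phi> (t + h) - \<phi> t) / h"
    proof -
      have "(Pt h (Pt t f) u - Pt t f u) / h - L f u = (\<phi> (t + h) - \<phi> t) / h" if "h > 0" for h
      proof -
        have "\<phi> (t + h) - \<phi> t = (Pt h (Pt t f) u - Pt t f u) - h * L f u"
          using incr[of t h] t that by (simp add: \<phi>_def algebra_simps)
        then show ?thesis using that by (simp add: diff_divide_distrib)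
      qed
      then show ?thesis by (auto simp: eventually_at_right_field intro!: exI[of _ 1])
    qed
    have "((\<lambda>h. (Pt h (Pt t f) u - Pt t f u) / h - L f u) \<longlongrightarrow> L (Pt t f) u - L f u) (at_right 0)"
      by (intro tendsto_diff generator_Pt[OF meas[OF t(1)] u] tendsto_const)
    then show "((\<lambda>h. (\<phi> (t + h) - \<phi> t) / h) \<longlongrightarrow> L (Pt t f) u - L f u) (at_right 0)"
      using ev by (rule Lim_transform_eventually)
    have bnd: "\<bar>Pt t f v - f v\<bar> \<le> 2 * B * Q * d" if "v \<in> S" "q v \<le> Q" for v
    proof -
      have "\<bar>Pt t f v - f v\<bar> \<le> 2 * B * q v * t" by (rule abs_Pt_diff_le[OF f that(1) t(1)])
      also have "\<dots> \<le> 2 * B * Q * d"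
        using that t B Q0 q_nonneg[of v] by (intro mult_mono) auto
      finally show ?thesis .
    qed
    have "L (Pt t f) u - L f u
        = (\<Sum>i=1..M. c i u * ((Pt t f (u + l i) - f (u + l i)) - (Pt t f u - f u)))"
      by (simp add: L_def sum_subtractf[symmetric] algebra_simps)
    also have "\<dots> \<le> (\<Sum>i=1..M. c i u * (4 * B * Q * d))"
    proof (rule sum_mono)
      fix i assume i: "i \<in> {1..M}"
      show "c i u * ((Pt t f (u + l i) - f (u + l i)) - (Pt t f u - f u)) \<le> c i u * (4 * B * Q * d)"
      \<comment> \<open>The Lipschitz bound in time holds on \<open>S\<close> only; a neighbour
        outside \<open>S\<close> has rate 0.\<close>
      proof (cases "u + l i \<in> S")
        case True
        show ?thesis
          using bnd[OF True Q(2)[OF i]] bnd[OF u Q(1)]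
          by (intro mult_left_mono rate_nonneg[OF i]) linarith
      qed (use rate_outside_zero[OF u i] in simp)
    qed
    also have "\<dots> = q u * (4 * B * Q * d)" by (simp add: q_def sum_distrib_right)
    also have "\<dots> \<le> Q * (4 * B * Q * d)" using Q B Q0 d by (intro mult_right_mono) auto
    finally show "L (Pt t f) u - L f u \<le> 4 * B * Q\<^sup>2 * d"
      by (simp add: power2_eq_square algebra_simps)
  qed
  then show ?thesis using f u by (simp add: \<phi>_def Pt_0 power2_eq_square algebra_simps)
qed

end

section \<open>Stopping at the exit from a set\<close>

text \<open>The exit time capped at \<open>T\<close>: inserting \<open>T\<close> keeps the set
  nonempty, so the infimum is a genuine real number even if the path never leaves
  \<open>D\<close>.\<close>

definition exit_time :: "real set \<Rightarrow> real \<Rightarrow> (real \<Rightarrow> real) \<Rightarrow> real" where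
  "exit_time D T w = Inf (insert T {t \<in> {0..T}. w t \<notin> D})"

lemma exit_time_bounds:
  assumes "T \<ge> 0" shows "0 \<le> exit_time D T w" "exit_time D T w \<le> T"
  unfolding exit_time_def using assms
  by (auto intro!: cInf_greatest cInf_lower bdd_belowI[of _ 0])

lemma before_exit_time:
  assumes "T \<ge> 0" "0 \<le> t" "t < exit_time D T w"
  shows "w t \<in> D"
proof (rule ccontr)
  assume "w t \<notin> D"
  moreover have "t \<le> T" using assms exit_time_bounds(2)[OF assms(1), of D w] by simp
  ultimately have "exit_time D T w \<le> t"
    unfolding exit_time_def using assms by (intro cInf_lower bdd_belowI[of _ 0]) auto
  with assms show False by simp
qed

lemma pure_jump_path_right:
  assumes "pure_jump_path w" "t \<ge> 0"
  obtains b where "b > t" "\<And>s. t \<le> s \<Longrightarrow> s < b \<Longrightarrow> w s = w t"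
proof -
  obtain b where "b > t" "\<forall>s>t. s < b \<longrightarrow> w s = w t"
    using assms unfolding pure_jump_path_def eventually_at_right_field by blast
  then show ?thesis by (intro that[of b]) (auto simp: le_less)
qed

text \<open>The path is constant on an interval to the right of the exit time. If it were still in
  \<open>D\<close> there, no exit could occur during that interval, and the infimum would be
  larger.\<close>

lemma at_exit_time:
  assumes w: "pure_jump_path w" and T: "T \<ge> 0" and lt: "exit_time D T w < T"
  shows "w (exit_time D T w) \<notin> D"
proof
  let ?r = "exit_time D T w"
  assume inD: "w ?r \<in> D"
  obtain b where b: "b > ?r" "\<And>s. ?r \<le> s \<Longrightarrow> s < b \<Longrightarrow> w s = w ?r"
    using pure_jump_path_right[OF w exit_time_bounds(1)[OF T]] by metis
  have "min b T \<le> ?r"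
    unfolding exit_time_def[of D T w]
  proof (rule cInf_greatest)
    fix t assume "t \<in> insert T {t \<in> {0..T}. w t \<notin> D}"
    then consider "t = T" | "0 \<le> t" "w t \<notin> D" by auto
    then show "min b T \<le> t"
    proof cases
      case 2
      then have "?r \<le> t" using before_exit_time[OF T, of t D w] by force
      with 2 b(2)[of t] inD show ?thesis by force
    qed simp
  qed simp
  with b lt show False by simp
qed

text \<open>The value at the exit from \<open>D\<close> when the path is observed only at the times \<open>0, h, 2 h, \<dots>, k h\<close>.\<close>

primrec grid_stop :: "real set \<Rightarrow> real \<Rightarrow> (real \<Rightarrow> real \<Rightarrow> real) \<Rightarrow> (real \<Rightarrow> real) \<Rightarrow> nat \<Rightarrow> real" where
  "grid_stop D h \<phi> w 0 = \<phi> 0 (w 0)"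
| "grid_stop D h \<phi> w (Suc k) =
     (if \<forall>j\<le>k. w (real j * h) \<in> D then \<phi> (real (Suc k) * h) (w (real (Suc k) * h))
      else grid_stop D h \<phi> w k)"

lemma grid_stop_eq:
  assumes "j \<le> k" "\<And>i. i < j \<Longrightarrow> w (real i * h) \<in> D" "j = k \<or> w (real j * h) \<notin> D"
  shows "grid_stop D h \<phi> w k = \<phi> (real j * h) (w (real j * h))"
  using assms
proof (induction k)
  case (Suc k)
  show ?case
  proof (cases "j = Suc k")
    case True
    then show ?thesis using Suc.prems(2) by (auto simp: less_Suc_eq_le)
  next
    case False
    then have "j \<le> k" "w (real j * h) \<notin> D" using Suc.prems by auto
    then show ?thesis using Suc by auto
  qed
qed simp

lemma abs_grid_stop_le:
  assumes "\<And>t u. 0 \<le> t \<Longrightarrow> t \<le> T \<Longrightarrow> \<bar>\<phi> t u\<bar> \<le> B" "0 \<le> h" "real k * h \<le> T"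
  shows "\<bar>grid_stop D h \<phi> w k\<bar> \<le> B"
  using assms(3)
proof (induction k)
  case (Suc k)
  have "real k * h \<le> T" using Suc.prems assms(2) by (simp add: algebra_simps)
  then show ?case using Suc assms(1)[of "real (Suc k) * h"] assms(2) by auto
qed (use assms in auto)

text \<open>A grid may miss a short excursion, but the path keeps its exit value for a positive
  time. Once the mesh is small, the first grid time \<open>g m\<close> not before the exit time
  falls into that period, so the grid stops there with the correct position; only the time argument
  is off, and it converges.\<close>

lemma grid_stop_tendsto:
  assumes w: "pure_jump_path w" and T: "T > 0" and cont: "\<And>u. continuous_on UNIV (\<lambda>t. \<phi> t u)"
  shows "(\<lambda>m. grid_stop D (T / real m) \<phi> w m) \<longlonglongrightarrow> \<phi> (exit_time D T w) (w (exit_time D T w))"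
proof -
  define \<rho> where "\<rho> = exit_time D T w"
  have \<rho>: "0 \<le> \<rho>" "\<rho> \<le> T" using exit_time_bounds[of T D w] T by (auto simp: \<rho>_def)
  define j where "j m = (LEAST i. \<rho> \<le> real i * (T / real m))" for m
  define g where "g m = real (j m) * (T / real m)" for m
  have j_ge: "\<rho> \<le> g m" and j_le: "j m \<le> m" if "m > 0" for m
  proof -
    have "\<rho> \<le> real m * (T / real m)" using \<rho> that by simp
    then show "j m \<le> m" "\<rho> \<le> g m" unfolding j_def g_def by (rule Least_le, rule LeastI)
  qed
  have j_less: "real i * (T / real m) < \<rho>" if "i < j m" for i m
    using not_less_Least[of i "\<lambda>i. \<rho> \<le> real i * (T / real m)"] that by (auto simp: j_def)
  have g_le: "g m \<le> \<rho> + T / real m" if "m > 0" for m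
  proof (cases "j m")
    case 0
    then show ?thesis using \<rho> T by (simp add: g_def)
  next
    case (Suc i)
    then show ?thesis using j_less[of i m] by (simp add: g_def field_simps add_divide_distrib)
  qed
  have g_lim: "g \<longlonglongrightarrow> \<rho>"
  proof (rule tendsto_sandwich[of "\<lambda>_. \<rho>" _ _ "\<lambda>m. \<rho> + T / real m"])
    show "(\<lambda>m. \<rho> + T / real m) \<longlonglongrightarrow> \<rho>"
      using tendsto_add[OF tendsto_const lim_const_over_n[of T], of \<rho>] by simp
  qed (auto intro!: eventually_sequentiallyI[of 1] j_ge g_le)
  obtain b where b: "b > \<rho>" "\<And>s. \<rho> \<le> s \<Longrightarrow> s < b \<Longrightarrow> w s = w \<rho>"
    using pure_jump_path_right[OF w \<rho>(1)] by metis
  have "\<forall>\<^sub>F m in sequentially. g m < b" using g_lim b(1) by (rule order_tendstoD)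
  then have ev: "\<forall>\<^sub>F m in sequentially. \<phi> (g m) (w \<rho>) = grid_stop D (T / real m) \<phi> w m"
    using eventually_gt_at_top[of 0]
  proof eventually_elim
    case (elim m)
    have wg: "w (g m) = w \<rho>" using b(2) j_ge elim by simp
    have "grid_stop D (T / real m) \<phi> w m = \<phi> (g m) (w (g m))"
      unfolding g_def
    proof (rule grid_stop_eq)
      show "j m \<le> m" using j_le elim by simp
      show "w (real i * (T / real m)) \<in> D" if "i < j m" for i
        using before_exit_time[of T "real i * (T / real m)" D w] j_less[OF that] T by (simp add: \<rho>_def)
      \<comment> \<open>For \<rho> below \<open>T\<close> the exit position is still visible at
        \<open>g m\<close>; for \<rho> equal to \<open>T\<close> the first grid time from \<rho> on
        is the last one.\<close>
      show "j m = m \<or> w (real (j m) * (T / real m)) \<notin> D"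
      proof (cases "\<rho> < T")
        case True
        then have "w \<rho> \<notin> D" using at_exit_time[OF w, of T D] T by (simp add: \<rho>_def)
        then show ?thesis using wg by (simp add: g_def)
      next
        case False
        then have "T \<le> real (j m) * (T / real m)" using j_ge[of m] elim by (simp add: g_def)
        then have "real m \<le> real (j m)" using T elim by (simp add: field_simps)
        then show ?thesis using j_le[of m] elim by simp
      qed
    qed
    then show ?case using wg by simp
  qed
  have "(\<lambda>m. \<phi> (g m) (w \<rho>)) \<longlonglongrightarrow> \<phi> \<rho> (w \<rho>)"
    using continuous_on_tendsto_compose[OF cont g_lim] by simp
  then show ?thesis unfolding \<rho>_def[symmetric] using ev by (rule Lim_transform_eventually)
qed

section \<open>The Markov property and expectations at the exit time\<close>

locale jump_process = jump_semigroup S p M c l + prob_space N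
  for S p M c l and N :: "'w measure" +
  fixes X :: "real \<Rightarrow> 'w \<Rightarrow> real" and x0 :: real
  assumes markov: "markov_process N S p X"
    and paths: "\<And>\<omega>. \<omega> \<in> space N \<Longrightarrow> pure_jump_path (\<lambda>t. X t \<omega>)"
    and start: "AE \<omega> in N. X 0 \<omega> = x0"
begin

lemma measurable_X: "t \<ge> 0 \<Longrightarrow> X t \<in> borel_measurable N"
  using markov by (simp add: markov_process_def)

lemma X_in_S: "t \<ge> 0 \<Longrightarrow> \<omega> \<in> space N \<Longrightarrow> X t \<omega> \<in> S"
  using markov by (simp add: markov_process_def)

lemma filtration_generators:
  "s \<ge> 0 \<Longrightarrow> (\<Union>r\<in>{0..s}. {X r -` A \<inter> space N | A. A \<in> sets borel}) \<subseteq> sets N"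
  using measurable_X by (auto intro: measurable_sets)

lemma space_filtration: "space (natural_filtration N X s) = space N"
  unfolding natural_filtration_def by (rule space_measure_of) auto

lemma subalgebra_filtration:
  assumes "s \<ge> 0" shows "subalgebra N (natural_filtration N X s)"
proof -
  let ?G = "\<Union>r\<in>{0..s}. {X r -` A \<inter> space N | A. A \<in> sets borel}"
  have "sets (natural_filtration N X s) = sigma_sets (space N) ?G"
    unfolding natural_filtration_def by (rule sets_measure_of) auto
  also have "\<dots> \<subseteq> sets N" using filtration_generators[OF assms] by (rule sets.sigma_sets_subset)
  finally show ?thesis by (simp add: subalgebra_def space_filtration)
qed

lemma measurable_X_filtration:
  assumes "0 \<le> r" "r \<le> s"
  shows "X r \<in> borel_measurable (natural_filtration N X s)"
proof (rule measurableI)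
  fix A :: "real set" assume "A \<in> sets borel"
  then show "X r -` A \<inter> space (natural_filtration N X s) \<in> sets (natural_filtration N X s)"
    unfolding space_filtration using assms unfolding natural_filtration_def
    by (intro in_measure_of UN_I[of r]) auto
qed simp

text \<open>The Markov property is given for indicators only. Instead of approximating
  \<open>f\<close>, both sides are read as integrals of \<open>f\<close> against measures: the law
  of \<open>X (s + t)\<close> under \<open>N\<close> restricted to \<open>B\<close>, and the mixture
  of the kernels at \<open>X s\<close>. These measures agree on every set, hence on
  \<open>f\<close>.\<close>

lemma markov_integral:
  assumes st: "s \<ge> 0" "t \<ge> 0" and B: "B \<in> sets (natural_filtration N X s)"
    and f: "f \<in> borel_measurable borel" "\<And>v. \<bar>f v\<bar> \<le> b"
  shows "(\<integral>\<omega>. indicator B \<omega> * f (X (s + t) \<omega>) \<partial>N) = (\<integral>\<omega>. indicator B \<omega> * Pt t f (X s \<omega>) \<partial>N)"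
proof -
  let ?R = "restrict_space borel S" and ?F = "natural_filtration N X s"
  interpret F: finite_measure_subalgebra N ?F
    using subalgebra_filtration[OF st(1)] by unfold_locales
  have BN [measurable]: "B \<in> sets N" using B F.subalg by (auto simp: subalgebra_def)
  have [measurable]: "X s \<in> borel_measurable N" "X (s + t) \<in> borel_measurable N"
    using st by (auto intro: measurable_X)
  have XR: "X s \<in> N \<rightarrow>\<^sub>M ?R" "X (s + t) \<in> N \<rightarrow>\<^sub>M ?R"
    using st X_in_S by (auto intro!: measurable_restrict_space2)
  define NB where "NB = density N (indicator B)"
  define K where "K \<omega> = p t (X s \<omega>)" for \<omega>
  have setsNB [measurable_cong]: "sets NB = sets N" and spNB: "space NB = space N"
    by (simp_all add: NB_def)
  have K: "K \<in> N \<rightarrow>\<^sub>M subprob_algebra ?R"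
    unfolding K_def using kernel_subprob[OF st(2)] XR(1) by (rule measurable_compose[rotated])
  have K1: "prob_space (K \<omega>)" if "\<omega> \<in> space N" for \<omega>
    unfolding K_def using st X_in_S that by (intro prob_space_kernel) auto
  have KNB: "K \<in> NB \<rightarrow>\<^sub>M subprob_algebra ?R" and XNB: "X (s + t) \<in> NB \<rightarrow>\<^sub>M ?R"
    using K XR(2) by (simp_all cong: measurable_cong_sets add: setsNB)
  have fR: "f \<in> borel_measurable ?R" using f(1) by (rule measurable_restrict_space1)
  have finNB: "finite_measure NB"
    by (rule finite_measureI) (simp add: NB_def emeasure_density emeasure_finite)
  have eq: "distr NB ?R (X (s + t)) = NB \<bind> K"
  proof (rule measure_eqI)
    have ne: "space NB \<noteq> {}" using not_empty by (simp add: spNB)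
    show sets_eq: "sets (distr NB ?R (X (s + t))) = sets (NB \<bind> K)"
      using sets_bind[OF Giry_Monad.sets_kernel[OF KNB] ne] by simp
    fix A assume "A \<in> sets (distr NB ?R (X (s + t)))"
    then have AR: "A \<in> sets ?R" by simp
    then have A [measurable]: "A \<in> sets borel" and AS: "A \<subseteq> S"
      by (auto simp: sets_restrict_space_iff)
    have KA: "(\<lambda>\<omega>. emeasure (K \<omega>) A) \<in> borel_measurable N" "(\<lambda>\<omega>. measure (K \<omega>) A) \<in> borel_measurable N"
      by (rule measurable_compose[OF K measurable_emeasure_subprob_algebra[OF AR]],
          rule measurable_compose[OF K measurable_measure_subprob_algebra[OF AR]])
    have ae: "AE \<omega> in N. real_cond_exp N ?F (\<lambda>\<omega>. indicator A (X (s + t) \<omega>)) \<omega> = measure (K \<omega>) A"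
    proof -
      have "AE \<omega> in N. real_cond_exp N ?F (\<lambda>\<omega>. indicator A (X (s + t) \<omega>)) \<omega>
          = measure (p t (X s \<omega>)) (A \<inter> S)"
        using markov st A unfolding markov_process_def by blast
      then show ?thesis using AS by (simp add: K_def Int_absorb2)
    qed
    have int: "integrable N (\<lambda>\<omega>. indicator A (X (s + t) \<omega>) :: real)"
      by (rule integrable_const_bound[of _ 1]) (auto simp: indicator_def)
    have intK: "integrable N (\<lambda>\<omega>. indicator B \<omega> * measure (K \<omega>) A)"
      using KA(2) K1 by (intro integrable_const_bound[of _ 1] AE_I2)
        (auto simp: indicator_def prob_space.prob_le_1)
    have "emeasure (distr NB ?R (X (s + t))) A = emeasure NB (X (s + t) -` A \<inter> space NB)"
      using XNB AR by (rule emeasure_distr)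
    also have "\<dots> = emeasure N (B \<inter> (X (s + t) -` A \<inter> space N))"
      by (simp add: NB_def emeasure_restricted)
    also have "\<dots> = ennreal (\<integral>\<omega>. indicator B \<omega> * indicator A (X (s + t) \<omega>) \<partial>N)"
    proof -
      have "(\<integral>\<omega>. indicator B \<omega> * indicator A (X (s + t) \<omega>) \<partial>N :: real)
          = (\<integral>\<omega>. indicator (B \<inter> (X (s + t) -` A \<inter> space N)) \<omega> \<partial>N)"
        by (intro Bochner_Integration.integral_cong) (auto simp: indicator_def)
      then show ?thesis by (simp add: emeasure_eq_measure Int_absorb2)
    qed
    \<comment> \<open>Here \<open>B\<close> has to belong to the past up to
      \<open>s\<close>.\<close>
    also have "(\<integral>\<omega>. indicator B \<omega> * indicator A (X (s + t) \<omega>) \<partial>N)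
        = (\<integral>\<omega>. indicator B \<omega> * real_cond_exp N ?F (\<lambda>\<omega>. indicator A (X (s + t) \<omega>)) \<omega> \<partial>N)"
      using F.real_cond_exp_intA[OF int B] by (simp add: set_lebesgue_integral_def)
    also have "\<dots> = (\<integral>\<omega>. indicator B \<omega> * measure (K \<omega>) A \<partial>N)"
      using ae KA(2) by (intro integral_cong_AE) auto
    also have "ennreal \<dots> = (\<integral>\<^sup>+\<omega>. ennreal (indicator B \<omega> * measure (K \<omega>) A) \<partial>N)"
      using intK by (intro nn_integral_eq_integral[symmetric]) auto
    also have "\<dots> = (\<integral>\<^sup>+\<omega>. indicator B \<omega> * emeasure (K \<omega>) A \<partial>N)"
    proof (rule nn_integral_cong)
      fix \<omega> assume "\<omega> \<in> space N"
      then interpret K: prob_space "K \<omega>" by (rule K1)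
      show "ennreal (indicator B \<omega> * measure (K \<omega>) A) = indicator B \<omega> * emeasure (K \<omega>) A"
        by (simp add: K.emeasure_eq_measure indicator_def)
    qed
    also have "\<dots> = (\<integral>\<^sup>+\<omega>. emeasure (K \<omega>) A \<partial>NB)"
      using KA by (simp add: NB_def nn_integral_density)
    also have "\<dots> = emeasure (NB \<bind> K) A"
      using emeasure_bind[OF ne KNB AR] by simp
    finally show "emeasure (distr NB ?R (X (s + t))) A = emeasure (NB \<bind> K) A" .
  qed
  have NB_integral: "(\<integral>\<omega>. g \<omega> \<partial>NB) = (\<integral>\<omega>. indicator B \<omega> * g \<omega> \<partial>N)"
    if "g \<in> borel_measurable N" for g :: "'w \<Rightarrow> real"
  proof -
    have "NB = density N (\<lambda>\<omega>. ennreal (indicator B \<omega>))" by (simp add: NB_def ennreal_indicator)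
    then show ?thesis using that by (simp add: integral_density)
  qed
  have "(\<integral>\<omega>. indicator B \<omega> * f (X (s + t) \<omega>) \<partial>N) = (\<integral>\<omega>. f (X (s + t) \<omega>) \<partial>NB)"
    by (intro NB_integral[symmetric] measurable_compose[OF _ f(1)] measurable_X) (use st in simp)
  also have "\<dots> = integral\<^sup>L (distr NB ?R (X (s + t))) f"
    using XNB fR by (rule integral_distr[symmetric])
  also have "\<dots> = integral\<^sup>L (NB \<bind> K) f" by (simp add: eq)
  also have "\<dots> = (\<integral>\<omega>. integral\<^sup>L (K \<omega>) f \<partial>NB)"
    using fR f(2) KNB finNB
    by (rule integral_bind[where B'=1])
      (auto simp: spNB prob_space.emeasure_space_1[OF K1] intro!: AE_I2)
  also have "\<dots> = (\<integral>\<omega>. Pt t f (X s \<omega>) \<partial>NB)"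
    using st X_in_S by (intro Bochner_Integration.integral_cong) (auto simp: K_def Pt_def spNB)
  also have "\<dots> = (\<integral>\<omega>. indicator B \<omega> * Pt t f (X s \<omega>) \<partial>N)"
    by (intro NB_integral measurable_compose[OF _ measurable_Pt[OF f(1) st(2)]] measurable_X st)
  finally show ?thesis .
qed

abbreviation exit_at :: "real set \<Rightarrow> real \<Rightarrow> 'w \<Rightarrow> real" where
  "exit_at D T \<omega> \<equiv> exit_time D T (\<lambda>t. X t \<omega>)"

lemma measurable_grid_stop:
  assumes D: "D \<in> sets borel" and "0 \<le> h" and \<phi>: "\<And>t. \<phi> t \<in> borel_measurable borel"
  shows "(\<lambda>\<omega>. grid_stop D h \<phi> (\<lambda>t. X t \<omega>) k) \<in> borel_measurable N"
proof (induction k)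
  case 0
  show ?case using measurable_compose[OF measurable_X \<phi>] by simp
next
  case (Suc k)
  have "(\<lambda>\<omega>. \<phi> (real (Suc k) * h) (X (real (Suc k) * h) \<omega>)) \<in> borel_measurable N"
    by (rule measurable_compose[OF measurable_X \<phi>]) (use assms(2) in simp)
  moreover have "{\<omega> \<in> space N. \<forall>j\<in>{..k}. X (real j * h) \<omega> \<in> D} \<in> sets N"
  proof (intro sets.sets_Collect_finite_All)
    fix j
    have "X (real j * h) \<in> borel_measurable N" using assms(2) by (intro measurable_X) simp
    then show "{\<omega> \<in> space N. X (real j * h) \<omega> \<in> D} \<in> sets N"
      by (rule measurable_sets_Collect) (use D in simp)
  qed simp
  then have "{\<omega> \<in> space N. \<forall>j\<le>k. X (real j * h) \<omega> \<in> D} \<in> sets N"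
    by (simp only: Ball_def atMost_iff)
  ultimately show ?case using Suc unfolding grid_stop.simps by (intro measurable_If)
qed

text \<open>The exit time is an infimum over uncountably many times; measurability comes from the
  grid approximations, each of which depends on finitely many values of the path. Choosing the time
  or the position for \<phi> yields the exit time and the exit position.\<close>

lemma measurable_at_exit:
  fixes \<phi> :: "real \<Rightarrow> real \<Rightarrow> real"
  assumes D: "D \<in> sets borel" and T: "T > 0" and \<phi>: "\<And>t. \<phi> t \<in> borel_measurable borel"
    and cont: "\<And>u. continuous_on UNIV (\<lambda>t. \<phi> t u)"
  shows "(\<lambda>\<omega>. \<phi> (exit_at D T \<omega>) (X (exit_at D T \<omega>) \<omega>)) \<in> borel_measurable N"
proof (rule borel_measurable_LIMSEQ_real)
  show "(\<lambda>\<omega>. grid_stop D (T / real m) \<phi> (\<lambda>t. X t \<omega>) m) \<in> borel_measurable N" for m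
    using T by (intro measurable_grid_stop D \<phi>) auto
  show "(\<lambda>m. grid_stop D (T / real m) \<phi> (\<lambda>t. X t \<omega>) m)
      \<longlonglongrightarrow> \<phi> (exit_at D T \<omega>) (X (exit_at D T \<omega>) \<omega>)" if "\<omega> \<in> space N" for \<omega>
    by (rule grid_stop_tendsto[OF paths[OF that] T cont])
qed

lemma measurable_exit_at: "D \<in> sets borel \<Longrightarrow> T > 0 \<Longrightarrow> exit_at D T \<in> borel_measurable N"
  using measurable_at_exit[of D T "\<lambda>t u. t"] by simp

lemma measurable_X_exit:
  "D \<in> sets borel \<Longrightarrow> T > 0 \<Longrightarrow> (\<lambda>\<omega>. X (exit_at D T \<omega>) \<omega>) \<in> borel_measurable N"
  using measurable_at_exit[of D T "\<lambda>t u. u"] by simp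

text \<open>One grid step of a discounted supermartingale, up to an error of order
  \<open>h\<^sup>2\<close>. In the constant, \<open>exp (\<bar>\<kappa>\<bar> * T)\<close> bounds
  the discount factor, \<open>B * \<kappa>\<^sup>2\<close> is the error of replacing
  \<open>exp (\<kappa> * h)\<close> by \<open>1 + \<kappa> * h\<close>, and the last term is the
  remainder of \<open>Pt_expansion\<close> with a discount of at most \<open>exp 1\<close>.\<close>

lemma grid_stop_step:
  assumes D: "D \<in> sets borel" and f: "f \<in> borel_measurable borel" "\<And>v. \<bar>f v\<bar> \<le> B"
    and Q: "\<And>u. u \<in> D \<Longrightarrow> q u \<le> Q" "\<And>u i. u \<in> D \<Longrightarrow> i \<in> {1..M} \<Longrightarrow> q (u + l i) \<le> Q"
    and sub: "\<And>u. u \<in> D \<Longrightarrow> L f u \<le> \<kappa> * f u"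
    and h: "0 \<le> h" "\<bar>\<kappa> * h\<bar> \<le> 1" "real (Suc k) * h \<le> T"
  shows "(\<integral>\<omega>. grid_stop D h (\<lambda>t u. exp (- \<kappa> * t) * f u) (\<lambda>t. X t \<omega>) (Suc k) \<partial>N)
    \<le> (\<integral>\<omega>. grid_stop D h (\<lambda>t u. exp (- \<kappa> * t) * f u) (\<lambda>t. X t \<omega>) k \<partial>N)
       + exp (\<bar>\<kappa>\<bar> * T) * (B * \<kappa>\<^sup>2 + exp 1 * (4 * B * Q\<^sup>2)) * h\<^sup>2"
proof -
  define \<phi> where "\<phi> t u = exp (- \<kappa> * t) * f u" for t u
  let ?S = "\<lambda>\<omega>. grid_stop D h \<phi> (\<lambda>t. X t \<omega>)"
  let ?K = "exp (\<bar>\<kappa>\<bar> * T) * (B * \<kappa>\<^sup>2 + exp 1 * (4 * B * Q\<^sup>2)) * h\<^sup>2"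
  define s where "s = real k * h"
  have s: "0 \<le> s" "s \<le> T" and Suc_s: "real (Suc k) * h = s + h"
    using h by (auto simp: s_def algebra_simps)
  have T: "T \<ge> 0" using s by linarith
  have B: "0 \<le> B" using order_trans[OF abs_ge_zero f(2)] .
  define G where "G = {\<omega> \<in> space N. \<forall>j\<in>{..k}. X (real j * h) \<omega> \<in> D}"
  have GF: "G \<in> sets (natural_filtration N X s)"
  proof -
    have "{\<omega> \<in> space (natural_filtration N X s). \<forall>j\<in>{..k}. X (real j * h) \<omega> \<in> D}
        \<in> sets (natural_filtration N X s)"
    proof (intro sets.sets_Collect_finite_All)
      fix j assume "j \<in> {..k}"
      then have "X (real j * h) \<in> borel_measurable (natural_filtration N X s)"
        using h by (intro measurable_X_filtration) (auto simp: s_def mult_right_mono)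
      then show "{\<omega> \<in> space (natural_filtration N X s). X (real j * h) \<omega> \<in> D}
          \<in> sets (natural_filtration N X s)"
        by (rule measurable_sets_Collect) (use D in simp)
    qed simp
    then show ?thesis by (simp add: space_filtration G_def)
  qed
  have GN [measurable]: "G \<in> sets N"
    using GF subalgebra_filtration[OF s(1)] by (auto simp: subalgebra_def)
  have \<phi>m: "\<phi> t \<in> borel_measurable borel" for t unfolding \<phi>_def using f by measurable
  have \<phi>b: "\<bar>\<phi> t u\<bar> \<le> exp (\<bar>\<kappa>\<bar> * T) * B" if "0 \<le> t" "t \<le> T" for t u
  proof -
    have "- \<kappa> * t \<le> \<bar>\<kappa>\<bar> * T" using that by (smt (verit) abs_ge_minus_self mult_mono)
    then show ?thesis unfolding \<phi>_def abs_mult using f B by (intro mult_mono) auto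
  qed
  have int0: "integrable N (\<lambda>\<omega>. ?S \<omega> k)"
    using abs_grid_stop_le[where \<phi>=\<phi> and T=T, OF \<phi>b h(1)] s measurable_grid_stop[OF D h(1) \<phi>m]
    by (intro integrable_const_bound[of _ "exp (\<bar>\<kappa>\<bar> * T) * B"] AE_I2) (auto simp: s_def)
  have intX: "integrable N (\<lambda>\<omega>. indicator G \<omega> * g (X t \<omega>))"
    if "g \<in> borel_measurable borel" "\<And>u. \<bar>g u\<bar> \<le> B" "t \<ge> 0" for g t
    using that measurable_compose[OF measurable_X that(1)] B
    by (intro integrable_const_bound[of _ B] AE_I2) (auto simp: indicator_def)
  \<comment> \<open>Outside \<open>G\<close> the grid has stopped earlier and the value is frozen,
    so the increment carries the indicator of \<open>G\<close>.\<close>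
  have decomp: "?S \<omega> (Suc k) = ?S \<omega> k
      + (exp (- \<kappa> * (s + h)) * (indicator G \<omega> * f (X (s + h) \<omega>))
         - exp (- \<kappa> * s) * (indicator G \<omega> * f (X s \<omega>)))" if "\<omega> \<in> space N" for \<omega>
  proof (cases "\<omega> \<in> G")
    case True
    then have "\<And>j. j \<le> k \<Longrightarrow> X (real j * h) \<omega> \<in> D" by (auto simp: G_def)
    moreover from this have "?S \<omega> k = \<phi> (real k * h) (X (real k * h) \<omega>)"
      by (intro grid_stop_eq) auto
    ultimately show ?thesis using True by (simp add: \<phi>_def Suc_s[simplified] s_def[symmetric])
  next
    case False
    then show ?thesis using that by (auto simp: G_def)
  qed
  have drop: "exp (- \<kappa> * (s + h)) * (indicator G \<omega> * Pt h f (X s \<omega>))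
      - exp (- \<kappa> * s) * (indicator G \<omega> * f (X s \<omega>))
      \<le> ?K" if "\<omega> \<in> space N" for \<omega>
  proof (cases "\<omega> \<in> G")
    case True
    define u where "u = X s \<omega>"
    have uD: "u \<in> D" using True by (auto simp: G_def u_def s_def)
    have uS: "u \<in> S" using X_in_S s(1) that by (simp add: u_def)
    define y where "y = \<kappa> * h"
    have y: "\<bar>y\<bar> \<le> 1" using h by (simp add: y_def)
    \<comment> \<open>\<open>f\<close> may take either sign, because the lemma is later applied to a
      positive function and to its negative; hence the distance of
      \<open>exp (- y) * (1 + y)\<close> from 1 is bounded on both sides.\<close>
    have e1: "exp (- y) * (1 + y) \<le> 1"
    proof -
      have "exp (- y) * (1 + y) \<le> exp (- y) * exp y"
        using exp_ge_add_one_self[of y] by (intro mult_left_mono) auto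
      then show ?thesis by (simp add: exp_add[symmetric])
    qed
    have e2: "1 - y\<^sup>2 \<le> exp (- y) * (1 + y)"
    proof -
      have "(1 - y) * (1 + y) \<le> exp (- y) * (1 + y)"
        using exp_ge_add_one_self[of "- y"] y by (intro mult_right_mono) auto
      then show ?thesis by (simp add: algebra_simps power2_eq_square)
    qed
    have "\<bar>exp (- y) * (1 + y) - 1\<bar> \<le> y\<^sup>2" using e1 e2 by simp
    then have "\<bar>exp (- y) * (1 + y) - 1\<bar> * \<bar>f u\<bar> \<le> y\<^sup>2 * B"
      using f B by (intro mult_mono) auto
    then have e3: "(exp (- y) * (1 + y) - 1) * f u \<le> y\<^sup>2 * B"
      by (metis abs_mult abs_le_D1)
    have "Pt h f u \<le> f u + h * L f u + 4 * B * Q\<^sup>2 * h\<^sup>2"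
      using uD by (intro Pt_expansion[OF f uS h(1)] Q)
    also have "\<dots> \<le> f u + h * (\<kappa> * f u) + 4 * B * Q\<^sup>2 * h\<^sup>2"
      using sub[OF uD] h by (intro add_mono mult_left_mono order_refl) auto
    finally have "exp (- y) * Pt h f u \<le> exp (- y) * (f u + h * (\<kappa> * f u) + 4 * B * Q\<^sup>2 * h\<^sup>2)"
      by (intro mult_left_mono) auto
    also have "\<dots> = f u + (exp (- y) * (1 + y) - 1) * f u + exp (- y) * (4 * B * Q\<^sup>2 * h\<^sup>2)"
      by (simp add: y_def algebra_simps)
    also have "\<dots> \<le> f u + y\<^sup>2 * B + exp 1 * (4 * B * Q\<^sup>2 * h\<^sup>2)"
      using e3 y B by (intro add_mono mult_right_mono) auto
    finally have "exp (- y) * Pt h f u - f u \<le> (B * \<kappa>\<^sup>2 + exp 1 * (4 * B * Q\<^sup>2)) * h\<^sup>2"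
      by (simp add: y_def power_mult_distrib algebra_simps)
    then have "exp (- \<kappa> * s) * (exp (- y) * Pt h f u - f u)
        \<le> exp (- \<kappa> * s) * ((B * \<kappa>\<^sup>2 + exp 1 * (4 * B * Q\<^sup>2)) * h\<^sup>2)"
      by (intro mult_left_mono) auto
    also have "\<dots> \<le> exp (\<bar>\<kappa>\<bar> * T) * ((B * \<kappa>\<^sup>2 + exp 1 * (4 * B * Q\<^sup>2)) * h\<^sup>2)"
    proof (rule mult_right_mono)
      have "- \<kappa> * s \<le> \<bar>\<kappa>\<bar> * T" using s by (smt (verit) abs_ge_minus_self mult_mono)
      then show "exp (- \<kappa> * s) \<le> exp (\<bar>\<kappa>\<bar> * T)" by simp
    qed (use B in auto)
    also have "exp (- \<kappa> * s) * (exp (- y) * Pt h f u - f u)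
        = exp (- \<kappa> * (s + h)) * Pt h f u - exp (- \<kappa> * s) * f u"
      by (simp add: y_def exp_add[symmetric] right_diff_distrib distrib_left mult.assoc[symmetric])
    finally show ?thesis using True by (simp add: u_def mult.assoc)
  qed (use B in auto)
  define I where "I k = (\<integral>\<omega>. ?S \<omega> k \<partial>N)" for k
  define E where "E g t = (\<integral>\<omega>. indicator G \<omega> * g (X t \<omega>) \<partial>N)" for g :: "real \<Rightarrow> real" and t
  note int1 = intX[OF f s(1)] and int2 = intX[OF measurable_Pt[OF f(1) h(1)] abs_Pt_le[OF f h(1)] s(1)]
  have "I (Suc k) = (\<integral>\<omega>. ?S \<omega> k
      + (exp (- \<kappa> * (s + h)) * (indicator G \<omega> * f (X (s + h) \<omega>))
         - exp (- \<kappa> * s) * (indicator G \<omega> * f (X s \<omega>))) \<partial>N)"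
    unfolding I_def by (rule Bochner_Integration.integral_cong[OF refl decomp])
  also have "\<dots> = I k + (exp (- \<kappa> * (s + h)) * E f (s + h) - exp (- \<kappa> * s) * E f s)"
    unfolding I_def E_def using int0 intX[OF f] s h by simp
  finally have step: "I (Suc k) = I k + (exp (- \<kappa> * (s + h)) * E f (s + h) - exp (- \<kappa> * s) * E f s)" .
  have "E f (s + h) = E (Pt h f) s"
    unfolding E_def by (rule markov_integral[OF s(1) h(1) GF f])
  then have "exp (- \<kappa> * (s + h)) * E f (s + h) - exp (- \<kappa> * s) * E f s
      = (\<integral>\<omega>. exp (- \<kappa> * (s + h)) * (indicator G \<omega> * Pt h f (X s \<omega>))
        - exp (- \<kappa> * s) * (indicator G \<omega> * f (X s \<omega>)) \<partial>N)"
    unfolding E_def using int1 int2 by simp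
  also have "\<dots> \<le> (\<integral>\<omega>. ?K \<partial>N)"
    by (rule integral_mono[OF _ _ drop]) (use int1 int2 in auto)
  also have "\<dots> = ?K"
    by (simp add: prob_space)
  finally show ?thesis unfolding \<phi>_def[abs_def, symmetric] I_def[symmetric] step by linarith
qed

text \<open>With mesh \<open>T / m\<close> the \<open>m\<close> one-step errors sum to
  \<open>K * T\<^sup>2 / m\<close>, which vanishes, and dominated convergence passes from the grid
  to the exit time. The rate bound \<open>Q\<close> only enters this vanishing error, so it leaves
  no trace in the conclusion.\<close>

lemma exit_supermartingale:
  assumes D: "D \<in> sets borel" and T: "T > 0"
    and f: "f \<in> borel_measurable borel" "\<And>v. \<bar>f v\<bar> \<le> B"
    and Q: "\<And>u. u \<in> D \<Longrightarrow> q u \<le> Q" "\<And>u i. u \<in> D \<Longrightarrow> i \<in> {1..M} \<Longrightarrow> q (u + l i) \<le> Q"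
    and sub: "\<And>u. u \<in> D \<Longrightarrow> L f u \<le> \<kappa> * f u"
  shows "(\<integral>\<omega>. exp (- \<kappa> * exit_at D T \<omega>) * f (X (exit_at D T \<omega>) \<omega>) \<partial>N) \<le> f x0"
proof -
  define \<phi> where "\<phi> t u = exp (- \<kappa> * t) * f u" for t u
  define K where "K = exp (\<bar>\<kappa>\<bar> * T) * (B * \<kappa>\<^sup>2 + exp 1 * (4 * B * Q\<^sup>2))"
  have B: "0 \<le> B" using order_trans[OF abs_ge_zero f(2)] .
  have \<phi>m: "\<phi> t \<in> borel_measurable borel" for t unfolding \<phi>_def using f by measurable
  have \<phi>c: "continuous_on UNIV (\<lambda>t. \<phi> t u)" for u unfolding \<phi>_def by (intro continuous_intros)
  have \<phi>b: "\<bar>\<phi> t u\<bar> \<le> exp (\<bar>\<kappa>\<bar> * T) * B" if "0 \<le> t" "t \<le> T" for t u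
  proof -
    have "- \<kappa> * t \<le> \<bar>\<kappa>\<bar> * T" using that by (smt (verit) abs_ge_minus_self mult_mono)
    then show ?thesis unfolding \<phi>_def abs_mult using f B by (intro mult_mono) auto
  qed
  let ?S = "\<lambda>m \<omega>. grid_stop D (T / real m) \<phi> (\<lambda>t. X t \<omega>)"
  let ?X = "\<lambda>\<omega>. \<phi> (exit_at D T \<omega>) (X (exit_at D T \<omega>) \<omega>)"
  define I where "I m k = (\<integral>\<omega>. ?S m \<omega> k \<partial>N)" for m k
  have I0: "I m 0 = f x0" for m
  proof -
    have "I m 0 = (\<integral>\<omega>. f (X 0 \<omega>) \<partial>N)" by (simp add: I_def \<phi>_def)
    also have "\<dots> = (\<integral>\<omega>. f x0 \<partial>N)"
      using start measurable_compose[OF measurable_X f(1), of 0] by (intro integral_cong_AE) auto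
    finally show ?thesis by (simp add: prob_space)
  qed
  have "(\<lambda>m. \<bar>\<kappa>\<bar> * (T / real m)) \<longlonglongrightarrow> 0"
    using tendsto_mult_right_zero[OF lim_const_over_n] by blast
  then have ev: "\<forall>\<^sub>F m in sequentially. \<bar>\<kappa>\<bar> * (T / real m) < 1"
    by (rule order_tendstoD) simp
  have le: "\<forall>\<^sub>F m in sequentially. I m m \<le> f x0 + K * T\<^sup>2 / real m"
    using ev eventually_gt_at_top[of 0]
  proof eventually_elim
    case (elim m)
    let ?h = "T / real m"
    have "I m k \<le> f x0 + real k * (K * ?h\<^sup>2)" if "k \<le> m" for k
      using that
    proof (induction k)
      case (Suc k)
      have "real (Suc k) * ?h \<le> T"
        using mult_left_mono[of "real (Suc k)" "real m" T] Suc.prems T elim by (simp add: field_simps)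
      then have "I m (Suc k) \<le> I m k + K * ?h\<^sup>2"
        unfolding I_def \<phi>_def K_def using elim T
        by (intro grid_stop_step D f Q sub) (auto simp: abs_mult)
      with Suc show ?case by (simp add: algebra_simps)
    qed (simp add: I0)
    from this[of m] show ?case using elim by (simp add: power2_eq_square)
  qed
  have lim: "(\<lambda>m. I m m) \<longlonglongrightarrow> integral\<^sup>L N ?X"
    unfolding I_def
  proof (rule integral_dominated_convergence[where w="\<lambda>_. exp (\<bar>\<kappa>\<bar> * T) * B"])
    show "?X \<in> borel_measurable N"
      by (rule measurable_at_exit[OF D T \<phi>m \<phi>c])
    show "(\<lambda>\<omega>. ?S m \<omega> m) \<in> borel_measurable N" for m
      using T by (intro measurable_grid_stop D \<phi>m) auto
    show "AE \<omega> in N. (\<lambda>m. ?S m \<omega> m)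
        \<longlonglongrightarrow> ?X \<omega>"
      by (intro AE_I2 grid_stop_tendsto paths T \<phi>c)
    show "AE \<omega> in N. norm (?S m \<omega> m) \<le> exp (\<bar>\<kappa>\<bar> * T) * B" for m
      unfolding real_norm_def using T
      by (intro AE_I2 abs_grid_stop_le[where T=T] \<phi>b) auto
  qed simp
  have "(\<lambda>m. f x0 + K * T\<^sup>2 / real m) \<longlonglongrightarrow> f x0 + 0"
    by (intro tendsto_add tendsto_const lim_const_over_n)
  then have "integral\<^sup>L N ?X \<le> f x0"
    using tendsto_le[OF _ _ lim le] by simp
  then show ?thesis by (simp add: \<phi>_def)
qed

end

section \<open>The fluid limit\<close>

text \<open>The gain of 1 / \<open>k\<close> from integrating the exponential weight is what makes
  the Picard operator bounded (applied to \<open>h w\<close>) and contracting (applied to a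
  difference).\<close>

lemma exp_weighted_integral_le:
  fixes g :: "real \<Rightarrow> real"
  assumes k: "k > 0" and s: "0 \<le> s" and g: "continuous_on {0..s} g"
    and bound: "\<And>r. r \<in> {0..s} \<Longrightarrow> \<bar>g r\<bar> \<le> C * exp (k * r)" and C: "0 \<le> C"
  shows "\<bar>exp (- k * s) * integral {0..s} g\<bar> \<le> C / k"
proof -
  have I: "((\<lambda>r. C * exp (k * r)) has_integral C / k * exp (k * s) - C / k * exp (k * 0)) {0..s}"
    using s k by (intro fundamental_theorem_of_calculus)
      (auto simp flip: has_real_derivative_iff_has_vector_derivative intro!: derivative_eq_intros)
  have "norm (integral {0..s} g) \<le> integral {0..s} (\<lambda>r. C * exp (k * r))"
    using bound by (intro integral_norm_bound_integral integrable_continuous_real g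
        has_integral_integrable[OF I]) auto
  also have "\<dots> = C / k * exp (k * s) - C / k" using integral_unique[OF I] by simp
  also have "\<dots> \<le> C / k * exp (k * s)" using C k by simp
  finally have "exp (- k * s) * \<bar>integral {0..s} g\<bar> \<le> exp (- k * s) * (C / k * exp (k * s))"
    by (intro mult_left_mono) auto
  also have "\<dots> = C / k" by (simp add: exp_minus)
  finally show ?thesis by (simp add: abs_mult)
qed

lemma integral_from_0_derivative:
  fixes g :: "real \<Rightarrow> real"
  assumes "continuous_on {0..} g" "0 \<le> t"
  shows "((\<lambda>s. integral {0..s} g) has_real_derivative g t) (at t within {0..})"
proof -
  have "((\<lambda>s. integral {0..s} g) has_real_derivative g t) (at t within {0..t + 1})"
    using assms by (intro integral_has_real_derivative continuous_on_subset[OF assms(1)]) auto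
  also have "at t within {0..t + 1} = at t within {0..}"
    by (rule at_within_nhd[of t "{..<t + 1}"]) auto
  finally show ?thesis .
qed

text \<open>Picard iteration on \<open>[0, \<infinity>)\<close> at once: in the variable \<open>w t = exp (- 2 C t) (y t - x)\<close> the
  integral operator contracts the sup norm by the factor 1/2.\<close>

lemma global_ode_solution:
  fixes b :: "real \<Rightarrow> real"
  assumes lip: "C-lipschitz_on UNIV b"
  obtains y where "y 0 = x" "\<And>t. t \<ge> 0 \<Longrightarrow> (y has_real_derivative b (y t)) (at t within {0..})"
proof -
  \<comment> \<open>One is added so that \<open>2 * K\<close> can be divided by even for a constant
    drift.\<close>
  define K where "K = C + 1"
  have K: "K > 0" using lipschitz_on_nonneg[OF lip] by (simp add: K_def)
  have lipK: "\<bar>b u - b v\<bar> \<le> K * \<bar>u - v\<bar>" for u v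
  proof -
    have "\<bar>b u - b v\<bar> \<le> C * \<bar>u - v\<bar>"
      using lipschitz_onD[OF lip, of u v] by (simp add: dist_real_def)
    also have "\<dots> \<le> K * \<bar>u - v\<bar>" by (intro mult_right_mono) (auto simp: K_def)
    finally show ?thesis .
  qed
  have b_cont: "continuous_on UNIV b" using lip by (rule lipschitz_on_continuous_on)
  \<comment> \<open>The drift along the path encoded by \<open>w\<close>, that is y = x + exp (2 K
    r) w.\<close>
  define h where "h w r = b (x + exp (2 * K * r) * apply_bcontfun w r)"
    for w :: "real \<Rightarrow>\<^sub>C real" and r
  have h_cont: "continuous_on A (h w)" for w A
    unfolding h_def by (intro continuous_intros continuous_on_compose2[OF b_cont]) auto
  \<comment> \<open>Bounded continuous functions live on the whole line; \<open>max t 0\<close>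
    extends the image by 0 to negative times.\<close>
  define \<Gamma> where "\<Gamma> w t = exp (- (2 * K) * max t 0) * integral {0..max t 0} (h w)"
    for w and t :: real
  have h_bound: "\<bar>h w r\<bar> \<le> (\<bar>b x\<bar> + K * norm w) * exp (2 * K * r)" if "r \<ge> 0" for w r
  proof -
    have "\<bar>h w r\<bar> \<le> \<bar>b x\<bar> + K * \<bar>exp (2 * K * r) * apply_bcontfun w r\<bar>"
      using lipK[of "x + exp (2 * K * r) * apply_bcontfun w r" x] by (simp add: h_def)
    also have "K * \<bar>exp (2 * K * r) * apply_bcontfun w r\<bar> \<le> K * (exp (2 * K * r) * norm w)"
      using norm_bounded[of w r] K by (intro mult_left_mono) (auto simp: abs_mult)
    also have "\<bar>b x\<bar> \<le> \<bar>b x\<bar> * exp (2 * K * r)"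
      using that K mult_left_mono[of 1 "exp (2 * K * r)" "\<bar>b x\<bar>"] by simp
    finally show ?thesis by (simp add: algebra_simps)
  qed
  have \<Gamma>_bc: "\<Gamma> w \<in> bcontfun" for w
  proof (rule bcontfun_normI)
    have "continuous_on {0..} (\<lambda>s. integral {0..s} (h w))"
      by (rule DERIV_continuous_on[OF integral_from_0_derivative[OF h_cont]]) simp
    then have "continuous_on UNIV (\<lambda>t. integral {0..max t 0} (h w))"
      by (rule continuous_on_compose2) (auto intro!: continuous_intros)
    then show "continuous_on UNIV (\<Gamma> w)" unfolding \<Gamma>_def by (intro continuous_intros)
    show "norm (\<Gamma> w t) \<le> (\<bar>b x\<bar> + K * norm w) / (2 * K)" for t
      unfolding \<Gamma>_def real_norm_def using K h_bound
      by (intro exp_weighted_integral_le h_cont) auto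
  qed
  define \<Phi> where "\<Phi> w = Bcontfun (\<Gamma> w)" for w
  have \<Phi>: "apply_bcontfun (\<Phi> w) = \<Gamma> w" for w
    unfolding \<Phi>_def by (rule Bcontfun_inverse[OF \<Gamma>_bc])
  have "dist (\<Phi> v) (\<Phi> w) \<le> 1 / 2 * dist v w" for v w
  proof (rule dist_bound)
    fix t :: real
    let ?s = "max t 0"
    have "\<Gamma> v t - \<Gamma> w t = exp (- (2 * K) * ?s) * integral {0..?s} (\<lambda>r. h v r - h w r)"
      by (simp add: \<Gamma>_def right_diff_distrib
          Henstock_Kurzweil_Integration.integral_diff[OF integrable_continuous_real[OF h_cont] integrable_continuous_real[OF h_cont]])
    also have "\<bar>\<dots>\<bar> \<le> (K * dist v w) / (2 * K)"
    proof (rule exp_weighted_integral_le)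
      fix r assume "r \<in> {0..?s}"
      have "\<bar>h v r - h w r\<bar> \<le> K * \<bar>exp (2 * K * r) * (apply_bcontfun v r - apply_bcontfun w r)\<bar>"
        using lipK[of "x + exp (2 * K * r) * apply_bcontfun v r" "x + exp (2 * K * r) * apply_bcontfun w r"]
        by (simp add: h_def right_diff_distrib)
      also have "\<dots> \<le> K * (exp (2 * K * r) * dist v w)"
        using dist_bounded[of v r w] K by (intro mult_left_mono) (auto simp: abs_mult dist_real_def)
      finally show "\<bar>h v r - h w r\<bar> \<le> K * dist v w * exp (2 * K * r)" by (simp add: mult_ac)
    qed (use K in \<open>auto intro!: continuous_intros h_cont\<close>)
    finally show "dist (apply_bcontfun (\<Phi> v) t) (apply_bcontfun (\<Phi> w) t) \<le> 1 / 2 * dist v w"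
      using K by (simp add: \<Phi> dist_real_def)
  qed
  then obtain w where w: "\<Phi> w = w" using banach_fix_type[of "1 / 2" \<Phi>] by auto
  define y where "y t = x + integral {0..t} (h w)" for t
  have y: "y t = x + exp (2 * K * t) * apply_bcontfun w t" if "t \<ge> 0" for t
  proof -
    have "apply_bcontfun w t = \<Gamma> w t" using \<Phi>[of w] by (simp add: w)
    then show ?thesis using that by (simp add: y_def \<Gamma>_def exp_minus)
  qed
  show ?thesis
  proof
    show "y 0 = x" by (simp add: y_def)
    fix t :: real assume t: "t \<ge> 0"
    have "(y has_real_derivative 0 + h w t) (at t within {0..})"
      unfolding y_def by (intro DERIV_add DERIV_const integral_from_0_derivative h_cont t)
    then show "(y has_real_derivative b (y t)) (at t within {0..})"
      using y[OF t] by (simp add: h_def)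
  qed
qed

text \<open>Gronwall's argument: the Lipschitz bound makes
  \<open>exp (- 2 * C * t) * (y t - z t)\<^sup>2\<close> nonincreasing, and it starts at 0. The
  minus sign in \<open>d\<close> turns this into monotone growth.\<close>

lemma ode_solution_unique:
  fixes b :: "real \<Rightarrow> real"
  assumes lip: "C-lipschitz_on UNIV b"
    and y: "continuous_on {0..T} y" "\<And>t. 0 < t \<Longrightarrow> t < T \<Longrightarrow> (y has_real_derivative b (y t)) (at t)"
    and z: "continuous_on {0..T} z" "\<And>t. 0 < t \<Longrightarrow> t < T \<Longrightarrow> (z has_real_derivative b (z t)) (at t)"
    and init: "y 0 = z 0" and t: "t \<in> {0..T}"
  shows "y t = z t"
proof -
  define d where "d t = - (exp (- 2 * C * t) * (y t - z t)\<^sup>2)" for t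
  have "d 0 \<le> d t"
  proof (rule DERIV_nonneg_imp_increasing_open[where f=d])
    show "0 \<le> t" using t by simp
    have "continuous_on {0..T} d" unfolding d_def by (intro continuous_intros y z)
    then show "continuous_on {0..t} d" by (rule continuous_on_subset) (use t in auto)
    fix s assume s: "0 < s" "s < t"
    then have sT: "s < T" using t by simp
    define D where "D = exp (- 2 * C * s) * (2 * C * (y s - z s)\<^sup>2 - 2 * (y s - z s) * (b (y s) - b (z s)))"
    have "(d has_real_derivative D) (at s)"
      unfolding d_def D_def
      by (rule derivative_eq_intros y(2)[OF s(1) sT] z(2)[OF s(1) sT] refl)+
        (simp add: algebra_simps power2_eq_square)
    moreover have "(y s - z s) * (b (y s) - b (z s)) \<le> C * (y s - z s)\<^sup>2"
    proof -
      have "(y s - z s) * (b (y s) - b (z s)) \<le> \<bar>y s - z s\<bar> * \<bar>b (y s) - b (z s)\<bar>"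
        by (metis abs_ge_self abs_mult)
      also have "\<dots> \<le> \<bar>y s - z s\<bar> * (C * \<bar>y s - z s\<bar>)"
        using lipschitz_onD[OF lip, of "y s" "z s"] by (intro mult_left_mono) (auto simp: dist_real_def)
      also have "\<dots> = C * (y s - z s)\<^sup>2" by (simp add: power2_eq_square)
      finally show ?thesis .
    qed
    then have "0 \<le> 2 * C * (y s - z s)\<^sup>2 - 2 * (y s - z s) * (b (y s) - b (z s))" by linarith
    then have "0 \<le> D" unfolding D_def by (intro mult_nonneg_nonneg) auto
    ultimately show "\<exists>D. (d has_real_derivative D) (at s) \<and> 0 \<le> D" by blast
  qed
  then have "exp (- 2 * C * t) * (y t - z t)\<^sup>2 \<le> 0" using init by (simp add: d_def)
  then have "(y t - z t)\<^sup>2 \<le> 0" by (simp add: mult_le_0_iff)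
  then show ?thesis by simp
qed

lemma ode_solution_interior:
  assumes "\<And>t. t \<ge> 0 \<Longrightarrow> (y has_real_derivative b (y t)) (at t within {0..})"
  shows "continuous_on {0..} y" and "\<And>t. t > 0 \<Longrightarrow> (y has_real_derivative b (y t)) (at t)"
proof -
  show "continuous_on {0..} y" using assms by (intro DERIV_continuous_on) auto
  show "(y has_real_derivative b (y t)) (at t)" if "t > 0" for t
    using assms[of t] that at_within_interior[of t "{0..}"] by simp
qed

text \<open>With \<open>B' = b\<close>, the function \<open>B \<circ> y\<close> has derivative \<open>b (y t)\<^sup>2\<close>, so a solution cannot return to a
  point where \<open>b\<close> does not vanish.\<close>

lemma ode_solution_no_return:
  fixes b :: "real \<Rightarrow> real"
  assumes b: "continuous_on UNIV b"
    and y: "\<And>t. t \<ge> 0 \<Longrightarrow> (y has_real_derivative b (y t)) (at t within {0..})"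
    and s: "0 \<le> s" "s < s'" and pos: "b (y s) > 0"
  shows "y s' \<noteq> y s"
proof
  assume eq: "y s' = y s"
  have yc: "continuous_on {0..} y" by (rule ode_solution_interior(1)[OF y])
  have yd: "(y has_real_derivative b (y t)) (at t)" if "t > 0" for t
    by (rule ode_solution_interior(2)[OF y that])
  have ycs: "continuous_on {s..s'} y" using yc by (rule continuous_on_subset) (use s in auto)
  then have "bounded (y ` {s..s'})" by (intro compact_imp_bounded compact_continuous_image) auto
  then obtain R where "\<forall>u\<in>y ` {s..s'}. norm u \<le> R" unfolding bounded_iff by blast
  then have R: "\<bar>y t\<bar> \<le> R" if "t \<in> {s..s'}" for t using that by simp
  \<comment> \<open>An antiderivative of \<open>b\<close>, based outside the range of
    \<open>y\<close> so that its derivative is two-sided on that range.\<close>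
  define B where "B u = integral {- R - 1..u} b" for u
  have B: "(B has_real_derivative b u) (at u)" if "\<bar>u\<bar> \<le> R" for u
  proof -
    have "(B has_real_derivative b u) (at u within {- R - 1..R + 1})"
      unfolding B_def using that
      by (intro integral_has_real_derivative continuous_on_subset[OF b]) auto
    moreover have "- R - 1 < u" "u < R + 1" using that by auto
    ultimately show ?thesis using at_within_interior[of u "{- R - 1..R + 1}"] by simp
  qed
  define g where "g t = B (y t)" for t
  have gd: "(g has_real_derivative b (y t) * b (y t)) (at t)" if "s < t" "t < s'" for t
    unfolding g_def using that s by (intro DERIV_chain2[OF B yd] R) auto
  have gc: "continuous_on {s..s'} g"
    unfolding g_def using B R
    by (intro continuous_on_compose2[OF _ ycs, of "{- R..R}"] DERIV_continuous_on)
      (auto intro: has_field_derivative_at_within simp: abs_le_iff minus_le_iff)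
  have "continuous_on {s..s'} (\<lambda>t. b (y t))" using continuous_on_compose2[OF b ycs] by simp
  then have "((\<lambda>t. b (y t)) \<longlongrightarrow> b (y s)) (at s within {s..s'})"
    using s by (auto simp: continuous_on_def)
  then have "\<forall>\<^sub>F t in at s within {s..s'}. b (y t) > 0" using pos by (rule order_tendstoD)
  then have "\<forall>\<^sub>F t in at_right s. b (y t) > 0"
    using s by (simp add: at_within_Icc_at_right)
  then obtain e where e: "e > s" "\<And>t. s < t \<Longrightarrow> t < e \<Longrightarrow> b (y t) > 0"
    by (auto simp: eventually_at_right_field)
  \<comment> \<open>Just after \<open>s\<close> the derivative of \<open>g\<close> is strictly
    positive; from \<open>m\<close> on it is merely a square. The strict gain on the first piece is
    therefore never lost.\<close>
  define m where "m = min e s'"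
  have m: "s < m" "m \<le> s'" using e s by (auto simp: m_def)
  have "g s < g m"
  proof (rule DERIV_pos_imp_increasing_open[OF m(1)])
    show "continuous_on {s..m} g" using gc by (rule continuous_on_subset) (use m in auto)
    fix t assume t: "s < t" "t < m"
    then have "b (y t) > 0" using e by (auto simp: m_def)
    then show "\<exists>D. (g has_real_derivative D) (at t) \<and> 0 < D"
      using gd[of t] t m by (intro exI[of _ "b (y t) * b (y t)"]) auto
  qed
  also have "g m \<le> g s'"
  proof (rule DERIV_nonneg_imp_increasing_open[OF m(2)])
    show "continuous_on {m..s'} g" using gc by (rule continuous_on_subset) (use m in auto)
    show "\<exists>D. (g has_real_derivative D) (at t) \<and> 0 \<le> D" if "m < t" "t < s'" for t
      using gd[of t] that m by (intro exI[of _ "b (y t) * b (y t)"]) auto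
  qed
  finally show False using eq by (simp add: g_def)
qed

lemma fluid_hitting_time_eq_integral:
  fixes b :: "real \<Rightarrow> real"
  assumes lip: "C-lipschitz_on UNIV b" and xr: "x < r" and pos: "\<And>u. u \<in> {x..r} \<Longrightarrow> b u > 0"
  shows "fluid_hitting_time b x r = integral {x..r} (\<lambda>u. 1 / b u)"
proof -
  have bc: "continuous_on A b" for A
    using lipschitz_on_continuous_on[OF lip] continuous_on_subset by blast
  define y where "y = fluid_path b x"
  have "\<exists>y. y 0 = x \<and> (\<forall>t\<ge>0. (y has_real_derivative b (y t)) (at t within {0..}))"
    using global_ode_solution[OF lip] by metis
  then have y: "y 0 = x" "\<And>t. t \<ge> 0 \<Longrightarrow> (y has_real_derivative b (y t)) (at t within {0..})"
    using someI_ex[of "\<lambda>y. y 0 = x \<and> (\<forall>t\<ge>0. (y has_real_derivative b (y t)) (at t within {0..}))"]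
    unfolding y_def fluid_path_def by blast+
  define b' where "b' u = b (max x (min r u))" for u
  have lip': "C-lipschitz_on UNIV b'"
  proof (rule lipschitz_onI)
    fix u v :: real
    have "dist (b' u) (b' v) \<le> C * dist (max x (min r u)) (max x (min r v))"
      unfolding b'_def by (rule lipschitz_onD[OF lip]) auto
    also have "\<dots> \<le> C * dist u v"
      using lipschitz_on_nonneg[OF lip] by (intro mult_left_mono) (auto simp: dist_real_def)
    finally show "dist (b' u) (b' v) \<le> C * dist u v" .
  qed (rule lipschitz_on_nonneg[OF lip])
  obtain z where z: "z 0 = x" "\<And>t. t \<ge> 0 \<Longrightarrow> (z has_real_derivative b' (z t)) (at t within {0..})"
    using global_ode_solution[OF lip'] by metis
  have zc: "continuous_on {0..} z" by (rule ode_solution_interior(1)[OF z(2)])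
  have zd: "(z has_real_derivative b' (z t)) (at t)" if "t > 0" for t
    by (rule ode_solution_interior(2)[OF z(2) that])
  obtain u0 where u0: "u0 \<in> {x..r}" "\<And>u. u \<in> {x..r} \<Longrightarrow> b u0 \<le> b u"
    using continuous_attains_inf[of "{x..r}" b] xr bc by auto
  have b0: "b u0 > 0" using pos u0 by simp
  have b'_ge: "b' u \<ge> b u0" for u unfolding b'_def using xr by (intro u0) auto
  have z_mono: "z s < z t" if "0 \<le> s" "s < t" for s t
  proof (rule DERIV_pos_imp_increasing_open[OF that(2)])
    show "continuous_on {s..t} z" using zc by (rule continuous_on_subset) (use that in auto)
    show "\<exists>D. (z has_real_derivative D) (at v) \<and> 0 < D" if "s < v" "v < t" for v
      using zd[of v] b'_ge[of "z v"] b0 that \<open>0 \<le> s\<close> by (intro exI[of _ "b' (z v)"]) auto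
  qed
  define T where "T = (r - x) / b u0"
  have T: "T > 0" using xr b0 by (simp add: T_def)
  have "z 0 - b u0 * 0 \<le> z T - b u0 * T"
  proof (rule DERIV_nonneg_imp_increasing_open[where f="\<lambda>t. z t - b u0 * t"])
    show "continuous_on {0..T} (\<lambda>t. z t - b u0 * t)"
      by (intro continuous_intros continuous_on_subset[OF zc]) auto
    show "\<exists>D. ((\<lambda>t. z t - b u0 * t) has_real_derivative D) (at v) \<and> 0 \<le> D" if "0 < v" "v < T" for v
      using b'_ge[of "z v"] that
      by (intro exI[of _ "b' (z v) - b u0"]) (auto intro!: derivative_eq_intros zd)
  qed (use T in simp)
  then have "r \<le> z T" using z(1) b0 by (simp add: T_def)
  then obtain s0 where s0: "0 \<le> s0" "z s0 = r"
    using IVT'[of z 0 r T] z(1) xr T continuous_on_subset[OF zc, of "{0..T}"] by auto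
  then have s0_pos: "s0 > 0" using z(1) xr by (cases "s0 = 0") auto
  have z_in: "x < z t" "z t < r" if "0 < t" "t < s0" for t
    using z_mono[of 0 t] z_mono[of t s0] that z(1) s0 by auto
  have b'_z: "b' (z t) = b (z t)" if "0 < t" "t < s0" for t
    using z_in[OF that] by (simp add: b'_def)
  have ys0: "y s0 = r"
  proof -
    have "y s0 = z s0"
    proof (rule ode_solution_unique[OF lip, where T=s0 and y=y and z=z and t=s0])
      show "continuous_on {0..s0} y" "continuous_on {0..s0} z"
        using ode_solution_interior(1)[OF y(2)] zc by (auto intro: continuous_on_subset)
      show "(y has_real_derivative b (y t)) (at t)" if "0 < t" for t
        by (rule ode_solution_interior(2)[OF y(2) that])
      show "(z has_real_derivative b (z t)) (at t)" if "0 < t" "t < s0" for t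
        using zd[OF that(1)] b'_z[OF that] by simp
    qed (use s0 y z in auto)
    then show ?thesis using s0 by simp
  qed
  have hit: "fluid_hitting_time b x r = s0"
    unfolding fluid_hitting_time_def y_def[symmetric]
  proof (rule the_equality)
    fix s assume s: "s > 0 \<and> y s = r"
    have "b r > 0" using pos xr by simp
    then show "s = s0"
      using ode_solution_no_return[OF bc y(2), of s s0] ode_solution_no_return[OF bc y(2), of s0 s]
        s s0_pos ys0 by (cases s s0 rule: linorder_cases) auto
  qed (use s0_pos ys0 in auto)
  define G where "G u = integral {x..u} (\<lambda>u. 1 / b u)" for u
  have Gd: "(G has_real_derivative 1 / b u) (at u within {x..r})" if "u \<in> {x..r}" for u
    unfolding G_def
  proof (rule integral_has_real_derivative[OF _ that])
    have "\<forall>u\<in>{x..r}. b u \<noteq> 0" using pos by (metis less_irrefl)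
    then show "continuous_on {x..r} (\<lambda>u. 1 / b u)" by (intro continuous_intros bc)
  qed
  have "G (z s0) - s0 = G (z 0) - 0"
  proof (rule DERIV_isconst_end[OF s0_pos])
    have Gc: "continuous_on {x..r} G" by (rule DERIV_continuous_on[OF Gd])
    have zs0: "continuous_on {0..s0} z" by (rule continuous_on_subset[OF zc]) auto
    have "z t \<in> {x..r}" if t: "t \<in> {0..s0}" for t
    proof -
      consider "t = 0" | "t = s0" | "0 < t" "t < s0" using t by fastforce
      then show ?thesis using z_in[of t] s0 z(1) xr by cases auto
    qed
    then have "continuous_on {0..s0} (\<lambda>t. G (z t))"
      by (intro continuous_on_compose2[OF Gc zs0]) auto
    then show "continuous_on {0..s0} (\<lambda>t. G (z t) - t)"
      by (intro continuous_on_diff continuous_on_id)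
    fix t assume t: "0 < t" "t < s0"
    have "(G has_real_derivative 1 / b (z t)) (at (z t))"
      using Gd[of "z t"] z_in[OF t] at_within_interior[of "z t" "{x..r}"] by simp
    from DERIV_chain2[OF this zd[OF t(1)]]
    have "((\<lambda>t. G (z t)) has_real_derivative 1) (at t)"
      using b'_z[OF t] pos[of "z t"] z_in[OF t] by simp
    then show "((\<lambda>t. G (z t) - t) has_real_derivative 0) (at t)"
      by (auto intro!: derivative_eq_intros)
  qed
  then have "s0 = G r" using s0 z(1) by (simp add: G_def)
  then show ?thesis using hit by (simp add: G_def)
qed

section \<open>Exponential rates and Gaussian tails\<close>

text \<open>For \<open>s\<close> tending to infinity this says that log u_n / s_n tends to
  \<open>c\<close>. The exponential form implies that \<open>u n\<close> is eventually positive and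
  combines directly with sums and products.\<close>

definition has_exp_rate :: "(nat \<Rightarrow> real) \<Rightarrow> (nat \<Rightarrow> real) \<Rightarrow> real \<Rightarrow> bool" where
  "has_exp_rate s u c \<longleftrightarrow> (\<forall>e>0. \<forall>\<^sub>F n in sequentially.
     exp (s n * (c - e)) \<le> u n \<and> u n \<le> exp (s n * (c + e)))"

lemma has_exp_rate_ext_ln:
  assumes s: "filterlim s at_top sequentially" and u: "has_exp_rate s u c"
  shows "(\<lambda>n. ereal (1 / s n) * ext_ln (u n)) \<longlonglongrightarrow> ereal c"
proof -
  have s_pos: "\<forall>\<^sub>F n in sequentially. s n > 0"
    using s by (simp add: filterlim_at_top_dense)
  have bounds: "\<forall>\<^sub>F n in sequentially. u n > 0 \<and> c - e \<le> ln (u n) / s n \<and> ln (u n) / s n \<le> c + e"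
    if "e > 0" for e
  proof -
    have "\<forall>\<^sub>F n in sequentially. exp (s n * (c - e)) \<le> u n \<and> u n \<le> exp (s n * (c + e))"
      using u that by (simp add: has_exp_rate_def)
    with s_pos show ?thesis
    proof eventually_elim
      case (elim n)
      then have pos: "u n > 0" using exp_gt_zero[of "s n * (c - e)"] by linarith
      have "s n * (c - e) \<le> ln (u n)" "ln (u n) \<le> s n * (c + e)"
        using elim pos by (auto simp: ln_ge_iff) (metis exp_gt_zero ln_exp ln_le_cancel_iff)
      then show ?case using pos elim by (simp add: field_simps)
    qed
  qed
  have "(\<lambda>n. ln (u n) / s n) \<longlonglongrightarrow> c"
  proof (rule tendstoI)
    fix e :: real assume e: "e > 0"
    then have "e / 2 > 0" by simp
    from bounds[OF this] show "\<forall>\<^sub>F n in sequentially. dist (ln (u n) / s n) c < e"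
    proof eventually_elim
      case (elim n)
      then show ?case using e unfolding dist_real_def by linarith
    qed
  qed
  then have "(\<lambda>n. ereal (ln (u n) / s n)) \<longlonglongrightarrow> ereal c" by simp
  moreover have "\<forall>\<^sub>F n in sequentially. ereal (ln (u n) / s n) = ereal (1 / s n) * ext_ln (u n)"
    using bounds[of 1] by (auto simp: ext_ln_def elim: eventually_mono)
  ultimately show ?thesis by (rule Lim_transform_eventually)
qed

lemma chernoff_upper:
  fixes Z :: "'w \<Rightarrow> real"
  assumes N: "finite_measure N" and A: "A \<in> sets N" and Z: "Z \<in> borel_measurable N"
    and int: "integrable N (\<lambda>\<omega>. indicator A \<omega> * exp (\<theta> * Z \<omega>))" and \<theta>: "\<theta> \<ge> 0"
  shows "measure N {\<omega> \<in> space N. \<omega> \<in> A \<and> Z \<omega> > z}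
    \<le> exp (- \<theta> * z) * (\<integral>\<omega>. indicator A \<omega> * exp (\<theta> * Z \<omega>) \<partial>N)"
proof -
  interpret finite_measure N by (rule N)
  let ?E = "{\<omega> \<in> space N. \<omega> \<in> A \<and> Z \<omega> > z}"
  have E [measurable]: "?E \<in> sets N" using A Z by measurable
  have "measure N ?E = (\<integral>\<omega>. indicator ?E \<omega> \<partial>N)" by (simp add: Int_absorb2)
  also have "\<dots> \<le> (\<integral>\<omega>. exp (- \<theta> * z) * (indicator A \<omega> * exp (\<theta> * Z \<omega>)) \<partial>N)"
  proof (rule integral_mono)
    show "integrable N (indicator ?E :: 'w \<Rightarrow> real)" by (rule integrable_real_indicator[OF E]) (simp add: emeasure_eq_measure)
    show "integrable N (\<lambda>\<omega>. exp (- \<theta> * z) * (indicator A \<omega> * exp (\<theta> * Z \<omega>)))" using int by simp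
    show "indicator ?E \<omega> \<le> exp (- \<theta> * z) * (indicator A \<omega> * exp (\<theta> * Z \<omega>))" for \<omega>
    proof (cases "\<omega> \<in> ?E")
      case True
      then have "0 \<le> - \<theta> * z + \<theta> * Z \<omega>"
        using \<theta> mult_left_mono[of z "Z \<omega>" \<theta>] by simp
      then have "1 \<le> exp (- \<theta> * z) * exp (\<theta> * Z \<omega>)" unfolding exp_add[symmetric] by simp
      then show ?thesis using True by simp
    qed simp
  qed
  finally show ?thesis by simp
qed

text \<open>Between \<open>z\<close> and \<open>y\<close> the integrand is at most
  \<open>exp (\<theta> * y)\<close>. Below \<open>z\<close> and above \<open>y\<close> it is
  enlarged by the factors \<open>exp (\<eta> * (z - Z))\<close> and
  \<open>exp (\<eta> * (Z - y))\<close>, which are at least 1 there, so the outer parts become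
  moment generating functions at shifted arguments.\<close>

lemma mgf_three_pieces:
  fixes Z :: "'w \<Rightarrow> real"
  assumes N: "finite_measure N" and A: "A \<in> sets N" and Z: "Z \<in> borel_measurable N"
    and int: "\<And>\<theta>. integrable N (\<lambda>\<omega>. indicator A \<omega> * exp (\<theta> * Z \<omega>))"
    and \<theta>: "\<theta> \<ge> 0" and \<eta>: "\<eta> \<ge> 0"
  shows "(\<integral>\<omega>. indicator A \<omega> * exp (\<theta> * Z \<omega>) \<partial>N)
    \<le> exp (\<theta> * y) * measure N {\<omega> \<in> space N. \<omega> \<in> A \<and> Z \<omega> > z}
      + exp (\<eta> * z) * (\<integral>\<omega>. indicator A \<omega> * exp ((\<theta> - \<eta>) * Z \<omega>) \<partial>N)
      + exp (- \<eta> * y) * (\<integral>\<omega>. indicator A \<omega> * exp ((\<theta> + \<eta>) * Z \<omega>) \<partial>N)"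
proof -
  interpret finite_measure N by (rule N)
  let ?E = "{\<omega> \<in> space N. \<omega> \<in> A \<and> Z \<omega> > z}"
  have E [measurable]: "?E \<in> sets N" using A Z by measurable
  have intE: "integrable N (indicator ?E :: 'w \<Rightarrow> real)" by (rule integrable_real_indicator[OF E]) (simp add: emeasure_eq_measure)
  have "(\<integral>\<omega>. indicator A \<omega> * exp (\<theta> * Z \<omega>) \<partial>N)
     \<le> (\<integral>\<omega>. exp (\<theta> * y) * indicator ?E \<omega>
          + exp (\<eta> * z) * (indicator A \<omega> * exp ((\<theta> - \<eta>) * Z \<omega>))
          + exp (- \<eta> * y) * (indicator A \<omega> * exp ((\<theta> + \<eta>) * Z \<omega>)) \<partial>N)"
  proof (rule integral_mono)
    show "integrable N (\<lambda>\<omega>. exp (\<theta> * y) * indicator ?E \<omega>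
          + exp (\<eta> * z) * (indicator A \<omega> * exp ((\<theta> - \<eta>) * Z \<omega>))
          + exp (- \<eta> * y) * (indicator A \<omega> * exp ((\<theta> + \<eta>) * Z \<omega>)))"
      by (intro Bochner_Integration.integrable_add integrable_mult_right intE int)
    show "indicator A \<omega> * exp (\<theta> * Z \<omega>) \<le> exp (\<theta> * y) * indicator ?E \<omega>
          + exp (\<eta> * z) * (indicator A \<omega> * exp ((\<theta> - \<eta>) * Z \<omega>))
          + exp (- \<eta> * y) * (indicator A \<omega> * exp ((\<theta> + \<eta>) * Z \<omega>))"
      if "\<omega> \<in> space N" for \<omega>
    proof (cases "\<omega> \<in> A")
      case True
      have e1: "exp (\<eta> * z) * exp ((\<theta> - \<eta>) * Z \<omega>) = exp (\<theta> * Z \<omega> + \<eta> * (z - Z \<omega>))"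
        by (simp add: exp_add[symmetric] algebra_simps)
      have e2: "exp (- \<eta> * y) * exp ((\<theta> + \<eta>) * Z \<omega>) = exp (\<theta> * Z \<omega> + \<eta> * (Z \<omega> - y))"
        by (simp add: exp_add[symmetric] algebra_simps)
      consider "Z \<omega> \<le> z" | "Z \<omega> \<ge> y" | "z < Z \<omega>" "Z \<omega> < y" by linarith
      then have "exp (\<theta> * Z \<omega>) \<le> exp (\<theta> * y) * indicator ?E \<omega>
          + exp (\<theta> * Z \<omega> + \<eta> * (z - Z \<omega>)) + exp (\<theta> * Z \<omega> + \<eta> * (Z \<omega> - y))"
      proof cases
        case 1
        then have "exp (\<theta> * Z \<omega>) \<le> exp (\<theta> * Z \<omega> + \<eta> * (z - Z \<omega>))" using \<eta> by simp
        then show ?thesis by (simp add: add_increasing add_increasing2)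
      next
        case 2
        then have "exp (\<theta> * Z \<omega>) \<le> exp (\<theta> * Z \<omega> + \<eta> * (Z \<omega> - y))" using \<eta> by simp
        then show ?thesis by (simp add: add_increasing)
      next
        case 3
        then have "exp (\<theta> * Z \<omega>) \<le> exp (\<theta> * y)" using \<theta> by (simp add: mult_left_mono)
        then show ?thesis using 3 True that by (simp add: add_increasing2)
      qed
      then show ?thesis using True by (simp add: e1 e2[simplified])
    qed simp
  qed fact
  also have "\<dots> = exp (\<theta> * y) * measure N ?E
      + exp (\<eta> * z) * (\<integral>\<omega>. indicator A \<omega> * exp ((\<theta> - \<eta>) * Z \<omega>) \<partial>N)
      + exp (- \<eta> * y) * (\<integral>\<omega>. indicator A \<omega> * exp ((\<theta> + \<eta>) * Z \<omega>) \<partial>N)"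
    using intE int by (simp add: Int_absorb2)
  finally show ?thesis .
qed

text \<open>The lower bound is Cramer's tilting argument, with the tilt \<open>\<theta> = (z + \<epsilon>) / V\<close> that moves the
  mean of \<open>Z\<close> to the midpoint of \<open>(z, z + 2 \<epsilon>)\<close>.\<close>

lemma gaussian_tail_rate:
  fixes Z :: "nat \<Rightarrow> 'w \<Rightarrow> real"
  assumes s: "filterlim s at_top sequentially" and V: "V > 0" and z: "z > 0"
    and good: "\<forall>\<^sub>F n in sequentially. finite_measure (N n) \<and> A n \<in> sets (N n) \<and>
        Z n \<in> borel_measurable (N n) \<and> (\<forall>\<theta>. integrable (N n) (\<lambda>\<omega>. indicator (A n) \<omega> * exp (\<theta> * Z n \<omega>)))"
    and mgf: "\<And>\<theta>. has_exp_rate s (\<lambda>n. \<integral>\<omega>. indicator (A n) \<omega> * exp (\<theta> * s n * Z n \<omega>) \<partial>N n) (V * \<theta>\<^sup>2 / 2)"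
  shows "has_exp_rate s (\<lambda>n. measure (N n) {\<omega> \<in> space (N n). \<omega> \<in> A n \<and> Z n \<omega> > z}) (- (z\<^sup>2 / (2 * V)))"
proof -
  define m where "m \<theta> n = (\<integral>\<omega>. indicator (A n) \<omega> * exp (\<theta> * s n * Z n \<omega>) \<partial>N n)" for \<theta> n
  define Pr where "Pr n = measure (N n) {\<omega> \<in> space (N n). \<omega> \<in> A n \<and> Z n \<omega> > z}" for n
  have mgf: "\<forall>\<^sub>F n in sequentially. exp (s n * (V * \<theta>\<^sup>2 / 2 - e)) \<le> m \<theta> n \<and>
      m \<theta> n \<le> exp (s n * (V * \<theta>\<^sup>2 / 2 + e))" if "e > 0" for e \<theta>
    using mgf[of \<theta>] that by (simp add: has_exp_rate_def m_def)
  have s_ge: "\<forall>\<^sub>F n in sequentially. s n \<ge> K" for K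
    using s by (simp add: filterlim_at_top)
  have "\<forall>\<^sub>F n in sequentially. exp (s n * (- (z\<^sup>2 / (2 * V)) - e)) \<le> Pr n \<and>
      Pr n \<le> exp (s n * (- (z\<^sup>2 / (2 * V)) + e))" if e: "e > 0" for e
  proof (rule eventually_conj)
    \<comment> \<open>The tilt \<open>z / V\<close> minimises V \<theta>^2 / 2 - \<theta> z, the
      exponent left by Chernoff's bound.\<close>
    show "\<forall>\<^sub>F n in sequentially. Pr n \<le> exp (s n * (- (z\<^sup>2 / (2 * V)) + e))"
      using good mgf[OF e, of "z / V"] s_ge[of 1]
    proof eventually_elim
      case (elim n)
      have "Pr n \<le> exp (- (z / V * s n) * z) * m (z / V) n"
        unfolding Pr_def m_def
      proof (rule chernoff_upper)
        show "integrable (N n) (\<lambda>\<omega>. indicator (A n) \<omega> * exp (z / V * s n * Z n \<omega>))"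
          using elim by blast
      qed (use elim V z in auto)
      also have "\<dots> \<le> exp (- (z / V * s n) * z) * exp (s n * (V * (z / V)\<^sup>2 / 2 + e))"
        using elim by (intro mult_left_mono) auto
      also have "\<dots> = exp (s n * (- (z\<^sup>2 / (2 * V)) + e))"
        unfolding exp_add[symmetric] using V by (simp add: field_simps power2_eq_square)
      finally show ?case .
    qed
    \<comment> \<open>Small enough that moving the tilt from \<open>z / V\<close> to
      \<open>(z + \<epsilon>) / V\<close> and paying for the far end
      \<open>z + 2 * \<epsilon>\<close> of the window costs at most \<open>e / 2\<close> in the
      exponent.\<close>
    define \<epsilon> where "\<epsilon> = min 1 (e * V / (8 * (z + 1)))"
    have "\<epsilon> \<le> e * V / (8 * (z + 1))" by (simp add: \<epsilon>_def)
    then have "\<epsilon> * (8 * (z + 1)) \<le> e * V" using z by (subst (asm) pos_le_divide_eq) auto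
    moreover have "0 < \<epsilon>" "\<epsilon> \<le> 1" using e V z by (auto simp: \<epsilon>_def)
    ultimately have \<epsilon>: "0 < \<epsilon>" "\<epsilon> \<le> 1" "\<epsilon> * (8 * (z + 1)) \<le> e * V" by auto
    define \<theta> where "\<theta> = (z + \<epsilon>) / V"
    \<comment> \<open>The shift that minimises both outer exponents: \<theta> - \<eta> = z / V and
      \<theta> + \<eta> = (z + 2 \<epsilon>) / V are the Chernoff tilts of the two ends. Both fall
      short of \<open>c\<close> by \<open>\<epsilon>\<^sup>2 / (2 * V)\<close>.\<close>
    define \<eta> where "\<eta> = \<epsilon> / V"
    define c where "c = V * \<theta>\<^sup>2 / 2"
    \<comment> \<open>The error allowed in the three moment generating functions:
      \<open>2 * \<kappa>\<close> may use up at most half of the gap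
      \<open>\<epsilon>\<^sup>2 / (2 * V)\<close> and at most half of \<open>e\<close>.\<close>
    define \<kappa> where "\<kappa> = min (e / 4) (\<epsilon>\<^sup>2 / (8 * V))"
    have \<kappa>: "\<kappa> > 0" "\<kappa> \<le> e / 4" "\<kappa> \<le> \<epsilon>\<^sup>2 / (8 * V)" using e \<epsilon> V by (auto simp: \<kappa>_def)
    have \<theta>: "\<theta> \<ge> 0" and \<eta>: "\<eta> \<ge> 0" using \<epsilon> V z by (auto simp: \<theta>_def \<eta>_def)
    have left: "\<eta> * z + V * (\<theta> - \<eta>)\<^sup>2 / 2 = c - \<epsilon>\<^sup>2 / (2 * V)"
      and right: "- \<eta> * (z + 2 * \<epsilon>) + V * (\<theta> + \<eta>)\<^sup>2 / 2 = c - \<epsilon>\<^sup>2 / (2 * V)"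
      using V by (simp_all add: c_def \<theta>_def \<eta>_def power2_eq_square field_simps)
    have exponent: "- (z\<^sup>2 / (2 * V)) - e \<le> c - 2 * \<kappa> - \<theta> * (z + 2 * \<epsilon>)"
    proof -
      have "c - \<theta> * (z + 2 * \<epsilon>) = - (z\<^sup>2 / (2 * V)) - (2 * z * \<epsilon> + 3 / 2 * \<epsilon>\<^sup>2) / V"
        using V by (simp add: c_def \<theta>_def power2_eq_square field_simps)
      moreover have "(2 * z * \<epsilon> + 3 / 2 * \<epsilon>\<^sup>2) / V \<le> e / 2"
      proof -
        have "\<epsilon> * \<epsilon> \<le> \<epsilon> * 1" using \<epsilon> by (intro mult_left_mono) auto
        moreover have "0 \<le> \<epsilon> * z" using \<epsilon> z by simp
        moreover have "2 * (2 * z * \<epsilon> + 3 / 2 * \<epsilon>\<^sup>2) = 4 * (\<epsilon> * z) + 3 * (\<epsilon> * \<epsilon>)"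
          "\<epsilon> * (8 * (z + 1)) = 8 * (\<epsilon> * z) + 8 * \<epsilon>"
          by (simp_all add: power2_eq_square algebra_simps)
        ultimately have "2 * (2 * z * \<epsilon> + 3 / 2 * \<epsilon>\<^sup>2) \<le> \<epsilon> * (8 * (z + 1))"
          using \<epsilon>(1) by linarith
        then show ?thesis using \<epsilon>(3) V by (simp add: field_simps)
      qed
      ultimately show ?thesis using \<kappa>(2) by linarith
    qed
    \<comment> \<open>The threshold with \<open>ln 4\<close> makes each outer piece at most a
      quarter of \<open>E\<close>, so the window carries at least \<open>E / 2\<close>; the one with
      \<open>ln 2\<close> absorbs this factor into another \<kappa>.\<close>
    show "\<forall>\<^sub>F n in sequentially. exp (s n * (- (z\<^sup>2 / (2 * V)) - e)) \<le> Pr n"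
      using good mgf[OF \<kappa>(1), of \<theta>] mgf[OF \<kappa>(1), of "\<theta> - \<eta>"] mgf[OF \<kappa>(1), of "\<theta> + \<eta>"]
        s_ge[of 1] s_ge[of "ln 4 * (4 * V / \<epsilon>\<^sup>2)"] s_ge[of "ln 2 / \<kappa>"]
    proof eventually_elim
      case (elim n)
      define E where "E = exp (s n * (c - \<kappa>))"
      have small: "exp (s n * (c - \<epsilon>\<^sup>2 / (2 * V) + \<kappa>)) \<le> E / 4"
      proof -
        have "ln 4 * (4 * V / \<epsilon>\<^sup>2) * (\<epsilon>\<^sup>2 / (4 * V)) \<le> s n * (\<epsilon>\<^sup>2 / (4 * V))"
          using elim V by (intro mult_right_mono) auto
        then have "ln 4 \<le> s n * (\<epsilon>\<^sup>2 / (4 * V))" using V \<epsilon> by simp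
        moreover have "s n * (c - \<epsilon>\<^sup>2 / (2 * V) + \<kappa>) \<le> s n * (c - \<kappa> - \<epsilon>\<^sup>2 / (4 * V))"
          using elim \<kappa>(3) by (intro mult_left_mono) (auto simp: field_simps)
        ultimately have "s n * (c - \<epsilon>\<^sup>2 / (2 * V) + \<kappa>) \<le> s n * (c - \<kappa>) - ln 4"
          by (simp add: algebra_simps)
        then have "exp (s n * (c - \<epsilon>\<^sup>2 / (2 * V) + \<kappa>)) \<le> exp (s n * (c - \<kappa>) - ln 4)" by simp
        then show ?thesis by (simp add: E_def exp_diff)
      qed
      have tail: "exp (\<eta> * s n * z) * m (\<theta> - \<eta>) n \<le> E / 4"
      proof -
        have "exp (\<eta> * s n * z) * m (\<theta> - \<eta>) n
            \<le> exp (\<eta> * s n * z) * exp (s n * (V * (\<theta> - \<eta>)\<^sup>2 / 2 + \<kappa>))"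
          using elim by (intro mult_left_mono) auto
        also have "\<dots> = exp (s n * ((\<eta> * z + V * (\<theta> - \<eta>)\<^sup>2 / 2) + \<kappa>))"
          by (simp add: exp_add[symmetric] algebra_simps)
        finally show ?thesis using small unfolding left by linarith
      qed
      have tail': "exp (- (\<eta> * s n) * (z + 2 * \<epsilon>)) * m (\<theta> + \<eta>) n \<le> E / 4"
      proof -
        have "exp (- (\<eta> * s n) * (z + 2 * \<epsilon>)) * m (\<theta> + \<eta>) n
            \<le> exp (- (\<eta> * s n) * (z + 2 * \<epsilon>)) * exp (s n * (V * (\<theta> + \<eta>)\<^sup>2 / 2 + \<kappa>))"
          using elim by (intro mult_left_mono) auto
        also have "\<dots> = exp (s n * ((- \<eta> * (z + 2 * \<epsilon>) + V * (\<theta> + \<eta>)\<^sup>2 / 2) + \<kappa>))"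
          by (simp add: exp_add[symmetric] algebra_simps)
        finally show ?thesis using small unfolding right by linarith
      qed
      have "m \<theta> n \<le> exp (\<theta> * s n * (z + 2 * \<epsilon>)) * Pr n + exp (\<eta> * s n * z) * m (\<theta> - \<eta>) n
          + exp (- (\<eta> * s n) * (z + 2 * \<epsilon>)) * m (\<theta> + \<eta>) n"
        using mgf_three_pieces[of "N n" "A n" "Z n" "\<theta> * s n" "\<eta> * s n" "z + 2 * \<epsilon>" z] elim \<theta> \<eta>
        by (simp add: m_def Pr_def algebra_simps)
      moreover have "E \<le> m \<theta> n" using elim by (simp add: E_def c_def)
      ultimately have half: "E / 2 \<le> exp (\<theta> * s n * (z + 2 * \<epsilon>)) * Pr n"
        using tail tail' by linarith
      have "ln 2 \<le> s n * \<kappa>" using elim \<kappa>(1) by (simp add: field_simps)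
      then have "exp (s n * (c - 2 * \<kappa>)) \<le> exp (s n * (c - \<kappa>) - ln 2)" by (simp add: algebra_simps)
      also have "\<dots> = E / 2" by (simp add: E_def exp_diff)
      also note half
      finally have "exp (- (\<theta> * s n * (z + 2 * \<epsilon>))) * exp (s n * (c - 2 * \<kappa>))
          \<le> exp (- (\<theta> * s n * (z + 2 * \<epsilon>))) * (exp (\<theta> * s n * (z + 2 * \<epsilon>)) * Pr n)"
        by (intro mult_left_mono) auto
      also have "\<dots> = Pr n" by (simp add: mult.assoc[symmetric] exp_add[symmetric])
      also have "exp (- (\<theta> * s n * (z + 2 * \<epsilon>))) * exp (s n * (c - 2 * \<kappa>))
          = exp (s n * (c - 2 * \<kappa> - \<theta> * (z + 2 * \<epsilon>)))"
        by (simp add: exp_add[symmetric] algebra_simps)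
      finally have "exp (s n * (c - 2 * \<kappa> - \<theta> * (z + 2 * \<epsilon>))) \<le> Pr n" .
      moreover have "s n * (- (z\<^sup>2 / (2 * V)) - e) \<le> s n * (c - 2 * \<kappa> - \<theta> * (z + 2 * \<epsilon>))"
        using exponent elim by (intro mult_left_mono) auto
      ultimately show ?case by (meson exp_le_cancel_iff order_trans)
    qed
  qed
  then show ?thesis by (simp add: has_exp_rate_def Pr_def)
qed

section \<open>Expansion of the exponential generator\<close>

lemma lipschitz_on_mult_bounded:
  fixes f g :: "real \<Rightarrow> real"
  assumes f: "C-lipschitz_on U f" and g: "D-lipschitz_on U g"
    and A: "\<And>u. u \<in> U \<Longrightarrow> \<bar>f u\<bar> \<le> A" "0 \<le> A" and B: "\<And>u. u \<in> U \<Longrightarrow> \<bar>g u\<bar> \<le> B" "0 \<le> B"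
  shows "(A * D + B * C)-lipschitz_on U (\<lambda>u. f u * g u)"
proof (rule lipschitz_onI)
  fix u v assume uv: "u \<in> U" "v \<in> U"
  have "f u * g u - f v * g v = f u * (g u - g v) + g v * (f u - f v)" by (simp add: algebra_simps)
  also have "\<bar>\<dots>\<bar> \<le> \<bar>f u\<bar> * \<bar>g u - g v\<bar> + \<bar>g v\<bar> * \<bar>f u - f v\<bar>"
    by (rule order_trans[OF abs_triangle_ineq]) (simp add: abs_mult)
  also have "\<dots> \<le> A * (D * dist u v) + B * (C * dist u v)"
    using lipschitz_onD[OF f uv] lipschitz_onD[OF g uv] A B uv
    by (intro add_mono mult_mono) (auto simp: dist_real_def)
  finally show "dist (f u * g u) (f v * g v) \<le> (A * D + B * C) * dist u v"
    by (simp add: dist_real_def algebra_simps)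
qed (use lipschitz_on_nonneg[OF f] lipschitz_on_nonneg[OF g] A B in auto)

lemma lipschitz_on_inverse_bounded:
  fixes f :: "real \<Rightarrow> real"
  assumes f: "C-lipschitz_on U f" and B: "\<And>u. u \<in> U \<Longrightarrow> B \<le> f u" "0 < B"
  shows "(C / B\<^sup>2)-lipschitz_on U (\<lambda>u. 1 / f u)"
proof (rule lipschitz_onI)
  fix u v assume uv: "u \<in> U" "v \<in> U"
  have pos: "0 < f u" "0 < f v" using B uv by (force intro: less_le_trans)+
  have "B\<^sup>2 \<le> f u * f v"
    using B uv pos unfolding power2_eq_square by (intro mult_mono) auto
  have "dist (1 / f u) (1 / f v) = \<bar>f u - f v\<bar> / (f u * f v)"
    using pos by (simp add: dist_real_def divide_simps abs_mult)
  also have "\<dots> \<le> C * dist u v / B\<^sup>2"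
    using lipschitz_onD[OF f uv] \<open>B\<^sup>2 \<le> f u * f v\<close> B
    by (intro frac_le) (auto simp: dist_real_def)
  finally show "dist (1 / f u) (1 / f v) \<le> C / B\<^sup>2 * dist u v" by simp
qed (use lipschitz_on_nonneg[OF f] B in auto)

text \<open>The mean value inequality for \<open>G u - g y * u\<close>, whose derivative
  \<open>g u - g y\<close> is at most \<open>C * \<bar>d\<bar>\<close> between the two points; a
  Lipschitz \<open>g\<close> thus stands in for a second derivative.\<close>

lemma first_order_remainder:
  fixes G g :: "real \<Rightarrow> real"
  assumes G: "\<And>u. u \<in> {p..w} \<Longrightarrow> (G has_real_derivative g u) (at u within {p..w})"
    and g: "C-lipschitz_on {p..w} g" and y: "y \<in> {p..w}" "y + d \<in> {p..w}"
  shows "\<bar>G (y + d) - G y - g y * d\<bar> \<le> C * d\<^sup>2"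
proof -
  define I where "I = {min y (y + d)..max y (y + d)}"
  have I: "I \<subseteq> {p..w}" using y by (auto simp: I_def)
  have "norm ((G (y + d) - g y * (y + d)) - (G y - g y * y)) \<le> (C * \<bar>d\<bar>) * norm ((y + d) - y)"
  proof (rule field_differentiable_bound)
    show "convex I" by (simp add: I_def)
    fix u assume u: "u \<in> I"
    then have up: "u \<in> {p..w}" using I by auto
    show "((\<lambda>u. G u - g y * u) has_real_derivative g u - g y) (at u within I)"
      using DERIV_subset[OF G[OF up] I] by (auto intro!: derivative_eq_intros)
    have "\<bar>g u - g y\<bar> \<le> C * \<bar>u - y\<bar>"
      using lipschitz_onD[OF g up y(1)] by (simp add: dist_real_def)
    also have "\<dots> \<le> C * \<bar>d\<bar>"
      using u lipschitz_on_nonneg[OF g] by (intro mult_left_mono) (auto simp: I_def)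
    finally show "norm (g u - g y) \<le> C * \<bar>d\<bar>" by simp
  qed (auto simp: I_def)
  then show ?thesis by (simp add: algebra_simps power2_eq_square abs_mult_self_eq)
qed

lemma exp_second_order_remainder:
  fixes z :: real
  assumes "\<bar>z\<bar> \<le> 1"
  shows "\<bar>exp z - 1 - z - z\<^sup>2 / 2\<bar> \<le> \<bar>z\<bar> ^ 3"
proof -
  obtain t where t: "\<bar>t\<bar> \<le> \<bar>z\<bar>" "exp z = (\<Sum>m<3. z ^ m / fact m) + exp t / fact 3 * z ^ 3"
    using Maclaurin_exp_le[of z 3] by blast
  have "exp z - 1 - z - z\<^sup>2 / 2 = exp t / 6 * z ^ 3"
    using t(2) by (simp add: eval_nat_numeral)
  moreover have "exp t \<le> 3"
  proof -
    have "exp t \<le> exp 1" using t assms by simp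
    then show ?thesis using exp_le by linarith
  qed
  then have "exp t / 6 * \<bar>z ^ 3\<bar> \<le> 1 * \<bar>z ^ 3\<bar>" by (intro mult_right_mono) auto
  moreover have "\<bar>exp t / 6 * z ^ 3\<bar> = exp t / 6 * \<bar>z ^ 3\<bar>" by (simp only: abs_mult) simp
  ultimately show ?thesis by (simp only: power_abs mult_1)
qed

text \<open>Put \<epsilon> = a / n. The exponent is \<open>W + v + e\<close>: \<open>W\<close> of
  order \<epsilon> from \<open>g\<close>, \<open>v\<close> of order \<epsilon>^2 from
  \<open>k\<close>, and \<open>e\<close> of order \<epsilon> / n from the Taylor remainders. So exp
  - 1 equals W + v + W^2 / 2 up to \<epsilon>^3 and \<epsilon> / n. Multiplied by \<open>n\<close>,
  these two errors are (a^2 / n) (a / n) and (a^2 / n) (1 / a).\<close>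

lemma scaled_exp_increment:
  fixes G K g k :: "real \<Rightarrow> real" and \<theta> l :: real
  assumes G: "\<And>u. u \<in> {p..w} \<Longrightarrow> (G has_real_derivative g u) (at u within {p..w})"
    and K: "\<And>u. u \<in> {p..w} \<Longrightarrow> (K has_real_derivative k u) (at u within {p..w})"
    and g: "Cg-lipschitz_on {p..w} g" "\<And>u. u \<in> {p..w} \<Longrightarrow> \<bar>g u\<bar> \<le> Bg"
    and k: "Ck-lipschitz_on {p..w} k" "\<And>u. u \<in> {p..w} \<Longrightarrow> \<bar>k u\<bar> \<le> Bk"
  shows "\<exists>C\<ge>0. \<forall>n a y. 1 \<le> a \<longrightarrow> C * a \<le> n \<longrightarrow> a \<le> n \<longrightarrow> y \<in> {p..w} \<longrightarrow> y + l / n \<in> {p..w} \<longrightarrow>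
    \<bar>n * (exp (\<theta> * a * (G (y + l / n) - G y) + \<theta>\<^sup>2 * (a\<^sup>2 / n) * (K (y + l / n) - K y)) - 1)
      - (\<theta> * a * l * g y + \<theta>\<^sup>2 * (a\<^sup>2 / n) * (l * k y + l\<^sup>2 * (g y)\<^sup>2 / 2))\<bar>
    \<le> C * (a\<^sup>2 / n) * (a / n + 1 / a)"
proof -
  define C1 where "C1 = \<bar>\<theta> * l\<bar> * \<bar>Bg\<bar> + \<theta>\<^sup>2 * \<bar>l\<bar> * \<bar>Bk\<bar> + \<bar>\<theta>\<bar> * l\<^sup>2 * Cg + \<theta>\<^sup>2 * l\<^sup>2 * Ck"
  \<comment> \<open>The cubic term comes from |z| <= 4 C1 \<epsilon>, the square from the difference
    of z^2 and W^2, and \<open>4 * C1\<close> lets \<open>C * a \<le> n\<close> force |z| <=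
    1.\<close>
  define C where "C = 64 * C1 ^ 3 + 8 * C1\<^sup>2 + 4 * C1"
  have Cg: "0 \<le> Cg" and Ck: "0 \<le> Ck" using g k by (auto dest: lipschitz_on_nonneg)
  have C1: "0 \<le> C1" "\<bar>\<theta> * l\<bar> * \<bar>Bg\<bar> \<le> C1" "\<theta>\<^sup>2 * \<bar>l\<bar> * \<bar>Bk\<bar> \<le> C1"
    "\<bar>\<theta>\<bar> * l\<^sup>2 * Cg \<le> C1" "\<theta>\<^sup>2 * l\<^sup>2 * Ck \<le> C1"
    using Cg Ck unfolding C1_def by (auto intro!: add_nonneg_nonneg add_increasing add_increasing2)
  have C0: "0 \<le> C" using C1 by (simp add: C_def)
  have "\<bar>n * (exp (\<theta> * a * (G (y + l / n) - G y) + \<theta>\<^sup>2 * (a\<^sup>2 / n) * (K (y + l / n) - K y)) - 1)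
      - (\<theta> * a * l * g y + \<theta>\<^sup>2 * (a\<^sup>2 / n) * (l * k y + l\<^sup>2 * (g y)\<^sup>2 / 2))\<bar>
    \<le> C * (a\<^sup>2 / n) * (a / n + 1 / a)"
    if a: "1 \<le> a" "C * a \<le> n" "a \<le> n" and y: "y \<in> {p..w}" "y + l / n \<in> {p..w}" for n a y
  proof -
    have n: "n > 0" "n \<ge> 1" using a by auto
    define \<epsilon> where "\<epsilon> = a / n"
    have \<epsilon>: "0 < \<epsilon>" "\<epsilon> \<le> 1" "1 / n \<le> \<epsilon>" using a n by (auto simp: \<epsilon>_def field_simps)
    define R1 where "R1 = G (y + l / n) - G y - g y * (l / n)"
    define R2 where "R2 = K (y + l / n) - K y - k y * (l / n)"
    define W where "W = \<theta> * l * g y * \<epsilon>"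
    define v where "v = \<theta>\<^sup>2 * (l * k y) * \<epsilon>\<^sup>2"
    define e where "e = \<theta> * a * R1 + \<theta>\<^sup>2 * (a\<^sup>2 / n) * R2"
    define z where "z = \<theta> * a * (G (y + l / n) - G y) + \<theta>\<^sup>2 * (a\<^sup>2 / n) * (K (y + l / n) - K y)"
    have z: "z = W + v + e"
      using n by (simp add: z_def W_def v_def e_def R1_def R2_def \<epsilon>_def power2_eq_square field_simps)
    have W: "\<bar>W\<bar> \<le> C1 * \<epsilon>"
    proof -
      have "\<bar>\<theta> * l\<bar> * \<bar>g y\<bar> \<le> \<bar>\<theta> * l\<bar> * \<bar>Bg\<bar>" using g(2)[OF y(1)] by (intro mult_left_mono) auto
      then have "\<bar>\<theta> * l\<bar> * \<bar>g y\<bar> * \<epsilon> \<le> C1 * \<epsilon>" using C1 \<epsilon> by (intro mult_right_mono) auto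
      then show ?thesis using \<epsilon> by (simp add: W_def abs_mult)
    qed
    have v: "\<bar>v\<bar> \<le> C1 * \<epsilon>\<^sup>2"
    proof -
      have "\<theta>\<^sup>2 * \<bar>l\<bar> * \<bar>k y\<bar> \<le> \<theta>\<^sup>2 * \<bar>l\<bar> * \<bar>Bk\<bar>" using k(2)[OF y(1)] by (intro mult_left_mono) auto
      then have "\<theta>\<^sup>2 * \<bar>l\<bar> * \<bar>k y\<bar> * \<epsilon>\<^sup>2 \<le> C1 * \<epsilon>\<^sup>2" using C1 by (intro mult_right_mono) auto
      then show ?thesis by (simp add: v_def abs_mult mult.assoc)
    qed
    have e: "\<bar>e\<bar> \<le> 2 * C1 * (\<epsilon> / n)"
    proof -
      have "\<bar>R1\<bar> \<le> Cg * (l / n)\<^sup>2" unfolding R1_def by (rule first_order_remainder[OF G g(1) y])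
      then have "\<bar>\<theta>\<bar> * a * \<bar>R1\<bar> \<le> \<bar>\<theta>\<bar> * a * (Cg * (l / n)\<^sup>2)" using a by (intro mult_left_mono) auto
      also have "\<dots> = (\<bar>\<theta>\<bar> * l\<^sup>2 * Cg) * (\<epsilon> / n)"
        using n by (simp add: \<epsilon>_def power2_eq_square field_simps)
      also have "\<dots> \<le> C1 * (\<epsilon> / n)" using C1 \<epsilon> n by (intro mult_right_mono) auto
      finally have e1: "\<bar>\<theta> * a * R1\<bar> \<le> C1 * (\<epsilon> / n)" using a by (simp add: abs_mult)
      have "\<bar>R2\<bar> \<le> Ck * (l / n)\<^sup>2" unfolding R2_def by (rule first_order_remainder[OF K k(1) y])
      then have "\<theta>\<^sup>2 * (a\<^sup>2 / n) * \<bar>R2\<bar> \<le> \<theta>\<^sup>2 * (a\<^sup>2 / n) * (Ck * (l / n)\<^sup>2)"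
        using n by (intro mult_left_mono) auto
      also have "\<dots> = (\<theta>\<^sup>2 * l\<^sup>2 * Ck) * (\<epsilon> * \<epsilon> / n)"
        using n by (simp add: \<epsilon>_def power2_eq_square field_simps)
      also have "\<dots> \<le> C1 * (\<epsilon> * 1 / n)"
        using C1 \<epsilon> n by (intro mult_mono divide_right_mono) auto
      finally have e2: "\<bar>\<theta>\<^sup>2 * (a\<^sup>2 / n) * R2\<bar> \<le> C1 * (\<epsilon> / n)" using n by (simp add: abs_mult)
      have "\<bar>e\<bar> \<le> \<bar>\<theta> * a * R1\<bar> + \<bar>\<theta>\<^sup>2 * (a\<^sup>2 / n) * R2\<bar>"
        unfolding e_def by (rule abs_triangle_ineq)
      then show ?thesis using e1 e2 by simp
    qed
    have e': "\<bar>e\<bar> \<le> 2 * C1 * \<epsilon>\<^sup>2"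
    proof -
      have "2 * C1 * (\<epsilon> / n) = 2 * C1 * (\<epsilon> * (1 / n))" by simp
      also have "\<dots> \<le> 2 * C1 * (\<epsilon> * \<epsilon>)" using C1 \<epsilon> by (intro mult_left_mono) auto
      finally show ?thesis using e by (simp add: power2_eq_square)
    qed
    have sq: "C1 * \<epsilon>\<^sup>2 \<le> C1 * \<epsilon>"
      using C1 \<epsilon> by (intro mult_left_mono) (auto simp: power2_eq_square mult_left_le)
    have zW: "\<bar>z - W\<bar> \<le> 3 * C1 * \<epsilon>\<^sup>2" using v e' unfolding z by linarith
    have z4: "\<bar>z\<bar> \<le> 4 * C1 * \<epsilon>" using zW W sq by linarith
    have zpW: "\<bar>z + W\<bar> \<le> 5 * C1 * \<epsilon>" using z4 W by linarith
    have "4 * C1 * a \<le> n"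
    proof -
      have "4 * C1 * a \<le> C * a" using C1 a by (intro mult_right_mono) (auto simp: C_def)
      then show ?thesis using a by linarith
    qed
    then have "4 * C1 * \<epsilon> \<le> 1" using n by (simp add: \<epsilon>_def field_simps)
    then have "\<bar>z\<bar> \<le> 1" using z4 by simp
    then have "\<bar>exp z - 1 - z - z\<^sup>2 / 2\<bar> \<le> \<bar>z\<bar> ^ 3" by (rule exp_second_order_remainder)
    also have "\<dots> \<le> (4 * C1 * \<epsilon>) ^ 3" using z4 by (intro power_mono) auto
    finally have rem: "\<bar>exp z - 1 - z - z\<^sup>2 / 2\<bar> \<le> 64 * C1 ^ 3 * \<epsilon> ^ 3" by (simp add: power_mult_distrib)
    have "\<bar>z\<^sup>2 - W\<^sup>2\<bar> = \<bar>z - W\<bar> * \<bar>z + W\<bar>"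
      by (simp add: abs_mult[symmetric] power2_eq_square algebra_simps)
    also have "\<dots> \<le> (3 * C1 * \<epsilon>\<^sup>2) * (5 * C1 * \<epsilon>)"
      using zW zpW C1 by (intro mult_mono) auto
    finally have quad: "\<bar>z\<^sup>2 - W\<^sup>2\<bar> \<le> 15 * C1\<^sup>2 * \<epsilon> ^ 3"
      by (simp add: power2_eq_square power3_eq_cube mult_ac)
    have sqn: "0 \<le> C1\<^sup>2 * \<epsilon> ^ 3" using \<epsilon> by simp
    have "\<bar>exp z - 1 - (W + v + W\<^sup>2 / 2)\<bar> \<le> (64 * C1 ^ 3 + 8 * C1\<^sup>2) * \<epsilon> ^ 3 + 2 * C1 * (\<epsilon> / n)"
    proof -
      have "exp z - 1 - (W + v + W\<^sup>2 / 2) = (exp z - 1 - z - z\<^sup>2 / 2) + (z\<^sup>2 - W\<^sup>2) / 2 + e"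
        unfolding z by (simp add: field_simps)
      also have "\<bar>\<dots>\<bar> \<le> \<bar>exp z - 1 - z - z\<^sup>2 / 2\<bar> + \<bar>z\<^sup>2 - W\<^sup>2\<bar> / 2 + \<bar>e\<bar>"
      proof -
        have "\<bar>A + D / 2 + E\<bar> \<le> \<bar>A\<bar> + \<bar>D\<bar> / 2 + \<bar>E\<bar>" for A D E :: real by linarith
        then show ?thesis .
      qed
      also have "\<dots> \<le> 64 * C1 ^ 3 * \<epsilon> ^ 3 + 8 * C1\<^sup>2 * \<epsilon> ^ 3 + 2 * C1 * (\<epsilon> / n)"
      proof (intro add_mono rem e)
        show "\<bar>z\<^sup>2 - W\<^sup>2\<bar> / 2 \<le> 8 * C1\<^sup>2 * \<epsilon> ^ 3"
        proof -
          have "Q / 2 \<le> 8 * Y" if "Q \<le> 15 * Y" "0 \<le> Y" for Q Y :: real using that by linarith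
          then show ?thesis using quad sqn unfolding mult.assoc by blast
        qed
      qed
      finally show ?thesis by (simp only: distrib_right)
    qed
    then have "n * \<bar>exp z - 1 - (W + v + W\<^sup>2 / 2)\<bar>
        \<le> n * ((64 * C1 ^ 3 + 8 * C1\<^sup>2) * \<epsilon> ^ 3 + 2 * C1 * (\<epsilon> / n))"
      using n by (intro mult_left_mono) auto
    also have "\<dots> = (64 * C1 ^ 3 + 8 * C1\<^sup>2) * ((a\<^sup>2 / n) * (a / n)) + 2 * C1 * ((a\<^sup>2 / n) * (1 / a))"
      using n a by (simp add: \<epsilon>_def power2_eq_square power3_eq_cube field_simps)
    also have "\<dots> \<le> C * ((a\<^sup>2 / n) * (a / n)) + C * ((a\<^sup>2 / n) * (1 / a))"
      using n a C1 by (intro add_mono mult_right_mono) (auto simp: C_def)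
    also have "\<dots> = C * (a\<^sup>2 / n) * (a / n + 1 / a)" by (simp add: distrib_left mult.assoc)
    also have "n * \<bar>exp z - 1 - (W + v + W\<^sup>2 / 2)\<bar> = \<bar>n * (exp z - 1) - n * (W + v + W\<^sup>2 / 2)\<bar>"
      by (simp only: right_diff_distrib[symmetric] abs_mult abs_of_pos[OF n(1)])
    also have "n * (W + v + W\<^sup>2 / 2)
        = \<theta> * a * l * g y + \<theta>\<^sup>2 * (a\<^sup>2 / n) * (l * k y + l\<^sup>2 * (g y)\<^sup>2 / 2)"
      using n by (simp add: W_def v_def \<epsilon>_def power2_eq_square field_simps)
    finally show ?thesis by (simp add: z_def)
  qed
  then show ?thesis using C0 by blast
qed

section \<open>Two-sided exit bounds and measurability of hitting times\<close>

context jump_process begin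

text \<open>An eigenfunction up to relative error \<eta> is a supermartingale for the discount
  \<kappa> + \<eta>, and its negative is one for \<kappa> - \<eta>. Returning to the discount
  \<kappa> costs a factor \<open>exp (\<eta> * T)\<close>, since the exit time is at most
  \<open>T\<close>.\<close>

lemma exit_mgf_bounds:
  assumes D: "D \<in> sets borel" and T: "T > 0"
    and f: "f \<in> borel_measurable borel" "\<And>v. 0 < f v" "\<And>v. f v \<le> B"
    and Q: "\<And>u. u \<in> D \<Longrightarrow> q u \<le> Q" "\<And>u i. u \<in> D \<Longrightarrow> i \<in> {1..M} \<Longrightarrow> q (u + l i) \<le> Q"
    and eig: "\<And>u. u \<in> D \<Longrightarrow> \<bar>L f u - \<kappa> * f u\<bar> \<le> \<eta> * f u" and \<eta>: "0 \<le> \<eta>"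
  defines "E \<equiv> (\<integral>\<omega>. exp (- \<kappa> * exit_at D T \<omega>) * f (X (exit_at D T \<omega>) \<omega>) \<partial>N)"
  shows "exp (- \<eta> * T) * f x0 \<le> E" and "E \<le> exp (\<eta> * T) * f x0"
proof -
  let ?h = "\<lambda>c \<omega>. exp (- c * exit_at D T \<omega>) * f (X (exit_at D T \<omega>) \<omega>)"
  have B: "\<bar>f v\<bar> \<le> B" for v using f(2,3)[of v] by simp
  have \<rho>: "0 \<le> exit_at D T \<omega>" "exit_at D T \<omega> \<le> T" for \<omega>
    using exit_time_bounds[of T] T by auto
  have meas: "?h c \<in> borel_measurable N" for c
    using measurable_exit_at[OF D T] measurable_compose[OF measurable_X_exit[OF D T] f(1)] by measurable
  have int: "integrable N (?h c)" for c
  proof (rule integrable_const_bound[OF _ meas])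
    have "norm (?h c \<omega>) \<le> exp (\<bar>c\<bar> * T) * B" for \<omega>
    proof -
      have "- c * exit_at D T \<omega> \<le> \<bar>c\<bar> * T"
        using \<rho>[of \<omega>] by (smt (verit) abs_ge_minus_self mult_mono)
      then show ?thesis
        unfolding real_norm_def abs_mult using B by (intro mult_mono) auto
    qed
    then show "AE \<omega> in N. norm (?h c \<omega>) \<le> exp (\<bar>c\<bar> * T) * B"
      by simp
  qed
  have up: "(\<integral>\<omega>. ?h (\<kappa> + \<eta>) \<omega> \<partial>N) \<le> f x0"
  proof (rule exit_supermartingale[OF D T f(1) B Q])
    show "L f u \<le> (\<kappa> + \<eta>) * f u" if "u \<in> D" for u
      using eig[OF that] by (simp add: distrib_right abs_le_iff)
  qed
  have "E \<le> (\<integral>\<omega>. exp (\<eta> * T) * (?h (\<kappa> + \<eta>) \<omega>) \<partial>N)"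
    unfolding E_def
  proof (rule integral_mono[OF int integrable_mult_right[OF int]])
    fix \<omega>
    have "exp (- \<kappa> * exit_at D T \<omega>) \<le> exp (\<eta> * T) * exp (- (\<kappa> + \<eta>) * exit_at D T \<omega>)"
      using mult_left_mono[OF \<rho>(2) \<eta>, of \<omega>] by (simp add: exp_add[symmetric] algebra_simps)
    then show "?h \<kappa> \<omega>
        \<le> exp (\<eta> * T) * (?h (\<kappa> + \<eta>) \<omega>)"
      using mult_right_mono[OF _ less_imp_le[OF f(2)]] by (metis mult.assoc)
  qed
  also have "\<dots> = exp (\<eta> * T) * (\<integral>\<omega>. ?h (\<kappa> + \<eta>) \<omega> \<partial>N)"
    by (rule integral_mult_right_zero)
  also have "\<dots> \<le> exp (\<eta> * T) * f x0" using up by (intro mult_left_mono) auto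
  finally show "E \<le> exp (\<eta> * T) * f x0" .
  have "(\<integral>\<omega>. exp (- (\<kappa> - \<eta>) * exit_at D T \<omega>) * (- f (X (exit_at D T \<omega>) \<omega>)) \<partial>N) \<le> - f x0"
  proof (rule exit_supermartingale[OF D T _ _ Q, where f="\<lambda>v. - f v"])
    show "(\<lambda>v. - f v) \<in> borel_measurable borel" using f(1) by measurable
    show "\<bar>- f v\<bar> \<le> B" for v using B by simp
    have "L (\<lambda>v. - f v) u = - L f u" for u by (simp add: L_def sum_negf[symmetric] algebra_simps)
    then show "L (\<lambda>v. - f v) u \<le> (\<kappa> - \<eta>) * - f u" if "u \<in> D" for u
      using eig[OF that] by (simp add: left_diff_distrib abs_le_iff)
  qed
  then have low: "f x0 \<le> (\<integral>\<omega>. ?h (\<kappa> - \<eta>) \<omega> \<partial>N)"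
    by simp
  have "exp (- \<eta> * T) * f x0
      \<le> exp (- \<eta> * T) * (\<integral>\<omega>. ?h (\<kappa> - \<eta>) \<omega> \<partial>N)"
    using low by (intro mult_left_mono) auto
  also have "\<dots> = (\<integral>\<omega>. exp (- \<eta> * T) * (?h (\<kappa> - \<eta>) \<omega>) \<partial>N)"
    by (rule integral_mult_right_zero[symmetric])
  also have "\<dots> \<le> E"
    unfolding E_def
  proof (rule integral_mono[OF integrable_mult_right[OF int] int])
    fix \<omega>
    have "exp (- \<eta> * T) * exp (- (\<kappa> - \<eta>) * exit_at D T \<omega>) \<le> exp (- \<kappa> * exit_at D T \<omega>)"
      using mult_left_mono[OF \<rho>(2) \<eta>, of \<omega>] by (simp add: exp_add[symmetric] algebra_simps)
    then show "exp (- \<eta> * T) * (?h (\<kappa> - \<eta>) \<omega>)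
        \<le> ?h \<kappa> \<omega>"
      using mult_right_mono[OF _ less_imp_le[OF f(2)]] by (metis mult.assoc)
  qed
  finally show "exp (- \<eta> * T) * f x0 \<le> E" .
qed

text \<open>A level reached at some time is still held at the rational times just after it, because
  the path is constant there; countably many times thus decide the event.\<close>

lemma measurable_hitting_time: "chain_hitting_time X m \<in> borel_measurable N"
proof (rule borel_measurableI_less)
  fix y :: ereal
  have "{\<omega> \<in> space N. chain_hitting_time X m \<omega> < y}
      = (\<Union>s\<in>{s \<in> \<rat>. 0 \<le> s \<and> ereal s < y}. {\<omega> \<in> space N. m \<le> X s \<omega>})" (is "?A = ?B")
  proof
    show "?A \<subseteq> ?B"
    proof
      fix \<omega> assume "\<omega> \<in> ?A"
      then have \<omega>: "\<omega> \<in> space N" and "chain_hitting_time X m \<omega> < y" by auto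
      then obtain t where t: "0 \<le> t" "m \<le> X t \<omega>" "ereal t < y"
        unfolding chain_hitting_time_def Inf_less_iff by auto
      obtain b where b: "b > t" "\<And>s. t \<le> s \<Longrightarrow> s < b \<Longrightarrow> X s \<omega> = X t \<omega>"
        using pure_jump_path_right[OF paths[OF \<omega>] t(1)] by blast
      obtain z where z: "ereal t < ereal z" "ereal z < y" using ereal_dense2[OF t(3)] by blast
      have "t < min b z" using b z by simp
      then obtain s where s: "s \<in> \<rat>" "t < s" "s < min b z" using Rats_dense_in_real by blast
      have "ereal s < y" using z(2) s(3) by (metis less_ereal.simps(1) less_trans min_less_iff_conj)
      moreover have "m \<le> X s \<omega>" using b(2)[of s] s t by simp
      ultimately show "\<omega> \<in> ?B" using s t \<omega> by force
    qed
    show "?B \<subseteq> ?A"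
      unfolding chain_hitting_time_def Inf_less_iff by auto
  qed
  moreover have "?B \<in> sets N"
  proof (rule sets.countable_UN')
    show "countable {s \<in> \<rat>. 0 \<le> s \<and> ereal s < y}"
      by (rule countable_subset[OF _ countable_rat]) auto
    show "(\<lambda>s. {\<omega> \<in> space N. m \<le> X s \<omega>}) ` {s \<in> \<rat>. 0 \<le> s \<and> ereal s < y} \<subseteq> sets N"
    proof (rule image_subsetI)
      fix s assume "s \<in> {s \<in> \<rat>. 0 \<le> s \<and> ereal s < y}"
      then have "X s \<in> borel_measurable N" by (intro measurable_X) simp
      then show "{\<omega> \<in> space N. m \<le> X s \<omega>} \<in> sets N" by measurable
    qed
  qed
  ultimately show "?A \<in> sets N" by simp
qed

end

lemma pure_jump_markov_process_jump_process:
  assumes "pure_jump_markov_process N (dd_generator M l F n) x0 X"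
    and "\<And>i u. i \<in> {1..M} \<Longrightarrow> F i u \<ge> 0"
  obtains S p where "jump_process S p M (\<lambda>i u. real n * F i (u / real n)) l N X x0"
proof -
  obtain S p where sp: "transition_function S p" "has_generator S p (dd_generator M l F n)"
    "markov_process N S p X"
    using assms(1) by (auto simp: pure_jump_markov_process_def)
  have gen: "dd_generator M l F n
      = (\<lambda>f u. \<Sum>i=1..M. real n * F i (u / real n) * (f (u + l i) - f u))"
    by (intro ext) (simp add: dd_generator_def sum_distrib_left mult.assoc)
  have "jump_process S p M (\<lambda>i u. real n * F i (u / real n)) l N X x0"
    using assms sp unfolding jump_process_def jump_semigroup_def jump_process_axioms_def gen
    by (auto simp: pure_jump_markov_process_def)
  then show ?thesis by (rule that)
qed

lemma lipschitz_sum_exists: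
  fixes f :: "'i \<Rightarrow> real \<Rightarrow> real"
  assumes "finite I" "\<And>i. i \<in> I \<Longrightarrow> \<exists>C. C-lipschitz_on U (f i)"
  shows "\<exists>C. C-lipschitz_on U (\<lambda>u. \<Sum>i\<in>I. a i * f i u)"
  using assms
proof (induction I)
  case empty
  then show ?case using lipschitz_on_constant by auto
next
  case (insert i I)
  then obtain C where "C-lipschitz_on U (\<lambda>u. \<Sum>i\<in>I. a i * f i u)" by auto
  moreover obtain D where "D-lipschitz_on U (f i)" using insert.prems by blast
  ultimately have "(\<bar>a i\<bar> * D + C)-lipschitz_on U (\<lambda>u. a i * f i u + (\<Sum>i\<in>I. a i * f i u))"
    by (intro lipschitz_on_add lipschitz_on_cmult_real)
  then show ?case using insert by auto
qed

lemma lipschitz_on_Icc_bounded: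
  fixes f :: "real \<Rightarrow> real"
  assumes "C-lipschitz_on {p..w} f"
  shows "\<exists>B\<ge>0. \<forall>u\<in>{p..w}. \<bar>f u\<bar> \<le> B"
proof -
  have "bounded (f ` {p..w})"
    using lipschitz_on_continuous_on[OF assms] by (intro compact_imp_bounded compact_continuous_image) auto
  then obtain B where B: "\<forall>v\<in>f ` {p..w}. norm v \<le> B" unfolding bounded_iff by blast
  have "\<forall>u\<in>{p..w}. \<bar>f u\<bar> \<le> max B 0" using B by (auto simp: max_def)
  then show ?thesis by (intro exI[of _ "max B 0"]) auto
qed

section \<open>Density-dependent chains\<close>

text \<open>\<open>{p..w}\<close> is a neighbourhood of \<open>{x..r}\<close> on which the drift
  stays positive. The margin on the left leaves room for the chain to move below \<open>x\<close>,
  the margin on the right for its jump over \<open>r\<close>.\<close>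

locale density_dependent =
  fixes M :: nat and l :: "nat \<Rightarrow> real" and F :: "nat \<Rightarrow> real \<Rightarrow> real" and p x r w :: real
  assumes F_nonneg: "\<And>i u. i \<in> {1..M} \<Longrightarrow> F i u \<ge> 0"
    and F_lipschitz: "\<And>i. i \<in> {1..M} \<Longrightarrow> \<exists>C. C-lipschitz_on UNIV (F i)"
    and points: "p < x" "x < r" "r < w"
    and drift_pos: "\<And>u. u \<in> {p..w} \<Longrightarrow> drift M l F u > 0"
begin

abbreviation b :: "real \<Rightarrow> real" where "b \<equiv> drift M l F"

definition \<sigma>2 :: "real \<Rightarrow> real" where "\<sigma>2 u = (\<Sum>i=1..M. (l i)\<^sup>2 * F i u)"

definition g :: "real \<Rightarrow> real" where "g u = 1 / b u"

text \<open>\<open>K\<close> removes the term \<open>\<theta>\<^sup>2 \<sigma>2 g\<^sup>2 / 2\<close> that \<open>G\<close> leaves in the exponential generator, that is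
  \<open>k b + \<sigma>2 g\<^sup>2 / 2 = 0\<close>.\<close>

definition k :: "real \<Rightarrow> real" where "k u = - (1 / 2) * (\<sigma>2 u * (g u * (g u * g u)))"

text \<open>The signed integral of 1 / b from \<open>x\<close> to \<open>u\<close>, the fluid travel
  time. Since \<open>integral {x..u} g\<close> would be 0 for \<open>u < x\<close>, both integrals
  start at \<open>p\<close>, so that \<open>G\<close> is negative to the left of
  \<open>x\<close>.\<close>

definition G :: "real \<Rightarrow> real" where "G u = integral {p..u} g - integral {p..x} g"

definition K :: "real \<Rightarrow> real" where "K u = integral {p..u} k - integral {p..x} k"

text \<open>The limiting variance: noise of intensity \<sigma>^2 in space becomes \<sigma>^2 / b^2
  in time, and the fluid spends time du / b at \<open>u\<close>.\<close>

definition V :: real where "V = integral {x..r} (\<lambda>u. \<sigma>2 u / b u ^ 3)"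

lemma drift_lipschitz: "\<exists>C. C-lipschitz_on UNIV b"
  using lipschitz_sum_exists[of "{1..M}" UNIV F l] F_lipschitz by (simp add: drift_def[abs_def])

lemma \<sigma>2_lipschitz: "\<exists>C. C-lipschitz_on {p..w} \<sigma>2"
proof -
  have "\<exists>C. C-lipschitz_on {p..w} (F i)" if "i \<in> {1..M}" for i
    using F_lipschitz[OF that] by (meson lipschitz_on_subset subset_UNIV)
  then show ?thesis
    using lipschitz_sum_exists[of "{1..M}" "{p..w}" F "\<lambda>i. (l i)\<^sup>2"] by (simp add: \<sigma>2_def[abs_def])
qed

lemma g_lipschitz: "\<exists>C. C-lipschitz_on {p..w} g"
proof -
  obtain C where C: "C-lipschitz_on UNIV b" using drift_lipschitz by blast
  then have Cp: "C-lipschitz_on {p..w} b" by (rule lipschitz_on_subset) simp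
  have "{p..w} \<noteq> {}" using points by simp
  then obtain u0 where u0: "u0 \<in> {p..w}" "\<And>u. u \<in> {p..w} \<Longrightarrow> b u0 \<le> b u"
    using continuous_attains_inf[of "{p..w}" b] lipschitz_on_continuous_on[OF Cp] by auto
  have "(C / (b u0)\<^sup>2)-lipschitz_on {p..w} (\<lambda>u. 1 / b u)"
    using Cp u0 drift_pos by (intro lipschitz_on_inverse_bounded) auto
  then show ?thesis by (auto simp: g_def[abs_def])
qed

lemma k_lipschitz: "\<exists>C. C-lipschitz_on {p..w} k"
proof -
  have prod: "\<exists>C. C-lipschitz_on {p..w} (\<lambda>u. f u * h u)"
    if fh: "\<exists>C. C-lipschitz_on {p..w} f" "\<exists>C. C-lipschitz_on {p..w} h" for f h :: "real \<Rightarrow> real"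
  proof -
    obtain C D where CD: "C-lipschitz_on {p..w} f" "D-lipschitz_on {p..w} h" using fh by blast
    obtain A where A: "A \<ge> 0" "\<forall>u\<in>{p..w}. \<bar>f u\<bar> \<le> A" using lipschitz_on_Icc_bounded[OF CD(1)] by blast
    obtain B where B: "B \<ge> 0" "\<forall>u\<in>{p..w}. \<bar>h u\<bar> \<le> B" using lipschitz_on_Icc_bounded[OF CD(2)] by blast
    have "(A * D + B * C)-lipschitz_on {p..w} (\<lambda>u. f u * h u)"
      using A B by (intro lipschitz_on_mult_bounded[OF CD]) auto
    then show ?thesis by blast
  qed
  have "\<exists>C. C-lipschitz_on {p..w} (\<lambda>u. \<sigma>2 u * (g u * (g u * g u)))"
    by (intro prod \<sigma>2_lipschitz g_lipschitz)
  then obtain C where "C-lipschitz_on {p..w} (\<lambda>u. \<sigma>2 u * (g u * (g u * g u)))" by blast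
  then have "(\<bar>- (1 / 2)\<bar> * C)-lipschitz_on {p..w} k"
    unfolding k_def[abs_def] by (rule lipschitz_on_cmult_real)
  then show ?thesis by blast
qed

lemma g_continuous: "continuous_on {p..w} g" and k_continuous: "continuous_on {p..w} k"
  using g_lipschitz k_lipschitz lipschitz_on_continuous_on by blast+

lemma G_derivative: "u \<in> {p..w} \<Longrightarrow> (G has_real_derivative g u) (at u within {p..w})"
  unfolding G_def[abs_def]
  using DERIV_diff[OF integral_has_real_derivative[OF g_continuous] DERIV_const] by simp

lemma K_derivative: "u \<in> {p..w} \<Longrightarrow> (K has_real_derivative k u) (at u within {p..w})"
  unfolding K_def[abs_def]
  using DERIV_diff[OF integral_has_real_derivative[OF k_continuous] DERIV_const] by simp

lemma G_x: "G x = 0" and K_x: "K x = 0"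
  by (simp_all add: G_def K_def)

lemma integral_split:
  fixes h :: "real \<Rightarrow> real"
  assumes "continuous_on {p..w} h"
  shows "integral {p..r} h - integral {p..x} h = integral {x..r} h"
proof -
  have "h integrable_on {p..r}"
    using points by (intro integrable_continuous_real continuous_on_subset[OF assms]) auto
  then show ?thesis
    using Henstock_Kurzweil_Integration.integral_combine[of p x r h] points by simp
qed

lemma G_r: "G r = integral {x..r} (\<lambda>u. 1 / b u)"
  using integral_split[OF g_continuous] by (simp add: G_def g_def[abs_def])

lemma k_eq: "k u = - (1 / 2) * (\<sigma>2 u / b u ^ 3)"
  by (simp add: k_def g_def power3_eq_cube)

lemma K_r: "K r = - V / 2"
proof -
  have "K r = integral {x..r} k" using integral_split[OF k_continuous] by (simp add: K_def)
  also have "\<dots> = integral {x..r} (\<lambda>u. - (1 / 2) * (\<sigma>2 u / b u ^ 3))"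
    by (rule arg_cong[where f="integral {x..r}"]) (rule ext, rule k_eq)
  also have "\<dots> = - (1 / 2) * V" unfolding V_def by (rule integral_mult_right)
  finally show ?thesis by simp
qed

lemma g_pos: "u \<in> {p..w} \<Longrightarrow> g u > 0"
  using drift_pos by (simp add: g_def)

text \<open>If all terms \<open>(l i)\<^sup>2 * F i u\<close> vanished, so would all terms of the
  drift. Positive drift therefore excludes a degenerate variance.\<close>

lemma \<sigma>2_pos:
  assumes "u \<in> {p..w}" shows "\<sigma>2 u > 0"
proof (rule ccontr)
  assume "\<not> \<sigma>2 u > 0"
  moreover have "\<sigma>2 u \<ge> 0" unfolding \<sigma>2_def by (intro sum_nonneg mult_nonneg_nonneg F_nonneg) auto
  ultimately have "(\<Sum>i=1..M. (l i)\<^sup>2 * F i u) = 0" by (simp add: \<sigma>2_def)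
  then have "\<forall>i\<in>{1..M}. (l i)\<^sup>2 * F i u = 0"
    using F_nonneg by (subst (asm) sum_nonneg_eq_0_iff) auto
  then have "b u = 0" unfolding drift_def by (intro sum.neutral) auto
  with drift_pos[OF assms] show False by simp
qed

lemma k_neg: "u \<in> {p..w} \<Longrightarrow> k u < 0"
  using \<sigma>2_pos drift_pos by (simp add: k_eq)

lemma interior_derivative:
  assumes "\<And>u. u \<in> {p..w} \<Longrightarrow> (H has_real_derivative h u) (at u within {p..w})" "p < u" "u < w"
  shows "(H has_real_derivative h u) (at u)"
  using assms(1)[of u] assms(2,3) at_within_interior[of u "{p..w}"] by simp

lemma G_strict_mono:
  assumes "p \<le> u" "u < v" "v \<le> w" shows "G u < G v"
proof (rule DERIV_pos_imp_increasing_open[OF assms(2)])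
  have "continuous_on {p..w} G" by (rule DERIV_continuous_on[OF G_derivative])
  then show "continuous_on {u..v} G" by (rule continuous_on_subset) (use assms in auto)
  show "\<exists>y. (G has_real_derivative y) (at t) \<and> 0 < y" if "u < t" "t < v" for t
    using interior_derivative[OF G_derivative, of t] g_pos[of t] that assms
    by (intro exI[of _ "g t"]) auto
qed

lemma G_mono: "p \<le> u \<Longrightarrow> u \<le> v \<Longrightarrow> v \<le> w \<Longrightarrow> G u \<le> G v"
  using G_strict_mono[of u v] by (cases "u = v") auto

lemma G_r_pos: "G r > 0"
  using G_strict_mono[of x r] points G_x by simp

lemma V_pos: "V > 0"
proof -
  have "K r < K x"
  proof (rule DERIV_neg_imp_decreasing_open[OF points(2)])
    have "continuous_on {p..w} K" by (rule DERIV_continuous_on[OF K_derivative])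
    then show "continuous_on {x..r} K" by (rule continuous_on_subset) (use points in auto)
    show "\<exists>y. (K has_real_derivative y) (at t) \<and> y < 0" if "x < t" "t < r" for t
      using interior_derivative[OF K_derivative, of t] k_neg[of t] that points
      by (intro exI[of _ "k t"]) auto
  qed
  then show ?thesis using K_r K_x by simp
qed

lemma lipschitz_of_bounded_derivative:
  assumes "\<And>u. u \<in> {p..w} \<Longrightarrow> (H has_real_derivative h u) (at u within {p..w})"
    and "\<exists>C. C-lipschitz_on {p..w} h"
  shows "\<exists>C\<ge>0. C-lipschitz_on {p..w} H"
proof -
  obtain B where B: "B \<ge> 0" "\<forall>u\<in>{p..w}. \<bar>h u\<bar> \<le> B"
    using lipschitz_on_Icc_bounded assms(2) by blast
  have "B-lipschitz_on {p..w} H"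
  proof (rule lipschitz_onI)
    show "dist (H u) (H v) \<le> B * dist u v" if "u \<in> {p..w}" "v \<in> {p..w}" for u v
      unfolding dist_norm using assms(1) B that
      by (intro field_differentiable_bound[of "{p..w}" H h]) auto
  qed (rule B(1))
  then show ?thesis using B(1) by blast
qed

section \<open>Test functions and their approximate eigenvalue\<close>

definition \<alpha> :: real where "\<alpha> = (p + x) / 2"

definition ell :: real where "ell = (\<Sum>i=1..M. \<bar>l i\<bar>)"

definition region :: "nat \<Rightarrow> real set" where
  "region n = {u. real n * \<alpha> \<le> u \<and> u < real n * r}"

text \<open>Clipping keeps test functions bounded without changing them on \<open>region n\<close> and its neighbours, and it
  limits the overshoot over \<open>r\<close>, since a jump of \<open>X / n\<close> has size at most \<open>ell / n\<close>.\<close>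

definition clip :: "nat \<Rightarrow> real \<Rightarrow> real" where
  "clip n v = max p (min (r + ell / real n) v)"

definition f :: "nat \<Rightarrow> real \<Rightarrow> real \<Rightarrow> real \<Rightarrow> real" where
  "f n a \<theta> u = exp (\<theta> * a * G (clip n (u / real n)) + \<theta>\<^sup>2 * (a\<^sup>2 / real n) * K (clip n (u / real n)))"

text \<open>A jump out of the region then stays in \<open>{p..w}\<close>: it exceeds
  \<open>r\<close> by at most \<open>w - r\<close>, and from \<alpha> it cannot fall below
  \<open>p\<close>.\<close>

definition large :: "nat \<Rightarrow> bool" where
  "large n \<longleftrightarrow> n \<ge> 1 \<and> ell / real n \<le> w - r \<and> ell / real n \<le> \<alpha> - p"

lemma \<alpha>: "p < \<alpha>" "\<alpha> < x" using points by (simp_all add: \<alpha>_def field_simps)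

lemma ell_nonneg: "ell \<ge> 0" by (simp add: ell_def sum_nonneg)

lemma abs_l_le_ell: "i \<in> {1..M} \<Longrightarrow> \<bar>l i\<bar> \<le> ell"
  unfolding ell_def by (intro member_le_sum) auto

lemma clip_range: "large n \<Longrightarrow> clip n v \<in> {p..w}"
  using points by (auto simp: clip_def large_def)

lemma region_borel [measurable]: "region n \<in> sets borel"
  unfolding region_def by measurable

lemma eventually_large: "eventually large sequentially"
proof -
  have lim: "(\<lambda>n. ell / real n) \<longlonglongrightarrow> 0" by (rule lim_const_over_n)
  have "w - r > 0" "\<alpha> - p > 0" using points \<alpha> by auto
  then have "\<forall>\<^sub>F n in sequentially. ell / real n < w - r" "\<forall>\<^sub>F n in sequentially. ell / real n < \<alpha> - p"
    using order_tendstoD(2)[OF lim] by auto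
  then show ?thesis using eventually_ge_at_top[of 1]
    by eventually_elim (auto simp: large_def)
qed

lemma region_scaled:
  assumes "large n" "u \<in> region n"
  shows "\<alpha> \<le> u / real n" "u / real n < r"
  using assms by (auto simp: region_def large_def field_simps)

lemma region_neighbours:
  assumes n: "large n" and u: "u \<in> region n" and i: "i \<in> {1..M}"
  shows "u / real n \<in> {p..w}" "u / real n + l i / real n \<in> {p..w}"
    "clip n (u / real n) = u / real n" "clip n ((u + l i) / real n) = u / real n + l i / real n"
proof -
  note y = region_scaled[OF n u]
  have npos: "real n > 0" using n by (simp add: large_def)
  have li: "\<bar>l i / real n\<bar> \<le> ell / real n"
    using abs_l_le_ell[OF i] npos by (simp add: divide_right_mono)
  have e0: "0 \<le> ell / real n" using ell_nonneg by simp
  have large: "ell / real n \<le> w - r" "ell / real n \<le> \<alpha> - p" using n by (auto simp: large_def)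
  have z: "p \<le> u / real n + l i / real n" "u / real n + l i / real n \<le> r + ell / real n"
  proof -
    have "- (ell / real n) \<le> l i / real n" "l i / real n \<le> ell / real n"
      using li unfolding abs_le_iff by linarith+
    then show "p \<le> u / real n + l i / real n" "u / real n + l i / real n \<le> r + ell / real n"
      using large y by linarith+
  qed
  show "u / real n \<in> {p..w}" using y \<alpha> points by simp
  show "u / real n + l i / real n \<in> {p..w}" using z large by simp
  show "clip n (u / real n) = u / real n" using y \<alpha> e0 by (simp add: clip_def)
  show "clip n ((u + l i) / real n) = u / real n + l i / real n"
    using z by (simp add: clip_def add_divide_distrib)
qed

text \<open>The first-order terms sum to \<theta> a g b with g b = 1; the second-order ones sum to a
  multiple of k b + \<sigma>^2 g^2 / 2 = 0.\<close>

lemma drift_cancel: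
  assumes "y \<in> {p..w}"
  shows "(\<Sum>i=1..M. F i y * (\<theta> * a * l i * g y + \<theta>\<^sup>2 * s * (l i * k y + (l i)\<^sup>2 * (g y)\<^sup>2 / 2))) = \<theta> * a"
proof -
  have b0: "b y \<noteq> 0" using drift_pos[OF assms] by simp
  have "(\<Sum>i=1..M. F i y * (\<theta> * a * l i * g y + \<theta>\<^sup>2 * s * (l i * k y + (l i)\<^sup>2 * (g y)\<^sup>2 / 2)))
      = (\<Sum>i=1..M. \<theta> * a * g y * (l i * F i y) + \<theta>\<^sup>2 * s * k y * (l i * F i y)
          + \<theta>\<^sup>2 * s * (g y)\<^sup>2 / 2 * ((l i)\<^sup>2 * F i y))"
    by (intro sum.cong refl) (simp add: algebra_simps)
  also have "\<dots> = \<theta> * a * g y * b y + \<theta>\<^sup>2 * s * k y * b y + \<theta>\<^sup>2 * s * (g y)\<^sup>2 / 2 * \<sigma>2 y"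
    by (simp only: sum.distrib sum_distrib_left[symmetric] drift_def \<sigma>2_def)
  also have "\<dots> = \<theta> * a"
    using b0 by (simp add: g_def k_eq power2_eq_square power3_eq_cube)
  finally show ?thesis .
qed

text \<open>The relative error is a^2 / n times a / n + 1 / a. Its constant depends on \<theta> but
  not on \<open>n\<close>, \<open>a\<close> or the point of the region, so along the sequence the
  error is o(s_n) uniformly.\<close>

lemma generator_eigenvalue:
  "\<exists>C\<ge>0. \<forall>n a. large n \<longrightarrow> 1 \<le> a \<longrightarrow> C * a \<le> real n \<longrightarrow> a \<le> real n \<longrightarrow> (\<forall>u\<in>region n.
     \<bar>dd_generator M l F n (f n a \<theta>) u - \<theta> * a * f n a \<theta> u\<bar>
       \<le> C * (a\<^sup>2 / real n) * (a / real n + 1 / a) * f n a \<theta> u)"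
proof -
  obtain Cg where Cg: "Cg-lipschitz_on {p..w} g" using g_lipschitz by blast
  obtain Ck where Ck: "Ck-lipschitz_on {p..w} k" using k_lipschitz by blast
  obtain Bg where Bg: "\<And>u. u \<in> {p..w} \<Longrightarrow> \<bar>g u\<bar> \<le> Bg" using lipschitz_on_Icc_bounded[OF Cg] by blast
  obtain Bk where Bk: "\<And>u. u \<in> {p..w} \<Longrightarrow> \<bar>k u\<bar> \<le> Bk" using lipschitz_on_Icc_bounded[OF Ck] by blast
  define R where "R i n a y = n * (exp (\<theta> * a * (G (y + l i / n) - G y)
      + \<theta>\<^sup>2 * (a\<^sup>2 / n) * (K (y + l i / n) - K y)) - 1)" for i and n a y :: real
  define Tm where "Tm i n a y = \<theta> * a * l i * g y
      + \<theta>\<^sup>2 * (a\<^sup>2 / n) * (l i * k y + (l i)\<^sup>2 * (g y)\<^sup>2 / 2)" for i and n a y :: real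
  have "\<forall>i. \<exists>C\<ge>0. \<forall>n a y. 1 \<le> a \<longrightarrow> C * a \<le> n \<longrightarrow> a \<le> n \<longrightarrow> y \<in> {p..w} \<longrightarrow> y + l i / n \<in> {p..w} \<longrightarrow>
      \<bar>R i n a y - Tm i n a y\<bar> \<le> C * (a\<^sup>2 / n) * (a / n + 1 / a)"
    unfolding R_def Tm_def
    using scaled_exp_increment[OF G_derivative K_derivative Cg Bg Ck Bk] by blast
  then obtain C where C: "\<And>i. C i \<ge> 0" "\<And>i n a y. 1 \<le> a \<Longrightarrow> C i * a \<le> n \<Longrightarrow> a \<le> n \<Longrightarrow> y \<in> {p..w} \<Longrightarrow>
      y + l i / n \<in> {p..w} \<Longrightarrow> \<bar>R i n a y - Tm i n a y\<bar> \<le> C i * (a\<^sup>2 / n) * (a / n + 1 / a)"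
    by metis
  have "\<forall>i\<in>{1..M}. \<exists>B\<ge>0. \<forall>u\<in>{p..w}. \<bar>F i u\<bar> \<le> B"
    using F_lipschitz lipschitz_on_Icc_bounded lipschitz_on_subset subset_UNIV by metis
  then obtain B where B: "\<And>i. i \<in> {1..M} \<Longrightarrow> B i \<ge> 0" "\<And>i u. i \<in> {1..M} \<Longrightarrow> u \<in> {p..w} \<Longrightarrow> \<bar>F i u\<bar> \<le> B i"
    by metis
  \<comment> \<open>\<open>C'\<close> has two tasks: it dominates each \<open>C i\<close>, so that
    the size condition holds for every jump, and it dominates the errors weighted by the bounds on
    the rates.\<close>
  define C' where "C' = (\<Sum>i=1..M. B i * C i) + (\<Sum>i=1..M. C i)"
  have C'1: "(\<Sum>i=1..M. B i * C i) \<le> C'" unfolding C'_def using C(1) by (simp add: sum_nonneg)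
  have BC: "0 \<le> (\<Sum>i=1..M. B i * C i)" using B(1) C(1) by (intro sum_nonneg mult_nonneg_nonneg) auto
  have C'2: "C i \<le> C'" if "i \<in> {1..M}" for i
  proof -
    have "C i \<le> (\<Sum>i=1..M. C i)" using that C(1) by (intro member_le_sum) auto
    then show ?thesis using BC by (simp add: C'_def)
  qed
  have C'0: "C' \<ge> 0" using C'1 BC by linarith
  have "\<bar>dd_generator M l F n (f n a \<theta>) u - \<theta> * a * f n a \<theta> u\<bar>
       \<le> C' * (a\<^sup>2 / real n) * (a / real n + 1 / a) * f n a \<theta> u"
    if n: "large n" and a: "1 \<le> a" "C' * a \<le> real n" "a \<le> real n" and u: "u \<in> region n" for n a u
  proof -
    have npos: "real n > 0" using n by (simp add: large_def)
    define y where "y = u / real n"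
    define \<phi> where "\<phi> = f n a \<theta> u"
    have \<phi>: "\<phi> > 0" by (simp add: \<phi>_def f_def)
    define \<delta> where "\<delta> = (a\<^sup>2 / real n) * (a / real n + 1 / a)"
    have \<delta>: "\<delta> \<ge> 0" using a npos by (auto simp: \<delta>_def intro!: mult_nonneg_nonneg add_nonneg_nonneg)
    have y: "y \<in> {p..w}" using region_scaled[OF n u] \<alpha> points by (simp add: y_def)
    have incr: "real n * (f n a \<theta> (u + l i) - \<phi>) = \<phi> * R i (real n) a y" if i: "i \<in> {1..M}" for i
    proof -
      note nb = region_neighbours[OF n u i]
      have "f n a \<theta> (u + l i) = \<phi> * exp (\<theta> * a * (G (y + l i / real n) - G y)
          + \<theta>\<^sup>2 * (a\<^sup>2 / real n) * (K (y + l i / real n) - K y))"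
        unfolding \<phi>_def f_def nb(3,4) exp_add[symmetric]
        by (simp add: y_def right_diff_distrib)
      then show ?thesis by (simp add: R_def algebra_simps)
    qed
    let ?S = "\<Sum>i=1..M. F i y * R i (real n) a y"
    have "dd_generator M l F n (f n a \<theta>) u = (\<Sum>i=1..M. F i y * (real n * (f n a \<theta> (u + l i) - \<phi>)))"
      by (simp add: dd_generator_def y_def \<phi>_def sum_distrib_left mult.left_commute)
    also have "\<dots> = (\<Sum>i=1..M. \<phi> * (F i y * R i (real n) a y))"
      by (intro sum.cong refl) (simp add: incr mult.left_commute)
    also have "\<dots> = \<phi> * ?S" by (simp add: sum_distrib_left)
    finally have gen: "dd_generator M l F n (f n a \<theta>) u = \<phi> * ?S" .
    have main: "(\<Sum>i=1..M. F i y * Tm i (real n) a y) = \<theta> * a"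
      unfolding Tm_def by (rule drift_cancel[OF y])
    have "\<bar>?S - \<theta> * a\<bar>
        = \<bar>\<Sum>i=1..M. F i y * (R i (real n) a y - Tm i (real n) a y)\<bar>"
      unfolding main[symmetric] by (simp add: sum_subtractf right_diff_distrib)
    also have "\<dots> \<le> (\<Sum>i=1..M. \<bar>F i y * (R i (real n) a y - Tm i (real n) a y)\<bar>)" by (rule sum_abs)
    also have "\<dots> \<le> (\<Sum>i=1..M. B i * C i * \<delta>)"
    proof (rule sum_mono)
      fix i assume i: "i \<in> {1..M}"
      have "C i * a \<le> C' * a" using C'2[OF i] a by (intro mult_right_mono) auto
      then have Ca: "C i * a \<le> real n" using a by linarith
      have "y + l i / real n \<in> {p..w}" using region_neighbours(2)[OF n u i] by (simp add: y_def)
      from C(2)[OF a(1) Ca a(3) y this]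
      have "\<bar>R i (real n) a y - Tm i (real n) a y\<bar> \<le> C i * \<delta>" by (simp add: \<delta>_def mult.assoc)
      then have "\<bar>F i y\<bar> * \<bar>R i (real n) a y - Tm i (real n) a y\<bar> \<le> B i * (C i * \<delta>)"
        using B[OF i] y by (intro mult_mono) auto
      then show "\<bar>F i y * (R i (real n) a y - Tm i (real n) a y)\<bar> \<le> B i * C i * \<delta>"
        by (simp add: abs_mult mult.assoc)
    qed
    also have "\<dots> = (\<Sum>i=1..M. B i * C i) * \<delta>" by (simp add: sum_distrib_right)
    also have "\<dots> \<le> C' * \<delta>" using C'1 \<delta> by (rule mult_right_mono)
    finally have "\<phi> * \<bar>?S - \<theta> * a\<bar> \<le> \<phi> * (C' * \<delta>)"
      using \<phi> by (intro mult_left_mono) auto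
    moreover have "\<phi> * \<bar>?S - \<theta> * a\<bar>
        = \<bar>\<phi> * ?S - \<theta> * a * \<phi>\<bar>"
      using \<phi> by (subst abs_of_pos[OF \<phi>, symmetric], subst abs_mult[symmetric])
        (simp add: right_diff_distrib mult.commute)
    ultimately show ?thesis unfolding gen \<phi>_def[symmetric] by (simp add: \<delta>_def mult_ac)
  qed
  then show ?thesis using C'0 by blast
qed

end

section \<open>Moderate deviations of the hitting time\<close>

text \<open>An error below every exponential cannot change the rate: with
  \<open>R = - (c + e / 2)\<close> it is at most the upper bound for \<open>u n\<close>, and the
  resulting factor 2 is absorbed by the remaining \<open>e / 2\<close>.\<close>

lemma has_exp_rate_perturb:
  assumes s: "filterlim s at_top sequentially" and u: "has_exp_rate s u c"
    and v: "\<forall>\<^sub>F n in sequentially. u n \<le> v n \<and> v n \<le> u n + d n"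
    and d: "\<And>R. \<forall>\<^sub>F n in sequentially. d n \<le> exp (- R * s n)"
  shows "has_exp_rate s v c"
  unfolding has_exp_rate_def
proof (intro allI impI)
  fix e :: real assume e: "e > 0"
  have "\<forall>\<^sub>F n in sequentially. exp (s n * (c - e / 2)) \<le> u n \<and> u n \<le> exp (s n * (c + e / 2))"
    using u e by (simp add: has_exp_rate_def)
  moreover have "\<forall>\<^sub>F n in sequentially. s n \<ge> max 0 (2 * ln 2 / e)"
    using s unfolding filterlim_at_top by blast
  ultimately show "\<forall>\<^sub>F n in sequentially. exp (s n * (c - e)) \<le> v n \<and> v n \<le> exp (s n * (c + e))"
    using v d[of "- (c + e / 2)"]
  proof eventually_elim
    case (elim n)
    have s0: "0 \<le> s n" by (rule order_trans[OF max.cobounded1 elim(2)])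
    have "s n * (c - e) \<le> s n * (c - e / 2)" using s0 e by (intro mult_left_mono) auto
    then have "exp (s n * (c - e)) \<le> v n" using elim by (meson exp_le_cancel_iff order_trans)
    moreover have "2 * exp (s n * (c + e / 2)) \<le> exp (s n * (c + e))"
    proof -
      have "ln 2 \<le> s n * (e / 2)" using elim e by (simp add: field_simps)
      then have "exp (ln 2 + s n * (c + e / 2)) \<le> exp (s n * (c + e))" by (simp add: algebra_simps)
      then show ?thesis by (simp add: exp_add)
    qed
    moreover have "exp (- (- (c + e / 2)) * s n) = exp (s n * (c + e / 2))" by (simp add: mult.commute)
    ultimately show ?case using elim by linarith
  qed
qed

section \<open>The stopped chain, the good event and the normalised hitting time\<close>

locale moderate_deviations = density_dependent M l F p x r w
  for M l F p x r w +
  fixes P :: "nat \<Rightarrow> 'w measure" and X :: "nat \<Rightarrow> real \<Rightarrow> 'w \<Rightarrow> real" and a :: "nat \<Rightarrow> real"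
  assumes process: "\<And>n. n \<ge> 1 \<Longrightarrow>
      pure_jump_markov_process (P n) (dd_generator M l F n) (real n * x) (X n)"
    and a_pos: "\<And>n. n \<ge> 1 \<Longrightarrow> a n > 0"
    and a_small: "(\<lambda>n. a n / real n) \<longlonglongrightarrow> 0"
    and a_large: "(\<lambda>n. sqrt (real n) / a n) \<longlonglongrightarrow> 0"
begin

definition s :: "nat \<Rightarrow> real" where "s n = (a n)\<^sup>2 / real n"

text \<open>The fluid reaches \<open>r\<close> at time \<open>G r\<close>; a chain still below
  \<open>r\<close> at the horizon lags by at least the added 1.\<close>

definition T :: real where "T = G r + 1"

definition \<rho> :: "nat \<Rightarrow> 'w \<Rightarrow> real" where "\<rho> n \<omega> = exit_time (region n) T (\<lambda>t. X n t \<omega>)"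

definition Y :: "nat \<Rightarrow> 'w \<Rightarrow> real" where "Y n \<omega> = clip n (X n (\<rho> n \<omega>) \<omega> / real n)"

text \<open>The exponential functional at the exit, that is the discounted test function
  \<open>f\<close>; its initial value is 1 because \<open>G\<close> and \<open>K\<close> vanish at
  \<open>x\<close>.\<close>

definition I :: "real \<Rightarrow> nat \<Rightarrow> 'w \<Rightarrow> real" where
  "I \<theta> n \<omega> = exp (\<theta> * a n * (G (Y n \<omega>) - \<rho> n \<omega>) + \<theta>\<^sup>2 * s n * K (Y n \<omega>))"

text \<open>The good event that the exit takes place through the upper end by time \<open>T\<close>;
  on it \<open>\<rho> n\<close> is the hitting time of \<open>n r\<close>.\<close>

definition A :: "nat \<Rightarrow> 'w set" where
  "A n = {\<omega> \<in> space (P n). real n * r \<le> X n (\<rho> n \<omega>) \<omega>}"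

definition Z :: "nat \<Rightarrow> 'w \<Rightarrow> real" where "Z n \<omega> = real n / a n * (G r - \<rho> n \<omega>)"

abbreviation Ac :: "nat \<Rightarrow> 'w set" where "Ac n \<equiv> space (P n) - A n"

lemma T_pos: "T > 0" using G_r_pos by (simp add: T_def)

text \<open>a_n / sqrt n tends to infinity; its square is \<open>s n\<close>, and \<open>a n\<close>
  dominates it for \<open>n \<ge> 1\<close>.\<close>

lemma s_at_top: "filterlim s at_top sequentially" and a_at_top: "filterlim a at_top sequentially"
proof -
  have "\<forall>\<^sub>F n in sequentially. 0 < sqrt (real n) / a n"
    using eventually_ge_at_top[of 1] by eventually_elim (use a_pos in simp)
  then have inv: "filterlim (\<lambda>n. inverse (sqrt (real n) / a n)) at_top sequentially"
    by (intro filterlim_inverse_at_top a_large)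
  have "filterlim (\<lambda>n. inverse (sqrt (real n) / a n) * inverse (sqrt (real n) / a n)) at_top sequentially"
    by (intro filterlim_at_top_mult_at_top inv)
  then show "filterlim s at_top sequentially"
  proof (rule filterlim_mono_eventually[OF _ order_refl order_refl])
    show "\<forall>\<^sub>F n in sequentially. inverse (sqrt (real n) / a n) * inverse (sqrt (real n) / a n) = s n"
      by (auto simp: s_def power2_eq_square)
  qed
  show "filterlim a at_top sequentially"
  proof (rule filterlim_at_top_mono[OF inv])
    show "\<forall>\<^sub>F n in sequentially. inverse (sqrt (real n) / a n) \<le> a n"
      using eventually_ge_at_top[of 1]
    proof eventually_elim
      case (elim n)
      then show ?case using a_pos[OF elim] by (simp add: divide_le_eq mult_le_cancel_left1)
    qed
  qed
qed

lemma s_pos: "n \<ge> 1 \<Longrightarrow> s n > 0"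
  unfolding s_def using a_pos[of n] by (intro divide_pos_pos zero_less_power) auto

lemma eventually_scales:
  "\<forall>\<^sub>F n in sequentially. large n \<and> n \<ge> 1 \<and> 1 \<le> a n \<and> a n \<le> real n \<and> C * a n \<le> real n"
proof -
  have "\<forall>\<^sub>F n in sequentially. \<bar>C\<bar> * (a n / real n) < 1"
    using tendsto_mult_right_zero[OF a_small, of "\<bar>C\<bar>"] by (rule order_tendstoD) simp
  moreover have "\<forall>\<^sub>F n in sequentially. a n / real n < 1" using a_small by (rule order_tendstoD) simp
  moreover have "\<forall>\<^sub>F n in sequentially. 1 \<le> a n" using a_at_top by (simp add: filterlim_at_top)
  ultimately show ?thesis using eventually_large eventually_ge_at_top[of 1]
  proof eventually_elim
    case (elim n)
    then have n: "real n > 0" by simp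
    have "C * a n \<le> \<bar>C\<bar> * a n" using elim by (intro mult_right_mono) auto
    also have "\<dots> \<le> real n" using elim n by (simp add: field_simps)
    finally show ?case using elim n by (simp add: field_simps)
  qed
qed

lemma obtain_process:
  assumes "n \<ge> 1"
  obtains S q where "jump_process S q M (\<lambda>i u. real n * F i (u / real n)) l (P n) (X n) (real n * x)"
  using pure_jump_markov_process_jump_process[OF process[OF assms] F_nonneg] .

lemma prob_space_P: "n \<ge> 1 \<Longrightarrow> prob_space (P n)"
  using process by (simp add: pure_jump_markov_process_def)

lemma
  assumes "n \<ge> 1"
  shows measurable_\<rho>: "\<rho> n \<in> borel_measurable (P n)"
    and measurable_X_\<rho>: "(\<lambda>\<omega>. X n (\<rho> n \<omega>) \<omega>) \<in> borel_measurable (P n)"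
    and measurable_chain_hitting_time: "chain_hitting_time (X n) h \<in> borel_measurable (P n)"
proof -
  obtain S q where "jump_process S q M (\<lambda>i u. real n * F i (u / real n)) l (P n) (X n) (real n * x)"
    using obtain_process[OF assms] .
  then interpret J: jump_process S q M "\<lambda>i u. real n * F i (u / real n)" l "P n" "X n" "real n * x" .
  show "\<rho> n \<in> borel_measurable (P n)" "(\<lambda>\<omega>. X n (\<rho> n \<omega>) \<omega>) \<in> borel_measurable (P n)"
    using J.measurable_exit_at[OF region_borel T_pos, of n] J.measurable_X_exit[OF region_borel T_pos, of n]
    by (simp_all add: \<rho>_def[abs_def])
  show "chain_hitting_time (X n) h \<in> borel_measurable (P n)" by (rule J.measurable_hitting_time)
qed

lemma A_sets: "n \<ge> 1 \<Longrightarrow> A n \<in> sets (P n)"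
  unfolding A_def using measurable_X_\<rho> by measurable

lemma measurable_Z: "n \<ge> 1 \<Longrightarrow> Z n \<in> borel_measurable (P n)"
  unfolding Z_def[abs_def] using measurable_\<rho> by measurable

lemma \<rho>_bounds: "0 \<le> \<rho> n \<omega>" "\<rho> n \<omega> \<le> T"
  unfolding \<rho>_def using exit_time_bounds T_pos by auto

lemma G_lipschitz: "\<exists>C\<ge>0. C-lipschitz_on {p..w} G" and K_lipschitz: "\<exists>C\<ge>0. C-lipschitz_on {p..w} K"
  using lipschitz_of_bounded_derivative[OF G_derivative g_lipschitz]
    lipschitz_of_bounded_derivative[OF K_derivative k_lipschitz] by blast+

lemma G_bounded: "\<exists>B\<ge>0. \<forall>u\<in>{p..w}. \<bar>G u\<bar> \<le> B" and K_bounded: "\<exists>B\<ge>0. \<forall>u\<in>{p..w}. \<bar>K u\<bar> \<le> B"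
  using G_lipschitz K_lipschitz lipschitz_on_Icc_bounded by blast+

lemma f_borel:
  assumes "large n" shows "f n c \<theta> \<in> borel_measurable borel"
proof -
  have clip: "continuous_on UNIV (\<lambda>u. clip n (u / real n))"
    unfolding clip_def using assms by (intro continuous_intros) (auto simp: large_def)
  have "continuous_on UNIV (\<lambda>u. G (clip n (u / real n)))" "continuous_on UNIV (\<lambda>u. K (clip n (u / real n)))"
    using clip_range[OF assms]
    by (auto intro!: continuous_on_compose2[OF DERIV_continuous_on[OF G_derivative] clip]
        continuous_on_compose2[OF DERIV_continuous_on[OF K_derivative] clip])
  then have "continuous_on UNIV (f n c \<theta>)" unfolding f_def by (intro continuous_intros)
  then show ?thesis by (rule borel_measurable_continuous_onI)
qed

lemma I_eq: "exp (- (\<theta> * a n) * \<rho> n \<omega>) * f n (a n) \<theta> (X n (\<rho> n \<omega>) \<omega>) = I \<theta> n \<omega>"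
  by (simp add: I_def f_def Y_def s_def exp_add[symmetric] algebra_simps)

lemma measurable_I:
  assumes "large n" "n \<ge> 1" shows "I \<theta> n \<in> borel_measurable (P n)"
  unfolding I_eq[symmetric]
  using measurable_\<rho>[OF assms(2)] measurable_compose[OF measurable_X_\<rho>[OF assms(2)] f_borel[OF assms(1)]]
  by measurable

lemma f_bounded:
  assumes "large n" shows "\<exists>B. \<forall>v. f n c \<theta> v \<le> B"
proof -
  obtain BG where BG: "BG \<ge> 0" "\<forall>u\<in>{p..w}. \<bar>G u\<bar> \<le> BG" using G_bounded by blast
  obtain BK where BK: "BK \<ge> 0" "\<forall>u\<in>{p..w}. \<bar>K u\<bar> \<le> BK" using K_bounded by blast
  have "f n c \<theta> v \<le> exp (\<bar>\<theta> * c\<bar> * BG + \<bar>\<theta>\<^sup>2 * (c\<^sup>2 / real n)\<bar> * BK)" for v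
  proof -
    let ?y = "clip n (v / real n)"
    have y: "?y \<in> {p..w}" by (rule clip_range[OF assms])
    have mult: "z * v \<le> \<bar>z\<bar> * B" if "\<bar>v\<bar> \<le> B" for z v B :: real
      using order_trans[OF abs_ge_self[of "z * v"]] mult_left_mono[OF that abs_ge_zero[of z]]
      by (simp add: abs_mult)
    have "\<theta> * c * G ?y \<le> \<bar>\<theta> * c\<bar> * BG" using BG(2) y by (intro mult) simp
    moreover have "\<theta>\<^sup>2 * (c\<^sup>2 / real n) * K ?y \<le> \<bar>\<theta>\<^sup>2 * (c\<^sup>2 / real n)\<bar> * BK"
      using BK(2) y by (intro mult) simp
    ultimately show ?thesis by (simp add: f_def)
  qed
  then show ?thesis by blast
qed

lemma integrable_I:
  assumes n: "large n" "n \<ge> 1" shows "integrable (P n) (I \<theta> n)"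
proof -
  interpret prob_space "P n" using prob_space_P n by blast
  obtain B where B: "\<forall>v. f n (a n) \<theta> v \<le> B" using f_bounded[OF n(1)] by blast
  have "norm (I \<theta> n \<omega>) \<le> exp (\<bar>\<theta> * a n\<bar> * T) * B" for \<omega>
  proof -
    have "- (\<theta> * a n) * \<rho> n \<omega> \<le> \<bar>\<theta> * a n\<bar> * T"
      using \<rho>_bounds[of n \<omega>] by (smt (verit) abs_ge_minus_self mult_mono)
    moreover have "0 \<le> f n (a n) \<theta> v" for v by (simp add: f_def)
    ultimately show ?thesis
      unfolding I_eq[symmetric] real_norm_def abs_mult using B by (intro mult_mono) auto
  qed
  then show ?thesis using measurable_I[OF n] by (intro integrable_const_bound) auto
qed

lemma mean_I_bounds:
  "\<exists>C\<ge>0. \<forall>n\<ge>1. large n \<longrightarrow> 1 \<le> a n \<longrightarrow> a n \<le> real n \<longrightarrow> C * a n \<le> real n \<longrightarrow>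
     exp (- (C * s n * (a n / real n + 1 / a n)) * T) \<le> (\<integral>\<omega>. I \<theta> n \<omega> \<partial>P n) \<and>
     (\<integral>\<omega>. I \<theta> n \<omega> \<partial>P n) \<le> exp ((C * s n * (a n / real n + 1 / a n)) * T)"
proof -
  obtain C where C: "C \<ge> 0" "\<And>n c. large n \<Longrightarrow> 1 \<le> c \<Longrightarrow> C * c \<le> real n \<Longrightarrow> c \<le> real n \<Longrightarrow>
      \<forall>u\<in>region n. \<bar>dd_generator M l F n (f n c \<theta>) u - \<theta> * c * f n c \<theta> u\<bar>
         \<le> C * (c\<^sup>2 / real n) * (c / real n + 1 / c) * f n c \<theta> u"
    using generator_eigenvalue by blast
  have "\<forall>i\<in>{1..M}. \<exists>B\<ge>0. \<forall>u\<in>{p..w}. \<bar>F i u\<bar> \<le> B"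
    using F_lipschitz lipschitz_on_Icc_bounded lipschitz_on_subset subset_UNIV by metis
  then obtain B where B: "\<And>i u. i \<in> {1..M} \<Longrightarrow> u \<in> {p..w} \<Longrightarrow> \<bar>F i u\<bar> \<le> B i" by metis
  have "exp (- (C * s n * (a n / real n + 1 / a n)) * T) \<le> (\<integral>\<omega>. I \<theta> n \<omega> \<partial>P n) \<and>
     (\<integral>\<omega>. I \<theta> n \<omega> \<partial>P n) \<le> exp ((C * s n * (a n / real n + 1 / a n)) * T)"
    if n: "n \<ge> 1" "large n" "1 \<le> a n" "a n \<le> real n" "C * a n \<le> real n" for n
  proof -
    obtain S p' where "jump_process S p' M (\<lambda>i u. real n * F i (u / real n)) l (P n) (X n) (real n * x)"
      using obtain_process[OF n(1)] .
    then interpret J: jump_process S p' M "\<lambda>i u. real n * F i (u / real n)" l "P n" "X n" "real n * x" .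
    have L: "J.L h u = dd_generator M l F n h u" for h u
      by (simp add: J.L_def dd_generator_def sum_distrib_left mult.assoc)
    have f0: "f n (a n) \<theta> (real n * x) = 1"
    proof -
      have "clip n x = x"
        using points ell_nonneg by (simp add: clip_def add_increasing2 min_absorb2)
      then show ?thesis using n by (simp add: f_def G_x K_x)
    qed
    obtain Bf where Bf: "\<forall>v. f n (a n) \<theta> v \<le> Bf" using f_bounded[OF n(2)] by blast
    \<comment> \<open>This bound grows with \<open>n\<close>, which is harmless: for each fixed
      \<open>n\<close> only its finiteness matters.\<close>
    define Q where "Q = (\<Sum>i=1..M. real n * B i)"
    have Q: "J.q u \<le> Q" if "u / real n \<in> {p..w}" for u
      unfolding J.q_def Q_def using B[OF _ that] by (intro sum_mono mult_left_mono) (auto simp: abs_le_iff)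
    define \<eta> where "\<eta> = C * s n * (a n / real n + 1 / a n)"
    have \<eta>: "0 \<le> \<eta>" using C(1) n s_pos[OF n(1)] unfolding \<eta>_def
      by (intro mult_nonneg_nonneg add_nonneg_nonneg) auto
    have Q1: "J.q u \<le> Q" if "u \<in> region n" for u
      using region_scaled[OF n(2) that] \<alpha> points by (intro Q) auto
    have Q2: "J.q (u + l i) \<le> Q" if "u \<in> region n" "i \<in> {1..M}" for u i
      using region_neighbours(2)[OF n(2) that] by (intro Q) (simp add: add_divide_distrib)
    have eig: "\<bar>J.L (f n (a n) \<theta>) u - \<theta> * a n * f n (a n) \<theta> u\<bar> \<le> \<eta> * f n (a n) \<theta> u" if "u \<in> region n" for u
      using C(2)[OF n(2,3,5,4)] that by (simp add: L \<eta>_def s_def)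
    have fpos: "0 < f n (a n) \<theta> v" for v by (simp add: f_def)
    note bnd = J.exit_mgf_bounds[OF region_borel[of n] T_pos f_borel[OF n(2)] fpos Bf[rule_format] Q1 Q2 eig \<eta>]
    show ?thesis
      using bnd unfolding \<rho>_def[symmetric] I_eq f0 \<eta>_def[symmetric] by simp
  qed
  then show ?thesis using C(1) by blast
qed

text \<open>The error exponent is \<open>s n\<close> times C T (a_n / n + 1 / a_n), a factor that
  tends to 0.\<close>

lemma mean_I_rate: "has_exp_rate s (\<lambda>n. \<integral>\<omega>. I \<theta> n \<omega> \<partial>P n) 0"
  unfolding has_exp_rate_def
proof (intro allI impI)
  fix e :: real assume e: "e > 0"
  obtain C where C: "C \<ge> 0" "\<And>n. n \<ge> 1 \<Longrightarrow> large n \<Longrightarrow> 1 \<le> a n \<Longrightarrow> a n \<le> real n \<Longrightarrow> C * a n \<le> real n \<Longrightarrow>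
     exp (- (C * s n * (a n / real n + 1 / a n)) * T) \<le> (\<integral>\<omega>. I \<theta> n \<omega> \<partial>P n) \<and>
     (\<integral>\<omega>. I \<theta> n \<omega> \<partial>P n) \<le> exp ((C * s n * (a n / real n + 1 / a n)) * T)"
    using mean_I_bounds by blast
  have inv: "(\<lambda>n. 1 / a n) \<longlonglongrightarrow> 0"
    using tendsto_inverse_0_at_top[OF a_at_top] by (simp add: inverse_eq_divide)
  have "(\<lambda>n. C * T * (a n / real n + 1 / a n)) \<longlonglongrightarrow> C * T * (0 + 0)"
    by (intro tendsto_intros a_small inv)
  then have "\<forall>\<^sub>F n in sequentially. C * T * (a n / real n + 1 / a n) < e"
    using e by (intro order_tendstoD(2)[of _ "C * T * (0 + 0)"]) auto
  then show "\<forall>\<^sub>F n in sequentially. exp (s n * (0 - e)) \<le> (\<integral>\<omega>. I \<theta> n \<omega> \<partial>P n) \<and>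
      (\<integral>\<omega>. I \<theta> n \<omega> \<partial>P n) \<le> exp (s n * (0 + e))"
    using eventually_scales[of C]
  proof eventually_elim
    case (elim n)
    have "s n * (C * T * (a n / real n + 1 / a n)) \<le> s n * e"
      using elim s_pos[of n] by (intro mult_left_mono) auto
    then have le: "(C * s n * (a n / real n + 1 / a n)) * T \<le> s n * e" by (simp add: mult_ac)
    have "exp (s n * (0 - e)) \<le> exp (- (C * s n * (a n / real n + 1 / a n)) * T)"
      using le by simp
    moreover have "exp ((C * s n * (a n / real n + 1 / a n)) * T) \<le> exp (s n * (0 + e))"
      using le by simp
    moreover note C(2)[of n]
    ultimately show ?case using elim by (meson order_trans)
  qed
qed

text \<open>Before the exit the path is below \<open>n r\<close> and at the exit it is not, so the
  infimum is attained there. The overshoot bound is immediate from the clipping.\<close>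

lemma on_A:
  assumes n: "large n" "n \<ge> 1" and \<omega>: "\<omega> \<in> A n"
  shows "r \<le> Y n \<omega>" "Y n \<omega> \<le> r + ell / real n" "chain_hitting_time (X n) (real n * r) \<omega> = ereal (\<rho> n \<omega>)"
proof -
  have e: "ell / real n \<ge> 0" using ell_nonneg by simp
  have "r \<le> X n (\<rho> n \<omega>) \<omega> / real n" using \<omega> n by (simp add: A_def field_simps)
  then show "r \<le> Y n \<omega>" using e by (simp add: Y_def clip_def)
  show "Y n \<omega> \<le> r + ell / real n" using e points by (simp add: Y_def clip_def)
  show "chain_hitting_time (X n) (real n * r) \<omega> = ereal (\<rho> n \<omega>)"
    unfolding chain_hitting_time_def
  proof (rule antisym)
    show "Inf (ereal ` {t. 0 \<le> t \<and> real n * r \<le> X n t \<omega>}) \<le> ereal (\<rho> n \<omega>)"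
      using \<omega> \<rho>_bounds by (intro Inf_lower) (auto simp: A_def)
    show "ereal (\<rho> n \<omega>) \<le> Inf (ereal ` {t. 0 \<le> t \<and> real n * r \<le> X n t \<omega>})"
    proof (intro Inf_greatest, clarify)
      fix t assume t: "0 \<le> t" "real n * r \<le> X n t \<omega>"
      have "\<not> t < \<rho> n \<omega>"
        using before_exit_time[of T t "region n" "\<lambda>t. X n t \<omega>"] t T_pos
        by (auto simp: \<rho>_def region_def)
      then show "ereal (\<rho> n \<omega>) \<le> ereal t" by simp
    qed
  qed
qed

text \<open>The two ways to miss the good event: \<open>- G \<alpha>\<close> for an exit at the
  lower end, 1 = T - G r for reaching the horizon.\<close>

definition gap :: real where "gap = min (- G \<alpha>) 1"

lemma gap_pos: "gap > 0"
  using G_strict_mono[of \<alpha> x] \<alpha> points by (simp add: gap_def G_x)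

text \<open>Failing to hit \<open>r\<close> by time \<open>T\<close> means leaving below \<open>\<alpha> < x\<close> or staying below \<open>r\<close> past the time
  \<open>G r\<close>; either way \<open>G (Y n \<omega>) - \<rho> n \<omega>\<close> is bounded away from 0.\<close>

lemma off_A:
  assumes n: "large n" "n \<ge> 1" and \<omega>: "\<omega> \<in> Ac n"
  shows "G (Y n \<omega>) - \<rho> n \<omega> \<le> - gap"
proof -
  have npos: "real n > 0" using n by simp
  have e: "ell / real n \<ge> 0" using ell_nonneg by simp
  have range: "Y n \<omega> \<in> {p..w}" unfolding Y_def by (rule clip_range[OF n(1)])
  have below: "X n (\<rho> n \<omega>) \<omega> < real n * r" using \<omega> by (auto simp: A_def)
  have path: "pure_jump_path (\<lambda>t. X n t \<omega>)"
    using process[OF n(2)] \<omega> by (simp add: pure_jump_markov_process_def)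
  show ?thesis
  proof (cases "\<rho> n \<omega> < T")
    case True
    then have "X n (\<rho> n \<omega>) \<omega> \<notin> region n"
      using at_exit_time[OF path, of T "region n"] T_pos by (simp add: \<rho>_def)
    then have "X n (\<rho> n \<omega>) \<omega> / real n < \<alpha>"
      using below npos by (auto simp: region_def field_simps)
    then have "Y n \<omega> \<le> \<alpha>" using \<alpha> by (simp add: Y_def clip_def)
    then have "G (Y n \<omega>) \<le> G \<alpha>" using range \<alpha> points by (intro G_mono) auto
    then show ?thesis using \<rho>_bounds(1)[of n \<omega>] by (simp add: gap_def)
  next
    case False
    then have \<rho>T: "\<rho> n \<omega> = T" using \<rho>_bounds(2)[of n \<omega>] by simp
    have "X n (\<rho> n \<omega>) \<omega> / real n < r" using below npos by (simp add: field_simps)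
    then have "Y n \<omega> \<le> r" using e points by (simp add: Y_def clip_def)
    then have "G (Y n \<omega>) \<le> G r" using range points by (intro G_mono) auto
    then show ?thesis unfolding \<rho>T by (simp add: gap_def T_def)
  qed
qed

text \<open>Compare with the parameter \<theta> - 1: the quotient of the two functionals is the
  exponential of a_n (G (Y) - \<rho>) + s_n (2 \<theta> - 1) K (Y), which off \<open>A\<close> is at
  most \<open>- gap * a n + C * s n\<close>. The functional at \<theta> - 1 has mean at most exp
  (s_n), and a_n / s_n = n / a_n tends to infinity.\<close>

lemma off_A_superexponential:
  "\<forall>\<^sub>F n in sequentially. (\<integral>\<omega>. indicator (Ac n) \<omega> * I \<theta> n \<omega> \<partial>P n) \<le> exp (- R * s n)"
proof -
  obtain BK where BK: "BK \<ge> 0" "\<forall>u\<in>{p..w}. \<bar>K u\<bar> \<le> BK" using K_bounded by blast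
  define C where "C = \<bar>2 * \<theta> - 1\<bar> * BK"
  have "\<forall>\<^sub>F n in sequentially. (\<integral>\<omega>. I (\<theta> - 1) n \<omega> \<partial>P n) \<le> exp (s n * (0 + 1))"
    using mean_I_rate[of "\<theta> - 1"] unfolding has_exp_rate_def
    by (auto dest!: spec[of _ 1] elim: eventually_mono)
  moreover have "\<forall>\<^sub>F n in sequentially. (\<bar>C + 1 + R\<bar> / gap) * a n \<le> real n"
    using eventually_scales[of "\<bar>C + 1 + R\<bar> / gap"] by eventually_elim simp
  ultimately show ?thesis using eventually_scales[of 0]
  proof eventually_elim
    case (elim n)
    then have n: "large n" "n \<ge> 1" and an: "a n \<ge> 1" by auto
    have sets: "Ac n \<in> sets (P n)" using A_sets[OF n(2)] by auto
    have "(\<integral>\<omega>. indicator (Ac n) \<omega> * I \<theta> n \<omega> \<partial>P n)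
        \<le> (\<integral>\<omega>. exp (- gap * a n + C * s n) * I (\<theta> - 1) n \<omega> \<partial>P n)"
    proof (rule integral_mono)
      show "integrable (P n) (\<lambda>\<omega>. indicator (Ac n) \<omega> * I \<theta> n \<omega>)"
        using integrable_real_mult_indicator[OF sets integrable_I[OF n]] by (simp add: mult.commute)
      show "integrable (P n) (\<lambda>\<omega>. exp (- gap * a n + C * s n) * I (\<theta> - 1) n \<omega>)"
        using integrable_I[OF n] by simp
      show "indicator (Ac n) \<omega> * I \<theta> n \<omega> \<le> exp (- gap * a n + C * s n) * I (\<theta> - 1) n \<omega>" for \<omega>
      proof (cases "\<omega> \<in> Ac n")
        case True
        define J where "J = G (Y n \<omega>) - \<rho> n \<omega>"
        have J: "a n * J \<le> a n * (- gap)"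
          unfolding J_def using off_A[OF n True] an by (intro mult_left_mono) auto
        have "Y n \<omega> \<in> {p..w}" unfolding Y_def by (rule clip_range[OF n(1)])
        then have "\<bar>(2 * \<theta> - 1) * K (Y n \<omega>)\<bar> \<le> C"
          unfolding C_def abs_mult using BK by (intro mult_left_mono) auto
        then have "s n * ((2 * \<theta> - 1) * K (Y n \<omega>)) \<le> s n * C"
          using s_pos[OF n(2)] by (intro mult_left_mono) auto
        moreover have "\<theta> * a n * J + \<theta>\<^sup>2 * s n * K (Y n \<omega>)
            = (a n * J + s n * ((2 * \<theta> - 1) * K (Y n \<omega>))) + ((\<theta> - 1) * a n * J + (\<theta> - 1)\<^sup>2 * s n * K (Y n \<omega>))"
          by (simp add: power2_eq_square algebra_simps)
        ultimately have "I \<theta> n \<omega> \<le> exp (- gap * a n + C * s n) * I (\<theta> - 1) n \<omega>"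
          unfolding I_def J_def[symmetric] exp_add[symmetric] using J by (simp add: mult.commute)
        then show ?thesis using True by simp
      qed (simp add: I_def)
    qed
    also have "\<dots> = exp (- gap * a n + C * s n) * (\<integral>\<omega>. I (\<theta> - 1) n \<omega> \<partial>P n)" by simp
    also have "\<dots> \<le> exp (- gap * a n + C * s n) * exp (s n * (0 + 1))"
      using elim by (intro mult_left_mono) auto
    also have "\<dots> \<le> exp (- R * s n)"
    proof -
      have "\<bar>C + 1 + R\<bar> * a n \<le> gap * real n"
        using elim gap_pos by (simp add: field_simps)
      then have "\<bar>C + 1 + R\<bar> * a n * (a n / real n) \<le> gap * real n * (a n / real n)"
        using an by (intro mult_right_mono) auto
      then have "\<bar>C + 1 + R\<bar> * s n \<le> gap * a n"
        using n by (simp add: s_def power2_eq_square)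
      moreover have "(C + 1 + R) * s n \<le> \<bar>C + 1 + R\<bar> * s n"
        using s_pos[OF n(2)] by (intro mult_right_mono) auto
      ultimately have "C * s n + s n + R * s n \<le> gap * a n" by (simp add: algebra_simps)
      then show ?thesis unfolding exp_add[symmetric] by simp
    qed
    finally show ?case .
  qed
qed

text \<open>On \<open>A\<close> the position is within ell / n of \<open>r\<close>. Replacing G (Y)
  by \<open>G r\<close> changes the exponent by order a_n ell / n = s_n ell / a_n, and replacing K
  (Y) by K r = - V / 2 by order s_n ell / n.\<close>

lemma on_A_exponent:
  "\<exists>d. d \<longlonglongrightarrow> 0 \<and> (\<forall>n\<ge>1. large n \<longrightarrow> (\<forall>\<omega>\<in>A n.
     \<bar>(\<theta> * a n * (G (Y n \<omega>) - \<rho> n \<omega>) + \<theta>\<^sup>2 * s n * K (Y n \<omega>))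
        - (\<theta> * s n * Z n \<omega> - s n * (V * \<theta>\<^sup>2 / 2))\<bar> \<le> s n * d n))"
proof -
  obtain CG where CG: "CG \<ge> 0" "CG-lipschitz_on {p..w} G" using G_lipschitz by blast
  obtain CK where CK: "CK \<ge> 0" "CK-lipschitz_on {p..w} K" using K_lipschitz by blast
  define d where "d n = \<bar>\<theta>\<bar> * CG * ell * (1 / a n) + \<theta>\<^sup>2 * CK * (ell / real n)" for n
  have inv: "(\<lambda>n. 1 / a n) \<longlonglongrightarrow> 0"
    using tendsto_inverse_0_at_top[OF a_at_top] by (simp add: inverse_eq_divide)
  have "d \<longlonglongrightarrow> \<bar>\<theta>\<bar> * CG * ell * 0 + \<theta>\<^sup>2 * CK * 0"
    unfolding d_def by (intro tendsto_intros inv lim_const_over_n)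
  moreover have "\<bar>(\<theta> * a n * (G (Y n \<omega>) - \<rho> n \<omega>) + \<theta>\<^sup>2 * s n * K (Y n \<omega>))
        - (\<theta> * s n * Z n \<omega> - s n * (V * \<theta>\<^sup>2 / 2))\<bar> \<le> s n * d n"
    if n: "n \<ge> 1" "large n" and \<omega>: "\<omega> \<in> A n" for n \<omega>
  proof -
    have an: "a n > 0" and sn: "s n > 0" and npos: "real n > 0" using a_pos s_pos n by auto
    note onA = on_A[OF n(2,1) \<omega>]
    have Y: "Y n \<omega> \<in> {p..w}" unfolding Y_def by (rule clip_range[OF n(2)])
    have rI: "r \<in> {p..w}" using points by simp
    have dist: "dist (Y n \<omega>) r \<le> ell / real n" using onA by (simp add: dist_real_def)
    have dG: "\<bar>G (Y n \<omega>) - G r\<bar> \<le> CG * (ell / real n)"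
      using lipschitz_onD[OF CG(2) Y rI] mult_left_mono[OF dist CG(1)] by (simp add: dist_real_def)
    have dK: "\<bar>K (Y n \<omega>) - K r\<bar> \<le> CK * (ell / real n)"
      using lipschitz_onD[OF CK(2) Y rI] mult_left_mono[OF dist CK(1)] by (simp add: dist_real_def)
    have sZ: "s n * Z n \<omega> = a n * (G r - \<rho> n \<omega>)"
      using an npos by (simp add: s_def Z_def power2_eq_square)
    have eq: "(\<theta> * a n * (G (Y n \<omega>) - \<rho> n \<omega>) + \<theta>\<^sup>2 * s n * K (Y n \<omega>))
        - (\<theta> * s n * Z n \<omega> - s n * (V * \<theta>\<^sup>2 / 2))
      = \<theta> * a n * (G (Y n \<omega>) - G r) + \<theta>\<^sup>2 * s n * (K (Y n \<omega>) - K r)"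
      unfolding mult.assoc[of \<theta>] sZ K_r by (simp add: algebra_simps)
    have "\<bar>\<theta> * a n * (G (Y n \<omega>) - G r) + \<theta>\<^sup>2 * s n * (K (Y n \<omega>) - K r)\<bar>
        \<le> \<bar>\<theta> * a n * (G (Y n \<omega>) - G r)\<bar> + \<bar>\<theta>\<^sup>2 * s n * (K (Y n \<omega>) - K r)\<bar>"
      by (rule abs_triangle_ineq)
    also have "\<dots> = \<bar>\<theta>\<bar> * a n * \<bar>G (Y n \<omega>) - G r\<bar> + \<theta>\<^sup>2 * s n * \<bar>K (Y n \<omega>) - K r\<bar>"
      using an sn by (simp add: abs_mult)
    also have "\<dots> \<le> \<bar>\<theta>\<bar> * a n * (CG * (ell / real n)) + \<theta>\<^sup>2 * s n * (CK * (ell / real n))"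
      using dG dK an sn by (intro add_mono mult_left_mono) auto
    also have "\<dots> = s n * d n"
      using an npos by (simp add: d_def s_def power2_eq_square field_simps)
    finally show ?thesis unfolding eq .
  qed
  ultimately show ?thesis by auto
qed

lemma integrable_exp_Z:
  assumes n: "n \<ge> 1"
  shows "integrable (P n) (\<lambda>\<omega>. indicator (A n) \<omega> * exp (c * Z n \<omega>))"
proof -
  interpret prob_space "P n" using prob_space_P n by blast
  define B where "B = \<bar>c\<bar> * (real n / a n * (G r + T))"
  have "norm (indicator (A n) \<omega> * exp (c * Z n \<omega>)) \<le> exp B" for \<omega>
  proof -
    have "\<bar>Z n \<omega>\<bar> \<le> real n / a n * (G r + T)"
      using \<rho>_bounds[of n \<omega>] G_r_pos a_pos[OF n] unfolding Z_def abs_mult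
      by (intro mult_mono) auto
    then have "\<bar>c\<bar> * \<bar>Z n \<omega>\<bar> \<le> B" unfolding B_def by (rule mult_left_mono) simp
    then have "c * Z n \<omega> \<le> B" using abs_ge_self[of "c * Z n \<omega>"] unfolding abs_mult by linarith
    then show ?thesis by (auto simp: indicator_def)
  qed
  moreover have "(\<lambda>\<omega>. indicator (A n) \<omega> * exp (c * Z n \<omega>)) \<in> borel_measurable (P n)"
    using A_sets[OF n] measurable_Z[OF n] by measurable
  ultimately show ?thesis by (intro integrable_const_bound) auto
qed

text \<open>On \<open>A\<close> the functional is exp (\<theta> s_n Z_n - s_n V \<theta>^2 / 2 +
  o(s_n)), its full mean is exp (o(s_n)), and the part off \<open>A\<close> is negligible. The error
  \<open>e\<close> is split into \<open>e / 4\<close> for the exponent and \<open>e / 4\<close> for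
  the mean; the part off \<open>A\<close> is at most exp (- s_n e / 2), no more than half the lower
  bound for the mean once s_n >= 4 ln 2 / e.\<close>

lemma mgf_rate:
  "has_exp_rate s (\<lambda>n. \<integral>\<omega>. indicator (A n) \<omega> * exp (\<theta> * s n * Z n \<omega>) \<partial>P n) (V * \<theta>\<^sup>2 / 2)"
  unfolding has_exp_rate_def
proof (intro allI impI)
  fix e :: real assume e: "e > 0"
  define v where "v = V * \<theta>\<^sup>2 / 2"
  obtain d where d: "d \<longlonglongrightarrow> 0" "\<And>n \<omega>. n \<ge> 1 \<Longrightarrow> large n \<Longrightarrow> \<omega> \<in> A n \<Longrightarrow>
     \<bar>(\<theta> * a n * (G (Y n \<omega>) - \<rho> n \<omega>) + \<theta>\<^sup>2 * s n * K (Y n \<omega>))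
        - (\<theta> * s n * Z n \<omega> - s n * v)\<bar> \<le> s n * d n"
    using on_A_exponent[of \<theta>] unfolding v_def by blast
  have "\<forall>\<^sub>F n in sequentially. d n < e / 4" using d(1) e by (intro order_tendstoD(2)[OF d(1)]) simp
  moreover have "\<forall>\<^sub>F n in sequentially. exp (s n * (0 - e / 4)) \<le> (\<integral>\<omega>. I \<theta> n \<omega> \<partial>P n) \<and>
      (\<integral>\<omega>. I \<theta> n \<omega> \<partial>P n) \<le> exp (s n * (0 + e / 4))"
    using mean_I_rate[of \<theta>] e unfolding has_exp_rate_def by (auto dest: spec[of _ "e / 4"])
  moreover have "\<forall>\<^sub>F n in sequentially. s n \<ge> 4 * ln 2 / e"
    using s_at_top by (simp add: filterlim_at_top)
  ultimately show "\<forall>\<^sub>F n in sequentially.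
      exp (s n * (V * \<theta>\<^sup>2 / 2 - e)) \<le> (\<integral>\<omega>. indicator (A n) \<omega> * exp (\<theta> * s n * Z n \<omega>) \<partial>P n) \<and>
      (\<integral>\<omega>. indicator (A n) \<omega> * exp (\<theta> * s n * Z n \<omega>) \<partial>P n) \<le> exp (s n * (V * \<theta>\<^sup>2 / 2 + e))"
    using off_A_superexponential[of \<theta> "e / 2"] eventually_scales[of 0]
  proof eventually_elim
    case (elim n)
    then have n: "large n" "n \<ge> 1" and dn: "d n < e / 4" by auto
    note sn = s_pos[OF n(2)]
    define m where "m = (\<integral>\<omega>. indicator (A n) \<omega> * exp (\<theta> * s n * Z n \<omega>) \<partial>P n)"
    define u where "u = (\<integral>\<omega>. indicator (A n) \<omega> * I \<theta> n \<omega> \<partial>P n)"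
    define off where "off = (\<integral>\<omega>. indicator (Ac n) \<omega> * I \<theta> n \<omega> \<partial>P n)"
    have setsA: "A n \<in> sets (P n)" "Ac n \<in> sets (P n)" using A_sets[OF n(2)] by auto
    have intA: "integrable (P n) (\<lambda>\<omega>. indicator (A n) \<omega> * I \<theta> n \<omega>)"
      and intAc: "integrable (P n) (\<lambda>\<omega>. indicator (Ac n) \<omega> * I \<theta> n \<omega>)"
      using integrable_real_mult_indicator[OF setsA(1) integrable_I[OF n]]
        integrable_real_mult_indicator[OF setsA(2) integrable_I[OF n]] by (simp_all add: mult.commute)
    note intZ = integrable_exp_Z[OF n(2), of "\<theta> * s n"]
    have "(\<integral>\<omega>. I \<theta> n \<omega> \<partial>P n)
        = (\<integral>\<omega>. indicator (A n) \<omega> * I \<theta> n \<omega> + indicator (Ac n) \<omega> * I \<theta> n \<omega> \<partial>P n)"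
      by (intro Bochner_Integration.integral_cong) (auto simp: indicator_def)
    then have split: "(\<integral>\<omega>. I \<theta> n \<omega> \<partial>P n) = u + off" using intA intAc by (simp add: u_def off_def)
    have off0: "off \<ge> 0" unfolding off_def by (intro integral_nonneg_AE) (simp add: I_def)
    have off_le: "off \<le> exp (- (e / 2) * s n)" using elim by (simp add: off_def)
    have expo: "\<bar>(\<theta> * a n * (G (Y n \<omega>) - \<rho> n \<omega>) + \<theta>\<^sup>2 * s n * K (Y n \<omega>))
        - (\<theta> * s n * Z n \<omega> - s n * v)\<bar> \<le> s n * (e / 4)" if "\<omega> \<in> A n" for \<omega>
      using d(2)[OF n(2,1) that] mult_left_mono[OF less_imp_le[OF dn] less_imp_le[OF sn]] by linarith
    have "m \<le> (\<integral>\<omega>. exp (s n * (v + e / 4)) * (indicator (A n) \<omega> * I \<theta> n \<omega>) \<partial>P n)"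
      unfolding m_def
    proof (rule integral_mono[OF intZ])
      show "indicator (A n) \<omega> * exp (\<theta> * s n * Z n \<omega>)
          \<le> exp (s n * (v + e / 4)) * (indicator (A n) \<omega> * I \<theta> n \<omega>)" for \<omega>
      proof (cases "\<omega> \<in> A n")
        case True
        then have "\<theta> * s n * Z n \<omega> \<le> s n * (v + e / 4)
            + (\<theta> * a n * (G (Y n \<omega>) - \<rho> n \<omega>) + \<theta>\<^sup>2 * s n * K (Y n \<omega>))"
          using expo[OF True] unfolding abs_le_iff distrib_left[of "s n"] by linarith
        then have "exp (\<theta> * s n * Z n \<omega>) \<le> exp (s n * (v + e / 4)) * I \<theta> n \<omega>"
          unfolding I_def exp_add[symmetric] by simp
        then show ?thesis using True by simp
      qed simp
    qed (use intA in simp)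
    then have upper: "m \<le> exp (s n * (v + e / 4)) * u" by (simp add: u_def)
    have "(\<integral>\<omega>. exp (s n * (v - e / 4)) * (indicator (A n) \<omega> * I \<theta> n \<omega>) \<partial>P n) \<le> m"
      unfolding m_def
    proof (rule integral_mono[OF _ intZ])
      show "exp (s n * (v - e / 4)) * (indicator (A n) \<omega> * I \<theta> n \<omega>)
          \<le> indicator (A n) \<omega> * exp (\<theta> * s n * Z n \<omega>)" for \<omega>
      proof (cases "\<omega> \<in> A n")
        case True
        then have "s n * (v - e / 4)
            + (\<theta> * a n * (G (Y n \<omega>) - \<rho> n \<omega>) + \<theta>\<^sup>2 * s n * K (Y n \<omega>)) \<le> \<theta> * s n * Z n \<omega>"
          using expo[OF True] unfolding abs_le_iff right_diff_distrib[of "s n"] by linarith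
        then have "exp (s n * (v - e / 4)) * I \<theta> n \<omega> \<le> exp (\<theta> * s n * Z n \<omega>)"
          unfolding I_def exp_add[symmetric] by simp
        then show ?thesis using True by simp
      qed simp
    qed (use intA in simp)
    then have lower: "exp (s n * (v - e / 4)) * u \<le> m" by (simp add: u_def)
    have "u \<le> exp (s n * (0 + e / 4))" using elim split off0 by linarith
    then have "exp (s n * (v + e / 4)) * u \<le> exp (s n * (v + e / 4)) * exp (s n * (0 + e / 4))"
      by (intro mult_left_mono) auto
    also have "\<dots> = exp (s n * (v + e / 2))" unfolding exp_add[symmetric] by (simp add: algebra_simps)
    also have "\<dots> \<le> exp (s n * (v + e))" using sn e by simp
    finally have up: "m \<le> exp (s n * (v + e))" using upper by linarith
    have "exp (- (e / 2) * s n) \<le> u"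
    proof -
      have "ln 2 \<le> s n * (e / 4)" using elim e by (simp add: field_simps)
      then have "exp (ln 2 + - (e / 2) * s n) \<le> exp (s n * (0 - e / 4))" by (simp add: algebra_simps)
      then have "2 * exp (- (e / 2) * s n) \<le> exp (s n * (0 - e / 4))" unfolding exp_add by simp
      then show ?thesis using elim split off_le by linarith
    qed
    then have "exp (s n * (v - e / 4)) * exp (- (e / 2) * s n) \<le> exp (s n * (v - e / 4)) * u"
      by (intro mult_left_mono) auto
    moreover have "exp (s n * (v - e)) \<le> exp (s n * (v - e / 4)) * exp (- (e / 2) * s n)"
      unfolding exp_add[symmetric] using sn e by (simp add: algebra_simps)
    ultimately have "exp (s n * (v - e)) \<le> m" using lower by linarith
    with up show ?case by (simp add: m_def v_def)
  qed
qed

text \<open>The rate V \<theta>^2 / 2 is even in \<theta>, so \<open>Z n\<close> and its negative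
  have the same tails; the sign \<sigma> serves early and late hits at once.\<close>

lemma tail_rate:
  assumes t: "t > 0" and \<sigma>: "\<bar>\<sigma>\<bar> = 1"
  shows "has_exp_rate s (\<lambda>n. measure (P n) {\<omega> \<in> space (P n). \<omega> \<in> A n \<and> \<sigma> * Z n \<omega> > t}) (- (t\<^sup>2 / (2 * V)))"
proof (rule gaussian_tail_rate[OF s_at_top V_pos t])
  show "\<forall>\<^sub>F n in sequentially. finite_measure (P n) \<and> A n \<in> sets (P n) \<and>
      (\<lambda>\<omega>. \<sigma> * Z n \<omega>) \<in> borel_measurable (P n) \<and>
      (\<forall>\<theta>. integrable (P n) (\<lambda>\<omega>. indicator (A n) \<omega> * exp (\<theta> * (\<sigma> * Z n \<omega>))))"
    using eventually_ge_at_top[of 1]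
  proof eventually_elim
    case (elim n)
    show ?case
    proof (intro conjI allI)
      show "finite_measure (P n)" using prob_space_P[OF elim] by (rule prob_space.finite_measure)
      show "(\<lambda>\<omega>. \<sigma> * Z n \<omega>) \<in> borel_measurable (P n)" using measurable_Z[OF elim] by measurable
      show "integrable (P n) (\<lambda>\<omega>. indicator (A n) \<omega> * exp (\<theta> * (\<sigma> * Z n \<omega>)))" for \<theta>
        using integrable_exp_Z[OF elim, of "\<theta> * \<sigma>"] by (simp only: mult.assoc)
    qed (rule A_sets[OF elim])
  qed
  have sq: "(\<theta> * \<sigma>)\<^sup>2 = \<theta>\<^sup>2" for \<theta>
    using \<sigma> by (metis abs_1 abs_square_eq_1 mult.right_neutral power2_abs power_mult_distrib power_one)
  have assoc: "\<theta> * s n * (\<sigma> * Z n \<omega>) = \<theta> * \<sigma> * s n * Z n \<omega>" for \<theta> n \<omega> by simp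
  show "has_exp_rate s
      (\<lambda>n. \<integral>\<omega>. indicator (A n) \<omega> * exp (\<theta> * s n * (\<sigma> * Z n \<omega>)) \<partial>P n) (V * \<theta>\<^sup>2 / 2)" for \<theta>
    using mgf_rate[of "\<theta> * \<sigma>"] by (simp only: sq assoc)
qed

text \<open>At \<theta> = 0 the functional \<open>I\<close> is 1, so its mean off \<open>A\<close>
  is the probability of the complement.\<close>

lemma off_A_prob: "\<forall>\<^sub>F n in sequentially. measure (P n) (Ac n) \<le> exp (- R * s n)"
  using off_A_superexponential[of 0 R] by (simp add: I_def Int_absorb2 Int_absorb1)

text \<open>Off \<open>A\<close> the hitting time may be infinite or unrelated to
  \<open>\<rho> n\<close>, so the event is only required to match a tail of \<open>Z n\<close> on
  \<open>A\<close>; the rest is a superexponentially small perturbation.\<close>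

lemma event_rate:
  assumes t: "t > 0" and \<sigma>: "\<bar>\<sigma>\<bar> = 1"
    and E: "\<And>n. n \<ge> 1 \<Longrightarrow> E n \<in> sets (P n)"
    and eq: "\<And>n \<omega>. n \<ge> 1 \<Longrightarrow> large n \<Longrightarrow> \<omega> \<in> A n \<Longrightarrow> \<omega> \<in> E n \<longleftrightarrow> \<sigma> * Z n \<omega> > t"
  shows "has_exp_rate s (\<lambda>n. measure (P n) (E n)) (- (t\<^sup>2 / (2 * V)))"
proof (rule has_exp_rate_perturb[OF s_at_top tail_rate[OF t \<sigma>] _ off_A_prob])
  show "\<forall>\<^sub>F n in sequentially.
      measure (P n) {\<omega> \<in> space (P n). \<omega> \<in> A n \<and> t < \<sigma> * Z n \<omega>} \<le> measure (P n) (E n) \<and>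
      measure (P n) (E n) \<le> measure (P n) {\<omega> \<in> space (P n). \<omega> \<in> A n \<and> t < \<sigma> * Z n \<omega>}
        + measure (P n) (Ac n)"
    using eventually_large eventually_ge_at_top[of 1]
  proof eventually_elim
    case (elim n)
    interpret prob_space "P n" using prob_space_P elim by blast
    let ?W = "{\<omega> \<in> space (P n). \<omega> \<in> A n \<and> t < \<sigma> * Z n \<omega>}"
    have W: "?W \<in> sets (P n)"
      using A_sets[OF elim(2)] measurable_Z[OF elim(2)] by measurable
    have Ac: "Ac n \<in> sets (P n)" using A_sets[OF elim(2)] by auto
    have "measure (P n) ?W \<le> measure (P n) (E n)"
      using eq[OF elim(2,1)] by (intro finite_measure_mono E elim) auto
    moreover have "measure (P n) (E n) \<le> measure (P n) (?W \<union> (Ac n))"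
      using eq[OF elim(2,1)] sets.sets_into_space[OF E[OF elim(2)]] W Ac
      by (intro finite_measure_mono) auto
    moreover have "measure (P n) (?W \<union> (Ac n)) \<le> measure (P n) ?W + measure (P n) (Ac n)"
      by (rule measure_Un_le[OF W Ac])
    ultimately show ?case by linarith
  qed
qed

text \<open>\<open>Z n\<close> measures the time gained on the fluid, so a late hit is a large value
  of its negative.\<close>

lemma late_rate:
  assumes t: "t > 0"
  shows "has_exp_rate s (\<lambda>n. measure (P n) {\<omega> \<in> space (P n). ereal (real n / a n) *
      (chain_hitting_time (X n) (real n * r) \<omega> - ereal (G r)) > ereal t}) (- (t\<^sup>2 / (2 * V)))"
    (is "has_exp_rate s (\<lambda>n. measure (P n) (?E n)) _")
proof (rule event_rate[OF t, of "- 1"])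
  show "?E n \<in> sets (P n)" if "n \<ge> 1" for n
    using measurable_chain_hitting_time[OF that, of "real n * r"] by measurable
  show "\<omega> \<in> ?E n \<longleftrightarrow> - 1 * Z n \<omega> > t"
    if "n \<ge> 1" "large n" "\<omega> \<in> A n" for n \<omega>
  proof -
    have "- 1 * Z n \<omega> = real n / a n * (\<rho> n \<omega> - G r)" by (simp add: Z_def algebra_simps)
    moreover have "\<omega> \<in> space (P n)" using that by (simp add: A_def)
    ultimately show ?thesis using on_A(3)[OF that(2,1,3)] by simp
  qed
qed simp

lemma early_rate:
  assumes t: "t > 0"
  shows "has_exp_rate s (\<lambda>n. measure (P n) {\<omega> \<in> space (P n). ereal (real n / a n) *
      (chain_hitting_time (X n) (real n * r) \<omega> - ereal (G r)) < ereal (- t)}) (- (t\<^sup>2 / (2 * V)))"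
    (is "has_exp_rate s (\<lambda>n. measure (P n) (?E n)) _")
proof (rule event_rate[OF t, of 1])
  show "?E n \<in> sets (P n)" if "n \<ge> 1" for n
    using measurable_chain_hitting_time[OF that, of "real n * r"] by measurable
  show "\<omega> \<in> ?E n \<longleftrightarrow> 1 * Z n \<omega> > t"
    if "n \<ge> 1" "large n" "\<omega> \<in> A n" for n \<omega>
  proof -
    have "real n / a n * (\<rho> n \<omega> - G r) = - Z n \<omega>" by (simp add: Z_def algebra_simps)
    moreover have "\<omega> \<in> space (P n)" using that by (simp add: A_def)
    ultimately show ?thesis using on_A(3)[OF that(2,1,3)] by auto
  qed
qed simp

end

section \<open>From the hypotheses of the theorem to the setting above\<close>

lemma positive_neighbourhood:
  fixes b :: "real \<Rightarrow> real"
  assumes b: "continuous_on UNIV b" and pos: "\<And>u. u \<in> {x..r} \<Longrightarrow> b u > 0" and xr: "x < r"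
  obtains p w where "p < x" "r < w" "\<And>u. u \<in> {p..w} \<Longrightarrow> b u > 0"
proof -
  have near: "\<exists>d>0. \<forall>u. \<bar>u - v\<bar> < d \<longrightarrow> b u > 0" if "v \<in> {x..r}" for v
  proof -
    have "(b \<longlongrightarrow> b v) (at v)" using b by (simp add: continuous_on_def)
    then have "\<forall>\<^sub>F u in at v. b u > 0" using pos[OF that] by (rule order_tendstoD)
    then obtain d where "d > 0" "\<And>u. u \<noteq> v \<Longrightarrow> dist u v < d \<Longrightarrow> b u > 0"
      by (auto simp: eventually_at)
    then show ?thesis using pos[OF that] by (metis dist_real_def)
  qed
  obtain d where d: "d > 0" "\<And>u. \<bar>u - x\<bar> < d \<Longrightarrow> b u > 0" using near[of x] xr by auto
  obtain d' where d': "d' > 0" "\<And>u. \<bar>u - r\<bar> < d' \<Longrightarrow> b u > 0" using near[of r] xr by auto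
  show ?thesis
  proof
    show "x - d / 2 < x" "r < r + d' / 2" using d d' by auto
    fix u assume u: "u \<in> {x - d / 2..r + d' / 2}"
    consider "u < x" | "r < u" | "u \<in> {x..r}" by fastforce
    then show "b u > 0"
    proof cases
      case 1
      then have "\<bar>u - x\<bar> < d" using u d(1) by (auto simp: abs_if)
      then show ?thesis by (rule d(2))
    next
      case 2
      then have "\<bar>u - r\<bar> < d'" using u d'(1) by (auto simp: abs_if)
      then show ?thesis by (rule d'(2))
    qed (rule pos)
  qed
qed

text \<open>Otherwise the intermediate value theorem yields a zero of \<open>b\<close> above
  \<open>x\<close> and not above \<open>r\<close>, which would force \<open>x_infinity b x\<close>
  down to at most \<open>r\<close>.\<close>

lemma positive_before_x_infinity:
  fixes b :: "real \<Rightarrow> real"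
  assumes b: "continuous_on UNIV b" and bx: "b x > 0" and r: "ereal r < x_infinity b x" and u: "u \<in> {x..r}"
  shows "b u > 0"
proof (rule ccontr)
  assume "\<not> b u > 0"
  then obtain v where v: "x \<le> v" "v \<le> u" "b v = 0"
    using IVT2'[of b u 0 x] bx u continuous_on_subset[OF b] by (auto simp: not_less)
  then have "v > x" using bx by (cases "v = x") auto
  then have "x_infinity b x \<le> ereal v"
    unfolding x_infinity_def using v by (intro Inf_lower) auto
  then have "ereal r < ereal v" using r by (rule order_less_le_trans[rotated])
  then show False using v u by simp
qed

lemma bounded_deriv_lipschitz:
  fixes f :: "real \<Rightarrow> real"
  assumes "f C1_differentiable_on UNIV" "bdd_above (range (\<lambda>u. \<bar>deriv f u\<bar>))"
  shows "\<exists>C. C-lipschitz_on UNIV f"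
proof -
  obtain B where B: "\<And>u. \<bar>deriv f u\<bar> \<le> B" using assms(2) by (auto simp: bdd_above_def)
  have der: "(f has_real_derivative deriv f u) (at u)" for u
    using assms(1) unfolding C1_differentiable_on_def
    by (metis UNIV_I DERIV_imp_deriv has_real_derivative_iff_has_vector_derivative)
  have "B-lipschitz_on UNIV f"
  proof (rule lipschitz_onI)
    show "dist (f u) (f v) \<le> B * dist u v" for u v
      unfolding dist_norm using der B
      by (intro field_differentiable_bound[of UNIV f "deriv f"]) auto
  qed (use order_trans[OF abs_ge_zero B] in blast)
  then show ?thesis by blast
qed

theorem theorem1p3:
  fixes M :: nat and l :: "nat \<Rightarrow> real" and F :: "nat \<Rightarrow> real \<Rightarrow> real" and x :: real
    and P :: "nat \<Rightarrow> 'w measure" and X :: "nat \<Rightarrow> real \<Rightarrow> 'w \<Rightarrow> real" and a :: "nat \<Rightarrow> real"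
    and r t :: real
  assumes "M \<ge> 1"
    and "\<And>i u. i \<in> {1..M} \<Longrightarrow> F i u \<ge> 0"
    and "\<And>i. i \<in> {1..M} \<Longrightarrow> F i C1_differentiable_on UNIV"
    and "\<And>i. i \<in> {1..M} \<Longrightarrow> F i 0 = 0"
    and "\<And>i. i \<in> {1..M} \<Longrightarrow> bdd_above (range (\<lambda>u. \<bar>deriv (F i) u\<bar>))"
    and "(\<Sum>i=1..M. l i * F i x) > 0"
    and "\<And>n. n \<ge> 1 \<Longrightarrow>
           pure_jump_markov_process (P n) (dd_generator M l F n) (real n * x) (X n)"
    and "\<And>n. n \<ge> 1 \<Longrightarrow> a n > 0"
    and "(\<lambda>n. a n / real n) \<longlonglongrightarrow> 0"
    and "(\<lambda>n. sqrt (real n) / a n) \<longlonglongrightarrow> 0"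
    and "x < r" and "ereal r < x_infinity (drift M l F) x"
    and "t > 0"
  shows
    "((\<lambda>n. ereal (real n / (a n)\<^sup>2) *
        ext_ln (measure (P n) {\<omega> \<in> space (P n).
          ereal (real n / a n) *
            (chain_hitting_time (X n) (real n * r) \<omega> - ereal (fluid_hitting_time (drift M l F) x r))
          > ereal t}))
      \<longlonglongrightarrow> ereal (- (t\<^sup>2 / (2 * integral {x..r}
            (\<lambda>u. (\<Sum>i=1..M. (l i)\<^sup>2 * F i u) / (\<Sum>i=1..M. l i * F i u) ^ 3)))))
     \<and>
     ((\<lambda>n. ereal (real n / (a n)\<^sup>2) *
        ext_ln (measure (P n) {\<omega> \<in> space (P n).
          ereal (real n / a n) *
            (chain_hitting_time (X n) (real n * r) \<omega> - ereal (fluid_hitting_time (drift M l F) x r))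
          < ereal (- t)}))
      \<longlonglongrightarrow> ereal (- (t\<^sup>2 / (2 * integral {x..r}
            (\<lambda>u. (\<Sum>i=1..M. (l i)\<^sup>2 * F i u) / (\<Sum>i=1..M. l i * F i u) ^ 3)))))"
proof -
  have lip: "\<exists>C. C-lipschitz_on UNIV (F i)" if "i \<in> {1..M}" for i
    by (rule bounded_deriv_lipschitz[OF assms(3)[OF that] assms(5)[OF that]])
  obtain C where C: "C-lipschitz_on UNIV (drift M l F)"
    using lipschitz_sum_exists[of "{1..M}" UNIV F l] lip by (auto simp: drift_def[abs_def])
  have cont: "continuous_on UNIV (drift M l F)" by (rule lipschitz_on_continuous_on[OF C])
  have pos: "drift M l F u > 0" if "u \<in> {x..r}" for u
    using positive_before_x_infinity[OF cont _ assms(12) that] assms(6) by (simp add: drift_def)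
  obtain p w where pw: "p < x" "r < w" "\<And>u. u \<in> {p..w} \<Longrightarrow> drift M l F u > 0"
    using positive_neighbourhood[OF cont pos assms(11)] by blast
  interpret moderate_deviations M l F p x r w P X a
  proof
    show "0 \<le> F i u" if "i \<in> {1..M}" for i u using assms(2) that .
    show "\<exists>C. C-lipschitz_on UNIV (F i)" if "i \<in> {1..M}" for i using lip that .
    show "pure_jump_markov_process (P n) (dd_generator M l F n) (real n * x) (X n)" if "n \<ge> 1" for n
      using assms(7) that .
    show "0 < a n" if "n \<ge> 1" for n using assms(8) that .
  qed (fact pw(1) assms(11) pw(2) pw(3) assms(9) assms(10))+
  have \<tau>: "fluid_hitting_time (drift M l F) x r = G r"
    using fluid_hitting_time_eq_integral[OF C assms(11) pos] by (simp add: G_r)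
  have V: "V = integral {x..r} (\<lambda>u. (\<Sum>i=1..M. (l i)\<^sup>2 * F i u) / (\<Sum>i=1..M. l i * F i u) ^ 3)"
    by (simp add: V_def \<sigma>2_def drift_def)
  have speed: "real n / (a n)\<^sup>2 = 1 / s n" for n by (simp add: s_def)
  show ?thesis
    unfolding \<tau> V[symmetric] speed
    using has_exp_rate_ext_ln[OF s_at_top late_rate[OF assms(13)]]
      has_exp_rate_ext_ln[OF s_at_top early_rate[OF assms(13)]] by blast
qed

end
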